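(* Let $\Omega\subset\mathbb{R}^3$ be a bounded open set with smooth connected boundary. Define, for $\theta\in L^2(\Omega;\mathcal{Z}^2)$, $B\theta=-\star d\,\mathcal{S}[i^*\theta]$ (restricted to $\Omega$). Then $B:L^2(\Omega;\mathcal{Z}^2)\to L^2(\Omega;\mathcal{Z}^2)$ is bounded and self-adjoint, and there is $0<m<1$ such that for every $\theta\ne0$ $$-1<-m<\frac{\langle B\theta,\theta\rangle_\Omega}{\langle\theta,\theta\rangle_\Omega}\le 0 .$$
   Context: $L^2(\Omega;\mathcal{Z}^2)$ is the space of square-integrable 2-forms on $\Omega$ that are closed ($d\theta=0$) in the sense of distributions, with the $L^2$ inner product $\langle\cdot,\cdot\rangle_\Omega$. $\star$ is the Euclidean Hodge star with volume form $dV$; $\partial\Omega$ carries the area form $dS=i_n dV$ ($n$ the outward unit normal). For a closed 2-form $\theta$, $i^*\theta=\theta\restriction_{\partial\Omega}/dS$ is the function on $\partial\Omega$ obtained by dividing the pullback of $\theta$ to $\partial\Omega$ by $dS$; for $\theta\in L^2(\Omega;\mathcal{Z}^2)$ it is well defined as an element of $H^{-1/2}(\partial\Omega)$. $\mathcal{S}[\sigma](x)=\int_{\partial\Omega}\frac{\sigma(y)}{4\pi|x-y|}\,dS_y$ is the Laplace single layer potential. *)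

theory Defs
  imports "HOL-Analysis.Analysis"
begin

text \<open>Closed 2-forms on a domain in R^3 are represented, via the Euclidean Hodge star,
  by vector fields F with theta = i_F dV.  Then d theta = (div F) dV, the boundary
  quantity i^* theta equals the normal component F . n, and for a function u the 2-form
  star (d u) corresponds to the vector field grad u.\<close>

fun Ck_on :: "nat \<Rightarrow> (real^3) set \<Rightarrow> (real^3 \<Rightarrow> real) \<Rightarrow> bool" where
  "Ck_on 0 U f = continuous_on U f"
| "Ck_on (Suc k) U f =
     ((\<forall>x\<in>U. f differentiable (at x)) \<and>
      (\<forall>v. Ck_on k U (\<lambda>x. frechet_derivative f (at x) v)))"

definition smooth_on :: "(real^3) set \<Rightarrow> (real^3 \<Rightarrow> real) \<Rightarrow> bool" where
  "smooth_on U f \<longleftrightarrow> (\<forall>k. Ck_on k U f)"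

definition grad :: "(real^3 \<Rightarrow> real) \<Rightarrow> real^3 \<Rightarrow> real^3" where
  "grad f x = (\<chi> i. frechet_derivative f (at x) (axis i 1))"

definition smooth_boundary :: "(real^3) set \<Rightarrow> bool" where
  "smooth_boundary \<Omega> \<longleftrightarrow>
     (\<forall>p\<in>frontier \<Omega>. \<exists>U \<rho>. open U \<and> p \<in> U \<and> smooth_on U \<rho> \<and>
        (\<forall>x\<in>U. grad \<rho> x \<noteq> 0) \<and> \<Omega> \<inter> U = {x\<in>U. \<rho> x < 0})"

definition test_fun :: "(real^3) set \<Rightarrow> (real^3 \<Rightarrow> real) \<Rightarrow> bool" where
  "test_fun \<Omega> \<phi> \<longleftrightarrow> smooth_on UNIV \<phi> \<and>
     (\<exists>K. compact K \<and> K \<subseteq> \<Omega> \<and> (\<forall>x. x \<notin> K \<longrightarrow> \<phi> x = 0))"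

definition L2_field :: "(real^3) set \<Rightarrow> (real^3 \<Rightarrow> real^3) \<Rightarrow> bool" where
  "L2_field \<Omega> F \<longleftrightarrow> F measurable_on \<Omega> \<and> (\<lambda>x. (norm (F x))^2) integrable_on \<Omega>"

definition closed2 :: "(real^3) set \<Rightarrow> (real^3 \<Rightarrow> real^3) \<Rightarrow> bool" where
  "closed2 \<Omega> F \<longleftrightarrow> L2_field \<Omega> F \<and>
     (\<forall>\<phi>. test_fun \<Omega> \<phi> \<longrightarrow> integral \<Omega> (\<lambda>x. F x \<bullet> grad \<phi> x) = 0)"

definition l2_inner :: "(real^3) set \<Rightarrow> (real^3 \<Rightarrow> real^3) \<Rightarrow> (real^3 \<Rightarrow> real^3) \<Rightarrow> real" where
  "l2_inner \<Omega> F G = integral \<Omega> (\<lambda>x. F x \<bullet> G x)"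

definition laplace_kernel :: "real^3 \<Rightarrow> real^3 \<Rightarrow> real" where
  "laplace_kernel x y = 1 / (4 * pi * norm (x - y))"

text \<open>Single layer potential of the normal trace i^* theta (an element of H^{-1/2}),
  evaluated at a point x of Omega.  The H^{-1/2} pairing of i^* theta with the smooth
  boundary function y |-> 1/(4 pi |x-y|) is given by Green's formula
  < i^* theta, g|bdry > = integral over Omega of F . grad g, for any smooth extension g
  (well defined since div F = 0).\<close>
definition single_layer_trace :: "(real^3) set \<Rightarrow> (real^3 \<Rightarrow> real^3) \<Rightarrow> real^3 \<Rightarrow> real" where
  "single_layer_trace \<Omega> F x =
     integral \<Omega> (\<lambda>y. F y \<bullet> grad (SOME g. smooth_on UNIV g \<and>
                          (\<forall>z\<in>frontier \<Omega>. g z = laplace_kernel x z)) y)"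

definition B_op :: "(real^3) set \<Rightarrow> (real^3 \<Rightarrow> real^3) \<Rightarrow> real^3 \<Rightarrow> real^3" where
  "B_op \<Omega> F x = (if x \<in> \<Omega> then - grad (single_layer_trace \<Omega> F) x else 0)"

end

theory Submission
  imports Defs
begin

text \<open>Let \<open>u\<close> be the single layer potential of the normal trace of \<open>F\<close>, so that \<open>B F = - grad u\<close> in \<open>\<Omega>\<close>.
  By Green's formula \<open>u\<close> is the Newton potential of \<open>- div F\<close>, where \<open>F\<close> is extended by zero. Hence \<open>- B\<close> is the
  compression to \<open>\<Omega>\<close> of the orthogonal projection of \<open>L\<^sup>2(\<real>\<^sup>3)\<close> onto gradients; it is symmetric, nonnegative and
  contractive. All integrals become absolutely convergent if the Newton kernel is softened to
  \<open>1 / (4 \<pi> \<surd>(\<bar>x\<bar>\<^sup>2 + d))\<close>, whose negative Laplacian is a probability density: the energy identity for the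
  softened potentials is elementary, and inside \<open>\<Omega>\<close> their gradients converge pointwise to \<open>grad u\<close>, because a
  test function, to whose gradient \<open>F\<close> is orthogonal, removes the singularity of the kernel.

  For the spectral gap, the pairing of \<open>F\<close> with \<open>grad \<phi>\<close> depends only on the values of \<open>\<phi>\<close> on the boundary, up to an
  additive constant. Replacing \<open>\<phi>\<close> inside \<open>\<Omega>\<close> by reflected exterior values, and using a Poincare
  inequality in an exterior collar, which is connected because the boundary is, bounds the pairing by
  \<open>K \<parallel>F\<parallel>\<close> times the square root of the exterior energy of \<open>\<phi>\<close>. So if \<open>a\<close> and \<open>b\<close> are the interior and exterior
  energies of \<open>u\<close>, then \<open>- \<langle>B F, F\<rangle> \<le> \<parallel>F\<parallel> min (\<surd>a) (K \<surd>b)\<close> while \<open>a + b \<le> \<parallel>F\<parallel>\<^sup>2\<close>, which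
  gives \<open>- \<langle>B F, F\<rangle> \<le> K / \<surd>(1 + K\<^sup>2) \<parallel>F\<parallel>\<^sup>2\<close>.\<close>

subsection \<open>Smooth functions and cutoffs\<close>

text \<open>The second derivatives of the Newton kernel are not locally integrable, so
  \<open>grad u\<close> is a singular integral of \<open>F\<close>. Softening trades it for smooth
  kernels, but the projection identities then hold only up to a mollifier, and the softened
  quadratic form is not visibly nonnegative; its sign is read off Gram matrices of softened
  gradients at different scales, in an iterated limit. The trace enters through an arbitrary smooth
  extension of the kernel, so everything rests on orthogonality of \<open>F\<close> to gradients of
  smooth functions vanishing merely on the frontier; cutting off small values proves this and takes
  the place of a trace theorem. The exterior energy is used only for the softened potentials, which
  are smooth on the whole space; \<open>u\<close> itself is followed only inside
  \<open>\<Omega>\<close>. The final constant is the worst case \<open>a = K^2 b\<close> of the two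
  competing bounds under \<open>a + b = |F|^2\<close>.\<close>

lemma Ck_on_imp_continuous_on: "Ck_on k U f \<Longrightarrow> continuous_on U f"
proof (cases k)
  case (Suc j)
  assume "Ck_on k U f"
  then show ?thesis using Suc
    by (auto intro!: continuous_at_imp_continuous_on differentiable_imp_continuous_within)
qed simp

lemma Ck_on_SucD: "Ck_on (Suc k) U f \<Longrightarrow> Ck_on k U f"
proof (induction k arbitrary: f)
  case 0
  then show ?case using Ck_on_imp_continuous_on by fastforce
qed auto

lemma Ck_on_subset: "Ck_on k U f \<Longrightarrow> V \<subseteq> U \<Longrightarrow> Ck_on k V f"
  by (induction k arbitrary: f) (auto intro: continuous_on_subset)

lemma Ck_on_cong:
  assumes "open U" "\<And>x. x \<in> U \<Longrightarrow> f x = g x" "Ck_on k U f"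
  shows "Ck_on k U g"
  using assms(2,3)
proof (induction k arbitrary: f g)
  case 0
  then show ?case by (auto simp: continuous_on_eq)
next
  case (Suc k)
  have d: "(g has_derivative frechet_derivative f (at x)) (at x)" if "x \<in> U" for x
    using Suc.prems that assms(1)
    by (metis Ck_on.simps(2) frechet_derivative_works has_derivative_transform_within_open)
  then have fd: "frechet_derivative g (at x) = frechet_derivative f (at x)" if "x \<in> U" for x
    using that frechet_derivative_at by metis
  have "Ck_on k U (\<lambda>x. frechet_derivative g (at x) v)" for v
    by (rule Suc.IH[where f="\<lambda>x. frechet_derivative f (at x) v"]) (use Suc.prems fd in auto)
  then show ?case using d by (auto simp: differentiable_def)
qed

lemma Ck_on_Un:
  assumes "open U" "open V" "Ck_on k U f" "Ck_on k V f"
  shows "Ck_on k (U \<union> V) f"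
  using assms(3,4)
  by (induction k arbitrary: f) (auto intro: continuous_on_open_Un assms(1,2))

lemma Ck_on_const [simp]: "Ck_on k U (\<lambda>x. c)"
  by (induction k arbitrary: c) auto

lemma frechet_derivative_bounded_linear:
  "bounded_linear f \<Longrightarrow> frechet_derivative f (at x) = f"
  by (metis bounded_linear_imp_has_derivative frechet_derivative_at)

lemma Ck_on_bounded_linear: "bounded_linear f \<Longrightarrow> Ck_on k U f"
proof (induction k)
  case 0
  then show ?case by (simp add: linear_continuous_on)
next
  case (Suc k)
  then show ?case
    by (auto simp: frechet_derivative_bounded_linear bounded_linear_imp_differentiable)
qed

text \<open>Allows any explicit derivative formula in place of \<open>frechet_derivative\<close>; on
  the open set \<open>U\<close> the two agree, and \<open>Ck_on_cong\<close> transfers the lower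
  order smoothness.\<close>

lemma Ck_on_SucI:
  assumes "open U"
    and "\<And>x. x \<in> U \<Longrightarrow> (f has_derivative f' x) (at x)"
    and "\<And>v. Ck_on k U (\<lambda>x. f' x v)"
  shows "Ck_on (Suc k) U f"
proof -
  have e: "frechet_derivative f (at x) = f' x" if "x \<in> U" for x
    using assms(2)[OF that] frechet_derivative_at by metis
  have "Ck_on k U (\<lambda>x. frechet_derivative f (at x) v)" for v
    by (rule Ck_on_cong[OF assms(1) _ assms(3)[of v]]) (simp add: e)
  then show ?thesis using assms(2) by (auto simp: differentiable_def)
qed

lemma Ck_on_has_derivative:
  assumes "Ck_on (Suc k) U f" "x \<in> U"
  shows "(f has_derivative frechet_derivative f (at x)) (at x)"
  using assms frechet_derivative_works by auto

lemma Ck_on_add: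
  assumes U: "open U" and "Ck_on k U f" "Ck_on k U g"
  shows "Ck_on k U (\<lambda>x. f x + g x)"
  using assms(2,3)
proof (induction k arbitrary: f g)
  case (Suc k)
  show ?case
    by (rule Ck_on_SucI[OF U has_derivative_add[OF Ck_on_has_derivative[OF Suc.prems(1)] Ck_on_has_derivative[OF Suc.prems(2)]]])
       (use Suc in auto)
qed (auto intro: continuous_intros)

lemma Ck_on_mult:
  assumes U: "open U" and "Ck_on k U f" "Ck_on k U g"
  shows "Ck_on k U (\<lambda>x. f x * g x)"
  using assms(2,3)
proof (induction k arbitrary: f g)
  case (Suc k)
  have "Ck_on k U (\<lambda>x. f x * frechet_derivative g (at x) v + frechet_derivative f (at x) v * g x)" for v
    using Suc.prems by (intro Ck_on_add[OF U] Suc.IH) (simp_all add: Ck_on_SucD del: Ck_on.simps, simp_all)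
  then show ?case
    by (intro Ck_on_SucI[OF U has_derivative_mult[OF Ck_on_has_derivative[OF Suc.prems(1)] Ck_on_has_derivative[OF Suc.prems(2)]]])
qed (auto intro: continuous_intros)

text \<open>The whole sequence of derivatives \<open>G n\<close> is carried along so that the
  induction closes: differentiating \<open>G n (f x)\<close> yields \<open>G (Suc n) (f x)\<close>
  times a derivative of \<open>f\<close>, again of the form covered by the hypothesis for all
  \<open>n\<close>.\<close>

lemma Ck_on_real_compose:
  fixes G :: "nat \<Rightarrow> real \<Rightarrow> real"
  assumes U: "open U" and G: "\<And>n t. t \<in> I \<Longrightarrow> (G n has_real_derivative G (Suc n) t) (at t)"
    and f: "Ck_on k U f" and fI: "f ` U \<subseteq> I"
  shows "Ck_on k U (\<lambda>x. G n (f x))"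
  using f
proof (induction k arbitrary: n)
  case 0
  have "continuous_on (f ` U) (G n)"
    using G fI by (intro continuous_at_imp_continuous_on) (blast intro: DERIV_isCont)
  with 0 show ?case by (auto intro: continuous_on_compose2)
next
  case (Suc k)
  have d: "((\<lambda>x. G n (f x)) has_derivative (\<lambda>v. G (Suc n) (f x) * frechet_derivative f (at x) v)) (at x)"
    if "x \<in> U" for x
    using G[of "f x" n] fI that Ck_on_has_derivative[OF Suc.prems that]
    by (auto simp: has_field_derivative_def intro: has_derivative_compose[where f=f])
  show ?case
    by (rule Ck_on_SucI[OF U d]) (assumption, intro Ck_on_mult[OF U] Suc.IH Ck_on_SucD[OF Suc.prems], use Suc.prems in simp)
qed

lemma smooth_onD: "smooth_on U f \<Longrightarrow> Ck_on k U f" by (simp add: smooth_on_def)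
lemma smooth_on_const [simp]: "smooth_on U (\<lambda>x. c)" by (simp add: smooth_on_def)
lemma smooth_on_bounded_linear: "bounded_linear f \<Longrightarrow> smooth_on U f"
  by (simp add: smooth_on_def Ck_on_bounded_linear)
lemma smooth_on_add: "open U \<Longrightarrow> smooth_on U f \<Longrightarrow> smooth_on U g \<Longrightarrow> smooth_on U (\<lambda>x. f x + g x)"
  by (simp add: smooth_on_def Ck_on_add)
lemma smooth_on_mult: "open U \<Longrightarrow> smooth_on U f \<Longrightarrow> smooth_on U g \<Longrightarrow> smooth_on U (\<lambda>x. f x * g x)"
  by (simp add: smooth_on_def Ck_on_mult)
lemma smooth_on_cmult: "open U \<Longrightarrow> smooth_on U f \<Longrightarrow> smooth_on U (\<lambda>x. c * f x)"
  by (simp add: smooth_on_mult)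
lemma smooth_on_minus: "open U \<Longrightarrow> smooth_on U f \<Longrightarrow> smooth_on U (\<lambda>x. - f x)"
  using smooth_on_cmult[of U f "-1"] by simp
lemma smooth_on_diff: "open U \<Longrightarrow> smooth_on U f \<Longrightarrow> smooth_on U g \<Longrightarrow> smooth_on U (\<lambda>x. f x - g x)"
  using smooth_on_add[OF _ _ smooth_on_minus, of U f g] by simp
lemma smooth_on_sum: "open U \<Longrightarrow> (\<And>i. i \<in> I \<Longrightarrow> smooth_on U (f i)) \<Longrightarrow> smooth_on U (\<lambda>x. \<Sum>i\<in>I. f i x)"
  by (induction I rule: infinite_finite_induct) (auto intro: smooth_on_add)
lemma smooth_on_prod: "open U \<Longrightarrow> (\<And>i. i \<in> I \<Longrightarrow> smooth_on U (f i)) \<Longrightarrow> smooth_on U (\<lambda>x. \<Prod>i\<in>I. f i x)"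
  by (induction I rule: infinite_finite_induct) (auto intro: smooth_on_mult)
lemma smooth_on_power: "open U \<Longrightarrow> smooth_on U f \<Longrightarrow> smooth_on U (\<lambda>x. f x ^ n)"
  by (induction n) (auto intro: smooth_on_mult)
lemma smooth_on_cong: "open U \<Longrightarrow> (\<And>x. x \<in> U \<Longrightarrow> f x = g x) \<Longrightarrow> smooth_on U f \<Longrightarrow> smooth_on U g"
  unfolding smooth_on_def using Ck_on_cong by blast
lemma smooth_on_subset: "smooth_on U f \<Longrightarrow> V \<subseteq> U \<Longrightarrow> smooth_on V f"
  unfolding smooth_on_def using Ck_on_subset by blast
lemma smooth_on_Un: "open U \<Longrightarrow> open V \<Longrightarrow> smooth_on U f \<Longrightarrow> smooth_on V f \<Longrightarrow> smooth_on (U \<union> V) f"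
  by (simp add: smooth_on_def Ck_on_Un)
lemma smooth_on_real_compose:
  fixes G :: "nat \<Rightarrow> real \<Rightarrow> real"
  assumes "open U" "\<And>n t. t \<in> I \<Longrightarrow> (G n has_real_derivative G (Suc n) t) (at t)"
    "smooth_on U f" "f ` U \<subseteq> I"
  shows "smooth_on U (\<lambda>x. G n (f x))"
  unfolding smooth_on_def using Ck_on_real_compose[of U I G _ f n, OF assms(1,2) _ assms(4)] assms(3) by (simp add: smooth_on_def)
lemma smooth_on_frechet: "smooth_on U f \<Longrightarrow> smooth_on U (\<lambda>x. frechet_derivative f (at x) v)"
  unfolding smooth_on_def by (metis Ck_on.simps(2))
lemma smooth_on_has_derivative:
  "smooth_on U f \<Longrightarrow> x \<in> U \<Longrightarrow> (f has_derivative frechet_derivative f (at x)) (at x)"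
  using smooth_onD Ck_on_has_derivative by blast
lemma smooth_on_continuous_on: "smooth_on U f \<Longrightarrow> continuous_on U f"
  by (metis smooth_onD Ck_on.simps(1))

lemma smooth_on_zero_extension:
  assumes "open U" "closed K" "K \<subseteq> U" "smooth_on U f" "\<And>x. x \<notin> K \<Longrightarrow> f x = 0"
  shows "smooth_on UNIV f"
proof -
  have "smooth_on (U \<union> -K) f"
    using assms by (intro smooth_on_Un) (auto intro: smooth_on_cong[where f="\<lambda>x. 0"])
  moreover have "U \<union> -K = UNIV" using assms by auto
  ultimately show ?thesis by simp
qed

lemma smooth_on_powr:
  assumes "open U" "smooth_on U f" "\<And>x. x \<in> U \<Longrightarrow> f x > 0"
  shows "smooth_on U (\<lambda>x. f x powr a)"
proof -
  \<comment> \<open>The \<open>n\<close>-th derivative of \<open>t powr a\<close>, with the falling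
    factorial as coefficient.\<close>
  define G where "G n t = (\<Prod>i<n. a - real i) * t powr (a - real n)" for n t
  have "(G n has_real_derivative G (Suc n) t) (at t)" if "t \<in> {0<..}" for n t
    unfolding G_def using that
    by (auto intro!: derivative_eq_intros simp: algebra_simps)
  from smooth_on_real_compose[of U "{0<..}" G f 0, OF assms(1) this assms(2)] assms(3)
  show ?thesis by (auto simp: G_def)
qed

lemma smooth_on_inverse:
  assumes "open U" "smooth_on U f" "\<And>x. x \<in> U \<Longrightarrow> f x > 0"
  shows "smooth_on U (\<lambda>x. inverse (f x))"
  by (rule smooth_on_cong[OF assms(1) _ smooth_on_powr[OF assms, of "-1"]])
     (use assms(3) in \<open>auto simp: powr_minus less_imp_le\<close>)

lemma smooth_on_inner_self: "smooth_on U (\<lambda>x. (x - p) \<bullet> (x - p))" if "open U"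
proof -
  have 1: "smooth_on U (\<lambda>x::real^3. x $ i - p $ i)" for i
    by (intro smooth_on_diff that smooth_on_bounded_linear smooth_on_const bounded_linear_vec_nth)
  have "(\<lambda>x. (x - p) \<bullet> (x - p)) = (\<lambda>x. \<Sum>i\<in>UNIV. (x $ i - p $ i) * (x $ i - p $ i))"
    by (auto simp: inner_vec_def)
  then show ?thesis using 1 that by (auto intro!: smooth_on_sum smooth_on_mult)
qed

section \<open>Flat functions and smooth radial cutoffs\<close>

definition bump :: "real \<Rightarrow> real" where "bump t = (if t > 0 then exp (- inverse t) else 0)"

text \<open>A family closed under differentiation that contains \<open>bump\<close> (as
  \<open>bumpd 1\<close>): every derivative of \<open>exp (- 1/t)\<close> is a polynomial in
  \<open>1/t\<close> times the same exponential.\<close>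

definition bumpd :: "real poly \<Rightarrow> real \<Rightarrow> real" where
  "bumpd p t = (if t > 0 then poly p (inverse t) * exp (- inverse t) else 0)"

lemma poly_exp_minus_tendsto_0: "((\<lambda>x. poly p x * exp (- x)) \<longlongrightarrow> (0::real)) at_top"
proof -
  have "((\<lambda>x. \<Sum>i\<le>degree p. coeff p i * (x ^ i / exp x)) \<longlongrightarrow> (\<Sum>i\<le>degree p. coeff p i * 0)) at_top"
    by (intro tendsto_intros tendsto_power_div_exp_0)
  moreover have "(\<lambda>x. \<Sum>i\<le>degree p. coeff p i * (x ^ i / exp x)) = (\<lambda>x. poly p x * exp (- x))"
    by (auto simp: poly_altdef sum_distrib_right exp_minus divide_inverse mult.assoc)
  ultimately show ?thesis by simp
qed

text \<open>For \<open>t > 0\<close> the chain rule gives the factor \<open>1/t^2\<close>, which is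
  the polynomial \<open>[:0,0,1:]\<close> at \<open>1/t\<close>, and \<open>p - p'\<close> from the
  product rule. Only \<open>t = 0\<close> needs an argument.\<close>

lemma bumpd_has_derivative:
  "(bumpd p has_real_derivative bumpd ([:0,0,1:] * (p - pderiv p)) t) (at t)"
proof (cases "t = 0")
  case False
  show ?thesis
  proof (cases "t > 0")
    case True
    have "((\<lambda>t. poly p (inverse t) * exp (- inverse t)) has_real_derivative bumpd ([:0,0,1:] * (p - pderiv p)) t) (at t)"
      unfolding bumpd_def using True
      by (auto intro!: derivative_eq_intros simp: algebra_simps power2_eq_square)
    then show ?thesis
      by (rule has_field_derivative_transform_within_open[of _ _ _ "{0<..}"]) (use True in \<open>auto simp: bumpd_def\<close>)
  next
    case f: False
    have "((\<lambda>t. 0) has_real_derivative bumpd ([:0,0,1:] * (p - pderiv p)) t) (at t)"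
      unfolding bumpd_def using f by simp
    then show ?thesis
      by (rule has_field_derivative_transform_within_open[of _ _ _ "{..<0}"]) (use f False in \<open>auto simp: bumpd_def\<close>)
  qed
next
  case t: True
  have "((\<lambda>h. (bumpd p h - bumpd p 0) / h) \<longlongrightarrow> 0) (at 0)"
    unfolding filterlim_at_split
  proof
    have "((\<lambda>h. 0::real) \<longlongrightarrow> 0) (at_left 0)" by simp
    then show "((\<lambda>h. (bumpd p h - bumpd p 0) / h) \<longlongrightarrow> 0) (at_left 0)"
      by (rule Lim_transform_eventually) (auto simp: bumpd_def eventually_at_filter)
    \<comment> \<open>Dividing by \<open>h\<close> multiplies by \<open>1/h\<close>, hence
      \<open>pCons 0 p\<close>; with \<open>s = 1/h\<close> tending to infinity the exponential
      beats the polynomial.\<close>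
    have "((\<lambda>h. poly (pCons 0 p) (inverse h) * exp (- inverse h)) \<longlongrightarrow> 0) (at_right 0)"
      using poly_exp_minus_tendsto_0 filterlim_inverse_at_top_right by (rule filterlim_compose)
    then show "((\<lambda>h. (bumpd p h - bumpd p 0) / h) \<longlongrightarrow> 0) (at_right 0)"
      by (rule Lim_transform_eventually) (auto simp: bumpd_def eventually_at_filter field_simps)
  qed
  then show ?thesis using t by (simp add: has_field_derivative_iff bumpd_def)
qed

lemma bump_eq: "bump = bumpd 1" by (auto simp: bump_def bumpd_def)

lemma bump_has_derivative:
  "(bump has_real_derivative (if t > 0 then exp (- inverse t) / t\<^sup>2 else 0)) (at t)"
proof -
  have "bumpd ([:0, 0, 1:] * (1 - pderiv 1)) t = (if t > 0 then exp (- inverse t) / t\<^sup>2 else 0)"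
    by (auto simp: bumpd_def power2_eq_square field_simps pderiv_1)
  then show ?thesis unfolding bump_eq using bumpd_has_derivative[of 1 t] by metis
qed

lemma smooth_on_bump:
  assumes "open U" "smooth_on U f"
  shows "smooth_on U (\<lambda>x. bump (f x))"
proof -
  define p where "p n = ((\<lambda>p. [:0,0,1:] * (p - pderiv p)) ^^ n) (1::real poly)" for n
  have "smooth_on U (\<lambda>x. bumpd (p 0) (f x))"
    by (rule smooth_on_real_compose[of U UNIV "\<lambda>n. bumpd (p n)", OF assms(1) _ assms(2)])
       (use bumpd_has_derivative in \<open>auto simp: p_def\<close>)
  then show ?thesis by (simp add: p_def bump_eq)
qed

lemma bump_nonneg: "bump t \<ge> 0" and bump_le_1: "bump t \<le> 1"
  and bump_pos: "t > 0 \<Longrightarrow> bump t > 0" and bump_zero: "t \<le> 0 \<Longrightarrow> bump t = 0"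
  by (auto simp: bump_def)

text \<open>The quotient \<open>a / (a + b)\<close>, where \<open>a\<close> is positive exactly
  inside the ball of radius \<open>s\<close> and \<open>b\<close> exactly outside the one of radius
  \<open>r\<close>. Since \<open>r < s\<close> these regions cover the space, so the denominator
  never vanishes.\<close>

lemma smooth_cutoff:
  fixes p :: "real^3"
  assumes "0 < r" "r < s"
  obtains \<eta> where "smooth_on UNIV \<eta>" "\<And>x. 0 \<le> \<eta> x" "\<And>x. \<eta> x \<le> 1"
    "\<And>x. dist p x \<le> r \<Longrightarrow> \<eta> x = 1" "\<And>x. dist p x \<ge> s \<Longrightarrow> \<eta> x = 0"
proof -
  define a where "a x = bump (s\<^sup>2 - (x - p) \<bullet> (x - p))" for x
  define b where "b x = bump ((x - p) \<bullet> (x - p) - r\<^sup>2)" for x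
  have rs: "r\<^sup>2 < s\<^sup>2" using assms by (simp add: power_strict_mono)
  have pos: "a x + b x > 0" for x
  proof (cases "(x - p) \<bullet> (x - p) < s\<^sup>2")
    case True
    then show ?thesis using bump_pos[of "s\<^sup>2 - (x - p) \<bullet> (x - p)"] bump_nonneg[of "(x - p) \<bullet> (x - p) - r\<^sup>2"]
      by (simp add: a_def b_def)
  next
    case False
    then show ?thesis using rs bump_pos[of "(x - p) \<bullet> (x - p) - r\<^sup>2"] bump_nonneg[of "s\<^sup>2 - (x - p) \<bullet> (x - p)"]
      by (simp add: a_def b_def)
  qed
  have d: "(x - p) \<bullet> (x - p) = (dist p x)\<^sup>2" for x
    by (metis dist_commute dist_norm power2_norm_eq_inner)
  have sm: "smooth_on UNIV a" "smooth_on UNIV b"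
    unfolding a_def b_def
    by (intro smooth_on_bump open_UNIV smooth_on_diff smooth_on_const smooth_on_inner_self)+
  show ?thesis
  proof (rule that[of "\<lambda>x. a x * inverse (a x + b x)"])
    show "smooth_on UNIV (\<lambda>x. a x * inverse (a x + b x))"
      by (intro smooth_on_mult smooth_on_inverse smooth_on_add sm open_UNIV pos)
    fix x
    show "0 \<le> a x * inverse (a x + b x)" using pos[of x] bump_nonneg by (simp add: a_def)
    show "a x * inverse (a x + b x) \<le> 1" using pos[of x] bump_nonneg
      by (simp add: field_simps b_def)
    show "a x * inverse (a x + b x) = 1" if "dist p x \<le> r"
    proof -
      have "b x = 0" using that by (auto simp: b_def d intro!: bump_zero power_mono)
      then show ?thesis using pos[of x] by simp
    qed
    show "a x * inverse (a x + b x) = 0" if "dist p x \<ge> s"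
      using that assms by (auto simp: a_def d intro!: bump_zero power_mono)
  qed
qed

subsection \<open>Integration over Euclidean space\<close>

lemma nn_integral_lborel_affine:
  fixes t :: "'a::euclidean_space"
  assumes [measurable]: "f \<in> borel_measurable borel" and c: "c \<noteq> 0"
  shows "(\<integral>\<^sup>+x. f x \<partial>lborel) = ennreal (\<bar>c\<bar> ^ DIM('a)) * (\<integral>\<^sup>+x. f (t + c *\<^sub>R x) \<partial>lborel)"
  by (subst lborel_affine[OF c, of t]) (simp add: nn_integral_density nn_integral_distr nn_integral_cmult ennreal_power)

lemma integrable_lborel_affine:
  fixes t :: "'a::euclidean_space" and f :: "'a \<Rightarrow> 'b :: {banach, second_countable_topology}"
  assumes f: "integrable lborel f" and c: "c \<noteq> 0"
  shows "integrable lborel (\<lambda>x. f (t + c *\<^sub>R x))"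
  using f f[THEN borel_measurable_integrable] c unfolding integrable_iff_bounded
  by (subst (asm) nn_integral_lborel_affine[where c=c and t=t]) (auto simp: ennreal_mult_less_top)

lemma integral_lborel_affine:
  fixes t :: "'a::euclidean_space" and f :: "'a \<Rightarrow> 'b :: {banach, second_countable_topology}"
  assumes f: "integrable lborel f" and c: "c \<noteq> 0"
  shows "(\<integral>x. f x \<partial>lborel) = (\<bar>c\<bar> ^ DIM('a)) *\<^sub>R (\<integral>x. f (t + c *\<^sub>R x) \<partial>lborel)"
proof -
  have [measurable]: "f \<in> borel_measurable borel" using borel_measurable_integrable[OF f] by simp
  show ?thesis
    using integrable_lborel_affine[OF f c, of t]
    by (subst lborel_affine[OF c, of t]) (simp add: integral_density integral_distr)
qed

text \<open>Difference quotients in direction \<open>e\<close> have integral 0 by translation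
  invariance, and the limit passes under the integral. The bound \<open>bd\<close> covers the whole
  segment from \<open>x\<close> to \<open>x + e\<close> because the mean value theorem evaluates the
  derivative at an unknown point of it.\<close>

lemma integral_directional_derivative_eq_0:
  fixes V :: "'a::euclidean_space \<Rightarrow> real"
  assumes D: "\<And>x. (V has_derivative V' x) (at x)"
    and V: "integrable lborel V" and w: "integrable lborel w"
    and bd: "\<And>x s. 0 \<le> s \<Longrightarrow> s \<le> 1 \<Longrightarrow> \<bar>V' (x + s *\<^sub>R e) e\<bar> \<le> w x"
  shows "integrable lborel (\<lambda>x. V' x e)" "(\<integral>x. V' x e \<partial>lborel) = 0"
proof -
  define t where "t n = inverse (real (Suc n))" for n
  define Q where "Q n x = (V (x + t n *\<^sub>R e) - V x) / t n" for n x
  have t: "t n > 0" "t n \<le> 1" for n by (auto simp: t_def field_simps)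
  have t0: "t \<longlonglongrightarrow> 0" unfolding t_def by (rule LIMSEQ_inverse_real_of_nat)
  have Vs: "integrable lborel (\<lambda>x. V (x + s *\<^sub>R e))" "(\<integral>x. V (x + s *\<^sub>R e) \<partial>lborel) = (\<integral>x. V x \<partial>lborel)" for s
    using integrable_lborel_affine[OF V, of 1 "s *\<^sub>R e"] integral_lborel_affine[OF V, of 1 "s *\<^sub>R e"]
    by (simp_all add: add.commute)
  have dV: "((\<lambda>s. V (x + s *\<^sub>R e)) has_real_derivative V' (x + s *\<^sub>R e) e) (at s)" for x s
  proof -
    have "((\<lambda>s. V (x + s *\<^sub>R e)) has_derivative (\<lambda>h. V' (x + s *\<^sub>R e) (h *\<^sub>R e))) (at s)"
      by (rule has_derivative_compose[OF _ D]) (auto intro!: derivative_eq_intros)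
    moreover have "V' (x + s *\<^sub>R e) (h *\<^sub>R e) = V' (x + s *\<^sub>R e) e * h" for h
      using has_derivative_linear[OF D] by (simp add: linear_cmul)
    ultimately show ?thesis by (simp add: has_field_derivative_def)
  qed
  have lim: "(\<lambda>n. Q n x) \<longlonglongrightarrow> V' x e" for x
  proof -
    have "((\<lambda>h. (V (x + h *\<^sub>R e) - V x) / h) \<longlongrightarrow> V' x e) (at 0)"
      using dV[of x 0] by (simp add: has_field_derivative_iff)
    moreover have "filterlim t (at 0) sequentially"
      using t0 t by (auto simp: filterlim_at less_imp_neq[OF t(1), symmetric])
    ultimately show ?thesis unfolding Q_def by (rule filterlim_compose)
  qed
  have Qi: "integrable lborel (Q n)" "(\<integral>x. Q n x \<partial>lborel) = 0" for n
    unfolding Q_def using Vs V by auto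
  have [measurable]: "Q n \<in> borel_measurable lborel" for n using Qi borel_measurable_integrable by blast
  have m: "(\<lambda>x. V' x e) \<in> borel_measurable lborel"
    by (rule borel_measurable_LIMSEQ_real[OF lim]) auto
  have b: "norm (Q n x) \<le> w x" for n x
  proof -
    obtain z where z: "0 < z" "z < t n" "V (x + t n *\<^sub>R e) - V (x + 0 *\<^sub>R e) = (t n - 0) * V' (x + z *\<^sub>R e) e"
      using MVT2[OF t(1) dV] by blast
    then have "Q n x = V' (x + z *\<^sub>R e) e" using t[of n] by (simp add: Q_def)
    then show ?thesis using bd[of z x] z t[of n] by simp
  qed
  show "integrable lborel (\<lambda>x. V' x e)"
    by (rule integrable_dominated_convergence[OF m _ w, of Q]) (use lim b in auto)
  have "(\<lambda>n. \<integral>x. Q n x \<partial>lborel) \<longlonglongrightarrow> (\<integral>x. V' x e \<partial>lborel)"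
    by (rule integral_dominated_convergence[OF m _ w, of Q]) (use lim b in auto)
  then show "(\<integral>x. V' x e \<partial>lborel) = 0"
    unfolding Qi by (simp add: LIMSEQ_const_iff)
qed

text \<open>Differentiation under the integral for the full derivative. Integrability of
  \<open>f'\<close> comes from difference quotients; the remainder quotient is followed along an
  arbitrary null sequence of increments, where it tends to 0 pointwise and is dominated by
  \<open>2 * w\<close>.\<close>

lemma has_derivative_integral:
  fixes f :: "'b \<Rightarrow> 'a::euclidean_space \<Rightarrow> real"
  assumes x: "0 < r"
    and int: "\<And>z. z \<in> ball x r \<Longrightarrow> integrable M (\<lambda>y. f y z)"
    and D: "\<And>y z. y \<in> space M \<Longrightarrow> z \<in> ball x r \<Longrightarrow> (f y has_derivative f' y z) (at z)"
    and w: "integrable M w"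
    and bd: "\<And>y z v. y \<in> space M \<Longrightarrow> z \<in> ball x r \<Longrightarrow> \<bar>f' y z v\<bar> \<le> w y * norm v"
  shows "\<And>v. integrable M (\<lambda>y. f' y x v)"
    and "((\<lambda>z. \<integral>y. f y z \<partial>M) has_derivative (\<lambda>v. \<integral>y. f' y x v \<partial>M)) (at x)"
proof -
  have xr: "x \<in> ball x r" using x by simp
  have lin: "linear (f' y x)" if "y \<in> space M" for y
    using has_derivative_linear[OF D[OF that xr]] .
  have lip: "\<bar>f y (x + h) - f y x\<bar> \<le> w y * norm h" if "y \<in> space M" "norm h < r" for y h
  proof -
    have "norm (f y (x + h) - f y x) \<le> w y * norm (x + h - x)"
    proof (rule differentiable_bound[where S="ball x r" and f'="f' y"])
      show "onorm (f' y z) \<le> w y" if "z \<in> ball x r" for z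
        by (rule onorm_le) (use bd \<open>y \<in> space M\<close> that in auto)
    qed (use that D x in \<open>auto intro: has_derivative_at_withinI simp: dist_norm\<close>)
    then show ?thesis by simp
  qed
  show int': "integrable M (\<lambda>y. f' y x v)" for v
  proof -
    \<comment> \<open>Chosen so that \<open>x + c v\<close> lies in the ball even for long
      \<open>v\<close>; all later increments are multiples of \<open>v\<close> no longer than
      \<open>c v\<close>.\<close>
    define c where "c = r / (2 * (norm v + 1))"
    have c: "c > 0" "norm (c *\<^sub>R v) < r"
    proof -
      show "c > 0" using x by (simp add: c_def add_nonneg_pos)
      have "norm v / (2 * (norm v + 1)) < 1" by (simp add: divide_simps add_nonneg_pos)
      then have "r * (norm v / (2 * (norm v + 1))) < r * 1" using x by (intro mult_strict_left_mono)
      then show "norm (c *\<^sub>R v) < r" using \<open>c > 0\<close> x by (simp add: c_def)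
    qed
    define t where "t n = c * inverse (real (Suc n))" for n
    have t: "t n > 0" "t n \<le> c" for n using c by (auto simp: t_def field_simps)
    have t0: "t \<longlonglongrightarrow> 0" unfolding t_def using tendsto_mult_left[OF LIMSEQ_inverse_real_of_nat, of c] by simp
    have tr: "norm (t n *\<^sub>R v) < r" for n
    proof -
      have "norm (t n *\<^sub>R v) \<le> norm (c *\<^sub>R v)" using t[of n] c by (auto intro: mult_right_mono)
      then show ?thesis using c by linarith
    qed
    define Q where "Q n y = (f y (x + t n *\<^sub>R v) - f y x) / t n" for n y
    have lim: "(\<lambda>n. Q n y) \<longlonglongrightarrow> f' y x v" if "y \<in> space M" for y
    proof -
      have "((\<lambda>s. f y (x + s *\<^sub>R v)) has_derivative (\<lambda>h. f' y x (h *\<^sub>R v))) (at 0)"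
        by (rule has_derivative_compose[of "\<lambda>s. x + s *\<^sub>R v"]) (use D[OF that xr] in \<open>auto intro!: derivative_eq_intros\<close>)
      then have "((\<lambda>s. f y (x + s *\<^sub>R v)) has_real_derivative f' y x v) (at 0)"
        using lin[OF that] by (simp add: linear_cmul has_field_derivative_def mult.commute[of _ "f' y x v"])
      then have "((\<lambda>h. (f y (x + h *\<^sub>R v) - f y x) / h) \<longlongrightarrow> f' y x v) (at 0)"
        by (simp add: has_field_derivative_iff)
      moreover have "filterlim t (at 0) sequentially"
        using t0 t by (auto simp: filterlim_at less_imp_neq[OF t(1), symmetric])
      ultimately show ?thesis unfolding Q_def by (rule filterlim_compose)
    qed
    have Qi: "integrable M (Q n)" for n
      unfolding Q_def using int[OF xr] int[of "x + t n *\<^sub>R v"] tr[of n] by (auto simp: dist_norm)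
    then have Qm: "Q n \<in> borel_measurable M" for n using borel_measurable_integrable by blast
    have Qb: "\<bar>Q n y\<bar> \<le> w y * norm v" if "y \<in> space M" for n y
      using lip[OF that tr[of n]] t[of n] by (simp add: Q_def divide_simps abs_mult) (simp add: mult_ac)
    have m: "(\<lambda>y. f' y x v) \<in> borel_measurable M"
      by (rule borel_measurable_LIMSEQ_real[OF lim Qm])
    show ?thesis
      by (rule integrable_dominated_convergence[where s=Q and f="\<lambda>y. f' y x v" and w="\<lambda>y. w y * norm v", OF m Qm])
         (use lim Qb w in \<open>auto intro: AE_I2\<close>)
  qed
  define L where "L v = (\<integral>y. f' y x v \<partial>M)" for v
  have linL: "linear L"
  proof (rule linearI)
    fix a b :: 'a and c :: real
    have "L (a + b) = (\<integral>y. f' y x a + f' y x b \<partial>M)"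
      unfolding L_def by (rule Bochner_Integration.integral_cong) (auto simp: linear_add[OF lin])
    then show "L (a + b) = L a + L b" using int' by (simp add: L_def)
    have "L (c *\<^sub>R a) = (\<integral>y. c * f' y x a \<partial>M)"
      unfolding L_def by (rule Bochner_Integration.integral_cong) (auto simp: linear_cmul[OF lin])
    then show "L (c *\<^sub>R a) = c *\<^sub>R L a" using int' by (simp add: L_def)
  qed
  have "((\<lambda>h. ((\<integral>y. f y (x + h) \<partial>M) - (\<integral>y. f y x \<partial>M) - L h) /\<^sub>R norm h) \<longlongrightarrow> 0) (at 0)"
    unfolding tendsto_at_iff_sequentially comp_def
  proof (intro allI impI)
    fix X :: "nat \<Rightarrow> 'a" assume X0: "\<forall>i. X i \<in> UNIV - {0}" and X: "X \<longlonglongrightarrow> 0"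
    obtain N where N: "\<And>n. n \<ge> N \<Longrightarrow> norm (X n) < r"
      using X x unfolding lim_sequentially by (metis dist_0_norm dist_commute)
    define X' where "X' n = X (n + N)" for n
    define Q where "Q n y = (f y (x + X' n) - f y x - f' y x (X' n)) / norm (X' n)" for n y
    have X'r: "norm (X' n) < r" "X' n \<noteq> 0" for n using N X0 by (auto simp: X'_def)
    have X'0: "X' \<longlonglongrightarrow> 0" using LIMSEQ_ignore_initial_segment[OF X] by (simp add: X'_def[abs_def])
    have lim: "(\<lambda>n. Q n y) \<longlonglongrightarrow> 0" if "y \<in> space M" for y
    proof -
      have "((\<lambda>h. (f y (x + h) - f y x - f' y x h) /\<^sub>R norm h) \<longlongrightarrow> 0) (at 0)"
        by (rule tendsto_norm_zero_cancel)
           (use D[OF that xr] in \<open>simp add: has_derivative_at divide_inverse mult.commute abs_mult\<close>)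
      moreover have "filterlim X' (at 0) sequentially"
        using X'0 X'r by (auto simp: filterlim_at)
      ultimately have "(\<lambda>n. (f y (x + X' n) - f y x - f' y x (X' n)) /\<^sub>R norm (X' n)) \<longlonglongrightarrow> 0"
        by (rule filterlim_compose)
      then show ?thesis by (simp add: Q_def divide_inverse mult.commute)
    qed
    have Qi: "integrable M (Q n)" for n
      unfolding Q_def using int[OF xr] int[of "x + X' n"] X'r[of n] int' by (auto simp: dist_norm)
    have Qb: "norm (Q n y) \<le> 2 * w y" if "y \<in> space M" for n y
    proof -
      have "\<bar>f y (x + X' n) - f y x - f' y x (X' n)\<bar> \<le> 2 * w y * norm (X' n)"
        using lip[OF that X'r(1)[of n]] bd[OF that xr, of "X' n"] by linarith
      then show ?thesis using X'r[of n] by (simp add: Q_def divide_simps abs_mult)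
    qed
    have "(\<lambda>n. \<integral>y. Q n y \<partial>M) \<longlonglongrightarrow> (\<integral>y. 0 \<partial>M)"
      by (rule integral_dominated_convergence[where w="\<lambda>y. 2 * w y"])
         (use lim Qb w Qi borel_measurable_integrable in \<open>auto intro: AE_I2\<close>)
    moreover have "(\<integral>y. Q n y \<partial>M) = ((\<integral>y. f y (x + X' n) \<partial>M) - (\<integral>y. f y x \<partial>M) - L (X' n)) /\<^sub>R norm (X' n)" for n
      unfolding Q_def L_def using int[OF xr] int[of "x + X' n"] X'r[of n] int' by (simp add: dist_norm divide_inverse mult.commute)
    ultimately have "(\<lambda>n. ((\<integral>y. f y (x + X (n + N)) \<partial>M) - (\<integral>y. f y x \<partial>M) - L (X (n+N))) /\<^sub>R norm (X (n+N))) \<longlonglongrightarrow> 0"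
      by (simp add: X'_def)
    then show "(\<lambda>n. ((\<integral>y. f y (x + X n) \<partial>M) - (\<integral>y. f y x \<partial>M) - L (X n)) /\<^sub>R norm (X n)) \<longlonglongrightarrow> 0"
      by (rule LIMSEQ_offset)
  qed
  then have "((\<lambda>h. norm ((\<integral>y. f y (x + h) \<partial>M) - (\<integral>y. f y x \<partial>M) - L h) / norm h) \<longlongrightarrow> 0) (at 0)"
    by (auto dest: tendsto_norm_zero simp: divide_inverse mult.commute abs_mult)
  then show "((\<lambda>z. \<integral>y. f y z \<partial>M) has_derivative (\<lambda>v. \<integral>y. f' y x v \<partial>M)) (at x)"
    using linL by (simp add: has_derivative_at L_def[abs_def] linear_conv_bounded_linear)
qed

subsection \<open>The softened Newton kernel\<close>

text \<open>\<open>sg d / (4 * pi)\<close> is the Newton kernel softened at scale \<open>sqrt d\<close>; for \<open>d = 0\<close> it is the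
  Newton kernel itself, with value \<open>0\<close> at the origin.\<close>

definition sg :: "real \<Rightarrow> real^3 \<Rightarrow> real" where "sg d z = inverse (sqrt (z \<bullet> z + d))"

lemma sg_nonneg: "sg d z \<ge> 0" if "d \<ge> 0"
  using that by (simp add: sg_def)

lemma sg_arg_pos: "d > 0 \<or> d \<ge> 0 \<and> z \<noteq> 0 \<Longrightarrow> z \<bullet> z + d > 0"
  by (auto simp: add_nonneg_pos add_pos_nonneg)

lemma sg_pos: "d > 0 \<or> d \<ge> 0 \<and> z \<noteq> 0 \<Longrightarrow> sg d z > 0"
  using sg_arg_pos[of d z] by (simp add: sg_def)

lemma sg_has_derivative:
  assumes "z \<bullet> z + d > 0"
  shows "(sg d has_derivative (\<lambda>v. - (z \<bullet> v) * sg d z ^ 3)) (at z)"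
proof -
  have "((\<lambda>z. inverse (sqrt (z \<bullet> z + d))) has_derivative (\<lambda>v. - (z \<bullet> v) * sg d z ^ 3)) (at z)"
    using assms
    by (auto intro!: derivative_eq_intros simp: sg_def inner_commute power3_eq_cube field_simps)
  then show ?thesis by (simp add: sg_def[abs_def])
qed

lemma smooth_on_sg:
  assumes "open U" "\<And>z. z \<in> U \<Longrightarrow> z \<bullet> z + d > 0"
  shows "smooth_on U (sg d)"
proof -
  have "smooth_on U (\<lambda>z. (z \<bullet> z + d) powr (- 1 / 2))"
    using smooth_on_inner_self[OF assms(1), of 0] assms
    by (intro smooth_on_powr smooth_on_add smooth_on_const) auto
  then show ?thesis
    by (rule smooth_on_cong[OF assms(1), rotated])
       (use assms(2) in \<open>force simp: sg_def powr_minus powr_half_sqrt\<close>)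
qed

lemma sg_bound_norm:
  assumes d: "d \<ge> 0"
  shows "norm z * sg d z \<le> 1"
proof -
  have "norm z \<le> sqrt (z \<bullet> z + d)" using d by (simp add: norm_eq_sqrt_inner)
  moreover have "sqrt (z \<bullet> z + d) \<ge> 0" using d by simp
  ultimately show ?thesis
    by (cases "sqrt (z \<bullet> z + d) = 0") (auto simp: sg_def divide_simps simp del: real_sqrt_eq_zero_cancel_iff)
qed

text \<open>A bounded shift and a change of scale cost only a constant factor, so every decay
  estimate can be stated in powers of the single weight \<open>sg 1\<close>.\<close>

lemma sg_decay:
  assumes "d > 0" "R \<ge> 0"
  obtains C where "C > 0" "\<And>x y. norm y \<le> R \<Longrightarrow> sg d (x - y) \<le> C * sg 1 x"
proof -
  \<comment> \<open>From \<open>|x|^2 + 1 \<le> 2 |x - y|^2 + (1 + 2 R^2)\<close>: the 2 serves the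
    quadratic term, and the constant term is paid for by \<open>d\<close>.\<close>
  define K where "K = 2 + (1 + 2 * R\<^sup>2) / d"
  have K: "K > 0" using assms by (simp add: K_def add_pos_nonneg)
  have "sg d (x - y) \<le> sqrt K * sg 1 x" if "norm y \<le> R" for x y
  proof -
    have "norm x \<le> norm (x - y) + R" using that norm_triangle_ineq[of "x - y" y] by simp
    then have "(norm x)\<^sup>2 \<le> (norm (x - y) + R)\<^sup>2" by (intro power_mono) auto
    also have "\<dots> \<le> 2 * (norm (x - y))\<^sup>2 + 2 * R\<^sup>2"
      using zero_le_power2[of "norm (x - y) - R"] by (simp add: power2_eq_square algebra_simps)
    finally have 1: "x \<bullet> x + 1 \<le> 2 * ((x - y) \<bullet> (x - y)) + (1 + 2 * R\<^sup>2)" by (simp add: power2_norm_eq_inner)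
    have "x \<bullet> x + 1 \<le> K * ((x - y) \<bullet> (x - y) + d)"
    proof -
      have "K * ((x - y) \<bullet> (x - y) + d) = 2 * ((x - y) \<bullet> (x - y)) + 2 * d + (1 + 2 * R\<^sup>2) / d * ((x - y) \<bullet> (x - y)) + (1 + 2 * R\<^sup>2)"
        using assms by (simp add: K_def field_simps)
      moreover have "(1 + 2 * R\<^sup>2) / d * ((x - y) \<bullet> (x - y)) \<ge> 0" using assms by simp
      ultimately show ?thesis using 1 assms by linarith
    qed
    then have "sqrt (x \<bullet> x + 1) \<le> sqrt K * sqrt ((x - y) \<bullet> (x - y) + d)"
      by (metis real_sqrt_le_iff real_sqrt_mult)
    moreover have "sqrt (x \<bullet> x + 1) > 0" "sqrt ((x - y) \<bullet> (x - y) + d) > 0"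
      using assms by (auto simp: add_nonneg_pos)
    ultimately show ?thesis by (simp add: sg_def field_simps)
  qed
  then show ?thesis using K that[of "sqrt K"] by simp
qed

lemma measurable_sg [measurable]: "sg d \<in> borel_measurable borel"
  unfolding sg_def[abs_def] by measurable

text \<open>Layer-cake computation in place of polar coordinates: \<open>sg d z ^ 5\<close> is the
  integral of \<open>5 r q(r)^7\<close> over \<open>r \<ge> |z|\<close>. Exchanging the integrals
  turns the integral over \<open>z\<close> into the volume of a ball of radius \<open>r\<close>, and
  a one-dimensional integral remains.\<close>

lemma nn_integral_sg5:
  assumes d: "d > 0"
  shows "(\<integral>\<^sup>+z. ennreal (sg d z ^ 5) \<partial>lborel) = ennreal (4 * pi / (3 * d))"
proof -
  define q where "q r = inverse (sqrt (r\<^sup>2 + d))" for r :: real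
  have qpos: "q r > 0" "sqrt (r\<^sup>2 + d) > 0" "r\<^sup>2 + d > 0" for r
  proof -
    show "r\<^sup>2 + d > 0" using d by (simp add: add_nonneg_pos)
    then show "sqrt (r\<^sup>2 + d) > 0" by simp
    then show "q r > 0" by (simp add: q_def)
  qed
  have qm[measurable]: "q \<in> borel_measurable borel" unfolding q_def[abs_def] by measurable
  have dq: "(q has_real_derivative - r * q r ^ 3) (at r)" for r
    unfolding q_def[abs_def] using qpos[of r]
    by (auto intro!: derivative_eq_intros simp: power3_eq_cube field_simps)
  have q2: "q r ^ 2 * (r\<^sup>2 + d) = 1" for r
    using qpos(3)[of r] by (simp add: q_def power_inverse less_imp_le)
  have "(q \<longlongrightarrow> 0) at_top"
    unfolding q_def[abs_def] add.commute[of _ d]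
    by (intro filterlim_compose[OF tendsto_inverse_0] filterlim_at_top_imp_at_infinity filterlim_compose[OF sqrt_at_top]
          filterlim_tendsto_add_at_top[OF tendsto_const] filterlim_pow_at_top filterlim_ident) simp
  then have lim1: "((\<lambda>r. - (q r ^ 5)) \<longlongrightarrow> 0) at_top"
    by (auto intro!: tendsto_eq_intros)
  have s: "ennreal (sg d z ^ 5) = (\<integral>\<^sup>+r. ennreal (5 * r * q r ^ 7) * indicator {norm z..} r \<partial>lborel)" for z
  proof -
    have "(\<integral>\<^sup>+r. ennreal (5 * r * q r ^ 7) * indicator {norm z..} r \<partial>lborel) = ennreal (0 - (- (q (norm z) ^ 5)))"
    proof (rule nn_integral_FTC_atLeast)
      show "DERIV (\<lambda>r. - (q r ^ 5)) r :> 5 * r * q r ^ 7" for r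
        by (rule derivative_eq_intros dq refl)+ (simp add: power_numeral_reduce)
      show "0 \<le> 5 * r * q r ^ 7" if "norm z \<le> r" for r
        using qpos[of r] order_trans[OF norm_ge_zero that] by (auto simp: less_imp_le)
    qed (use lim1 in auto)
    moreover have "q (norm z) = sg d z" by (simp add: q_def sg_def power2_norm_eq_inner)
    ultimately show ?thesis by simp
  qed
  have lim2: "((\<lambda>r. 4 * pi / (3 * d) * (r * q r) ^ 5) \<longlongrightarrow> 4 * pi / (3 * d)) at_top"
  proof -
    have "((\<lambda>r. sqrt (1 - d * q r ^ 2)) \<longlongrightarrow> sqrt (1 - d * 0 ^ 2)) at_top"
      by (intro tendsto_intros \<open>(q \<longlongrightarrow> 0) at_top\<close>)
    moreover have "eventually (\<lambda>r. sqrt (1 - d * q r ^ 2) = r * q r) at_top"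
      using eventually_ge_at_top[of 0]
    proof eventually_elim
      case (elim r)
      have "1 - d * q r ^ 2 = (r * q r) ^ 2" using q2[of r] by (simp add: power_mult_distrib algebra_simps)
      then show ?case using elim qpos[of r] by (simp add: real_sqrt_mult)
    qed
    ultimately have "((\<lambda>r. r * q r) \<longlongrightarrow> 1) at_top" by (auto elim: Lim_transform_eventually)
    then have "((\<lambda>r. 4 * pi / (3 * d) * (r * q r) ^ 5) \<longlongrightarrow> 4 * pi / (3 * d) * 1 ^ 5) at_top"
      by (intro tendsto_intros)
    then show ?thesis by simp
  qed
  have "(\<integral>\<^sup>+z. ennreal (sg d z ^ 5) \<partial>lborel)
      = (\<integral>\<^sup>+z. (\<integral>\<^sup>+r. ennreal (5 * r * q r ^ 7) * indicator {norm (z::real^3)..} r \<partial>lborel) \<partial>lborel)"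
    by (simp add: s)
  also have "\<dots> = (\<integral>\<^sup>+z. (\<integral>\<^sup>+r. ennreal (5 * r * q r ^ 7) * indicator {p. norm (fst p) \<le> snd p} (z::real^3, r) \<partial>lborel) \<partial>lborel)"
    by (intro nn_integral_cong) (auto simp: indicator_def)
  also have "\<dots> = (\<integral>\<^sup>+r. (\<integral>\<^sup>+z. ennreal (5 * r * q r ^ 7) * indicator {p. norm (fst p) \<le> snd p} (z::real^3, r) \<partial>lborel) \<partial>lborel)"
    by (rule lborel_pair.Fubini'[symmetric]) measurable
  also have "\<dots> = (\<integral>\<^sup>+r. ennreal (20 * pi / 3 * r ^ 4 * q r ^ 7) * indicator {0..} r \<partial>lborel)"
  proof (rule nn_integral_cong)
    fix r :: real
    have "(\<integral>\<^sup>+z. ennreal (5 * r * q r ^ 7) * indicator {p. norm (fst p) \<le> snd p} (z::real^3, r) \<partial>lborel)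
        = (\<integral>\<^sup>+z. ennreal (5 * r * q r ^ 7) * indicator (cball 0 r) (z::real^3) \<partial>lborel)"
      by (intro nn_integral_cong) (auto simp: indicator_def)
    also have "\<dots> = ennreal (5 * r * q r ^ 7) * emeasure lborel (cball (0::real^3) r)"
      by (rule nn_integral_cmult_indicator) simp
    also have "\<dots> = ennreal (20 * pi / 3 * r ^ 4 * q r ^ 7) * indicator {0..} r"
    proof (cases "r \<ge> 0")
      case True
      then show ?thesis using qpos[of r]
        by (simp add: emeasure_cball unit_ball_vol_3 ennreal_mult[symmetric] power_numeral_reduce)
    qed auto
    finally show "(\<integral>\<^sup>+z. ennreal (5 * r * q r ^ 7) * indicator {p. norm (fst p) \<le> snd p} (z::real^3, r) \<partial>lborel)
      = ennreal (20 * pi / 3 * r ^ 4 * q r ^ 7) * indicator {0..} r" .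
  qed
  \<comment> \<open>The primitive is a multiple of \<open>(r q)^5\<close>, because
    \<open>(r q)' = d q^3\<close> by \<open>q^2 (r^2 + d) = 1\<close>; at infinity
    \<open>r q\<close> tends to 1.\<close>
  also have "\<dots> = ennreal (4 * pi / (3 * d) - 4 * pi / (3 * d) * (0 * q 0) ^ 5)"
  proof (rule nn_integral_FTC_atLeast)
    fix r :: real assume "0 \<le> r"
    have D: "((\<lambda>r. 4 * pi / (3 * d) * (r * q r) ^ 5) has_real_derivative
        4 * pi / (3 * d) * (5 * (r * q r) ^ 4 * (q r - r * r * q r ^ 3))) (at r)"
      by (rule derivative_eq_intros dq refl)+ (simp add: power_numeral_reduce algebra_simps)
    have e1: "q r - r * r * q r ^ 3 = d * q r ^ 3"
    proof -
      have "q r = q r * (q r ^ 2 * (r\<^sup>2 + d))" by (simp add: q2)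
      then show ?thesis by (simp add: power2_eq_square power3_eq_cube algebra_simps)
    qed
    have e2: "4 * pi / (3 * d) * (5 * (r * q r) ^ 4 * (d * q r ^ 3)) = 20 * pi / 3 * r ^ 4 * q r ^ 7"
      using d by (simp add: power_mult_distrib power_numeral_reduce)
    show "DERIV (\<lambda>r. 4 * pi / (3 * d) * (r * q r) ^ 5) r :> 20 * pi / 3 * r ^ 4 * q r ^ 7"
      using D unfolding e1 e2 .
    show "0 \<le> 20 * pi / 3 * r ^ 4 * q r ^ 7" using \<open>0 \<le> r\<close> qpos[of r] by (simp add: less_imp_le)
  qed (use lim2 in auto)
  finally show ?thesis by simp
qed

text \<open>Minus the Laplacian of the softened kernel.\<close>

definition rho :: "real \<Rightarrow> real^3 \<Rightarrow> real" where "rho d z = 3 * d / (4 * pi) * sg d z ^ 5"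

lemma measurable_rho [measurable]: "rho d \<in> borel_measurable borel"
  unfolding rho_def[abs_def] by measurable

lemma rho_nonneg: "d \<ge> 0 \<Longrightarrow> rho d z \<ge> 0" by (simp add: rho_def sg_nonneg)

lemma nn_integral_rho: "d > 0 \<Longrightarrow> (\<integral>\<^sup>+z. ennreal (rho d z) \<partial>lborel) = 1"
proof -
  assume d: "d > 0"
  have "(\<integral>\<^sup>+z. ennreal (rho d z) \<partial>lborel) = ennreal (3 * d / (4 * pi)) * (\<integral>\<^sup>+z. ennreal (sg d z ^ 5) \<partial>lborel)"
  proof -
    have "ennreal (rho d z) = ennreal (3 * d / (4 * pi)) * ennreal (sg d z ^ 5)" for z
      unfolding rho_def using d by (intro ennreal_mult) (auto simp: sg_nonneg)
    then show ?thesis by (simp add: nn_integral_cmult)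
  qed
  also have "\<dots> = 1" unfolding nn_integral_sg5[OF d]
    using d by (simp add: ennreal_mult[symmetric])
  finally show ?thesis .
qed

lemma integrable_sg5: "d > 0 \<Longrightarrow> integrable lborel (\<lambda>z. sg d z ^ 5)"
  using nn_integral_sg5[of d] by (intro integrableI_nonneg) (auto simp: sg_nonneg)

lemma integrable_rho: "d > 0 \<Longrightarrow> integrable lborel (rho d)"
  unfolding rho_def[abs_def] using integrable_sg5 by auto

lemma integral_rho: "d > 0 \<Longrightarrow> (\<integral>z. rho d z \<partial>lborel) = 1"
  by (subst integral_eq_nn_integral) (auto simp: nn_integral_rho rho_nonneg)

subsection \<open>Convolutions\<close>

lemma inner_grad:
  assumes "f differentiable (at x)"
  shows "grad f x \<bullet> v = frechet_derivative f (at x) v"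
proof -
  have l: "linear (frechet_derivative f (at x))" using assms by (rule linear_frechet_derivative)
  have "frechet_derivative f (at x) v = frechet_derivative f (at x) (\<Sum>i\<in>UNIV. v $ i *\<^sub>R axis i 1)"
    using basis_expansion[of v] by (simp add: scalar_mult_eq_scaleR)
  also have "\<dots> = (\<Sum>i\<in>UNIV. v $ i * frechet_derivative f (at x) (axis i 1))"
    using l by (simp add: linear_sum linear_cmul)
  finally show ?thesis by (simp add: grad_def inner_vec_def mult.commute)
qed

lemma grad_eqI:
  assumes "(f has_derivative f') (at x)" "\<And>v. f' v = g \<bullet> v"
  shows "grad f x = g"
proof -
  have "frechet_derivative f (at x) = (\<lambda>v. g \<bullet> v)"
    using frechet_derivative_at[OF assms(1)] assms(2) by auto
  then show ?thesis by (simp add: grad_def vec_eq_iff inner_axis)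
qed

lemma grad_eq_0_outside:
  assumes "closed K" "\<And>y. y \<notin> K \<Longrightarrow> f y = 0" "x \<notin> K"
  shows "grad f x = 0"
proof (rule grad_eqI)
  have "((\<lambda>y. 0) has_derivative (\<lambda>v. 0)) (at x)" by simp
  then show "(f has_derivative (\<lambda>v. 0)) (at x)"
    by (rule has_derivative_transform_within_open[of _ _ _ UNIV "- K"]) (use assms in auto)
qed simp

lemma continuous_bounded_on_compact:
  fixes g :: "'a::topological_space \<Rightarrow> 'b::real_normed_vector"
  assumes "continuous_on K g" "compact K"
  obtains B where "B \<ge> 0" "\<And>y. y \<in> K \<Longrightarrow> norm (g y) \<le> B"
proof -
  have "bounded (g ` K)" by (intro compact_imp_bounded compact_continuous_image assms)
  then obtain B where "\<forall>t\<in>g ` K. norm t \<le> B" unfolding bounded_iff by blast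
  then show ?thesis using that[of "max B 0"] by (auto simp: le_max_iff_disj)
qed

lemma has_derivative_grad:
  assumes "smooth_on U f" "x \<in> U"
  shows "(f has_derivative (\<lambda>v. grad f x \<bullet> v)) (at x)"
  using smooth_on_has_derivative[OF assms] inner_grad[of f x]
  by (simp add: differentiableI)

lemma grad_component_smooth: "smooth_on U f \<Longrightarrow> smooth_on U (\<lambda>x. grad f x $ i)"
  by (simp add: grad_def smooth_on_frechet)

lemma continuous_on_grad: "smooth_on U f \<Longrightarrow> continuous_on U (grad f)"
  using continuous_on_vec_lambda[of U "\<lambda>i x. grad f x $ i"]
    smooth_on_continuous_on[OF grad_component_smooth[of U f]] by simp

lemma measurable_grad:
  assumes "smooth_on UNIV f" shows "grad f \<in> borel_measurable borel"
  using continuous_on_grad[OF assms] by (rule borel_measurable_continuous_onI)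

text \<open>Bounded support makes an \<open>L2\<close> field integrable as well, so that it can be
  convolved with every continuous kernel, whatever the growth of the kernel at infinity.\<close>

definition bfield :: "real \<Rightarrow> (real^3 \<Rightarrow> real^3) \<Rightarrow> bool" where
  "bfield R F \<longleftrightarrow> F \<in> borel_measurable borel \<and> (\<forall>x. norm x > R \<longrightarrow> F x = 0) \<and>
     integrable lborel (\<lambda>x. (norm (F x))\<^sup>2)"

definition bscalar :: "real \<Rightarrow> (real^3 \<Rightarrow> real) \<Rightarrow> bool" where
  "bscalar R a \<longleftrightarrow> integrable lborel a \<and> (\<forall>y. norm y > R \<longrightarrow> a y = 0)"

definition cv :: "(real^3 \<Rightarrow> real) \<Rightarrow> (real^3 \<Rightarrow> real) \<Rightarrow> real^3 \<Rightarrow> real" where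
  "cv a f x = (\<integral>y. a y * f (x - y) \<partial>lborel)"

lemma smooth_derivative_bounded_on_compact:
  assumes f: "smooth_on UNIV f" and K: "compact K"
  obtains L where "L \<ge> 0" "\<And>z v. z \<in> K \<Longrightarrow> \<bar>frechet_derivative f (at z) v\<bar> \<le> L * norm v"
proof -
  obtain L where L: "L \<ge> 0" "\<And>z. z \<in> K \<Longrightarrow> norm (grad f z) \<le> L"
    using continuous_bounded_on_compact[OF continuous_on_subset[OF continuous_on_grad[OF f]] K] by blast
  show ?thesis
  proof (rule that[OF L(1)])
    fix z v assume "z \<in> K"
    have "\<bar>frechet_derivative f (at z) v\<bar> = \<bar>grad f z \<bullet> v\<bar>"
      using inner_grad[of f z v] smooth_on_has_derivative[OF f, of z] by (simp add: differentiableI)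
    also have "\<dots> \<le> norm (grad f z) * norm v" by (rule Cauchy_Schwarz_ineq2)
    also have "\<dots> \<le> L * norm v" using L(2)[OF \<open>z \<in> K\<close>] by (intro mult_right_mono) auto
    finally show "\<bar>frechet_derivative f (at z) v\<bar> \<le> L * norm v" .
  qed
qed

lemma integrable_bscalar_mult:
  assumes a: "bscalar R a" and [measurable]: "g \<in> borel_measurable borel"
    and b: "\<And>y. norm y \<le> R \<Longrightarrow> \<bar>g y\<bar> \<le> B"
  shows "integrable lborel (\<lambda>y. a y * g y)"
proof -
  have i: "integrable lborel a" using a by (simp add: bscalar_def)
  then have [measurable]: "a \<in> borel_measurable borel" using borel_measurable_integrable by fastforce
  show ?thesis
  proof (rule Bochner_Integration.integrable_bound[where f="\<lambda>y. B * a y"])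
    have "norm (a y * g y) \<le> norm (B * a y)" for y
    proof (cases "norm y \<le> R")
      case True
      then have "\<bar>g y\<bar> \<le> \<bar>B\<bar>" using b[of y] by linarith
      then show ?thesis using mult_right_mono[of "\<bar>g y\<bar>" "\<bar>B\<bar>" "\<bar>a y\<bar>"] by (simp add: abs_mult mult.commute)
    next
      case False then show ?thesis using a by (auto simp: bscalar_def)
    qed
    then show "AE y in lborel. norm (a y * g y) \<le> norm (B * a y)" by simp
  qed (use i in auto)
qed

lemma integrable_cv:
  assumes a: "bscalar R a" and f: "continuous_on UNIV f"
  shows "integrable lborel (\<lambda>y. a y * f (x - y))"
proof -
  have "continuous_on (cball 0 R) (\<lambda>y. f (x - y))"
    by (intro continuous_on_compose2[OF f] continuous_intros) auto
  from continuous_bounded_on_compact[OF this compact_cball]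
  obtain B where B: "\<bar>f (x - y)\<bar> \<le> B" if "norm y \<le> R" for y
    by (metis mem_cball_0 real_norm_def)
  have [measurable]: "f \<in> borel_measurable borel" using f by (rule borel_measurable_continuous_onI)
  show ?thesis by (rule integrable_bscalar_mult[OF a _ B]) auto
qed

lemma cv_has_derivative:
  assumes a: "bscalar R a" and f: "smooth_on UNIV f"
  shows "(cv a f has_derivative (\<lambda>v. cv a (\<lambda>z. frechet_derivative f (at z) v) x)) (at x)"
proof -
  \<comment> \<open>With \<open>z\<close> within 1 of \<open>x\<close> and \<open>y\<close> in the
    support of \<open>a\<close>, the argument \<open>z - y\<close> stays in this ball, so a local
    bound on the derivative of \<open>f\<close> dominates.\<close>
  obtain L where L: "L \<ge> 0" "\<And>z v. z \<in> cball 0 (norm x + 1 + R) \<Longrightarrow> \<bar>frechet_derivative f (at z) v\<bar> \<le> L * norm v"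
    using smooth_derivative_bounded_on_compact[OF f compact_cball] by blast
  have ia: "integrable lborel (\<lambda>y. L * \<bar>a y\<bar>)" using a by (auto simp: bscalar_def)
  have "((\<lambda>z. \<integral>y. a y * f (z - y) \<partial>lborel) has_derivative (\<lambda>v. \<integral>y. a y * frechet_derivative f (at (x - y)) v \<partial>lborel)) (at x)"
  proof (rule has_derivative_integral(2)[OF zero_less_one _ _ ia])
    show "integrable lborel (\<lambda>y. a y * f (z - y))" for z
      by (rule integrable_cv[OF a smooth_on_continuous_on[OF f]])
    show "((\<lambda>z. a y * f (z - y)) has_derivative (\<lambda>v. a y * frechet_derivative f (at (z - y)) v)) (at z)" for y z
    proof -
      have "((\<lambda>z. f (z - y)) has_derivative (\<lambda>v. frechet_derivative f (at (z - y)) v)) (at z)"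
        by (rule has_derivative_compose[of "\<lambda>z. z - y" "\<lambda>v. v"])
           (use smooth_on_has_derivative[OF f] in \<open>auto intro!: derivative_eq_intros\<close>)
      then show ?thesis by (rule has_derivative_mult_right)
    qed
    show "\<bar>a y * frechet_derivative f (at (z - y)) v\<bar> \<le> L * \<bar>a y\<bar> * norm v" if "z \<in> ball x 1" for y z v
    proof (cases "norm y \<le> R")
      case True
      have "norm (z - y) \<le> norm x + 1 + R"
        using that True norm_triangle_ineq4[of z y] norm_triangle_ineq2[of z x] by (simp add: dist_norm norm_minus_commute)
      then have "\<bar>a y\<bar> * \<bar>frechet_derivative f (at (z - y)) v\<bar> \<le> \<bar>a y\<bar> * (L * norm v)"
        by (intro mult_left_mono L(2)) auto
      then show ?thesis by (simp add: abs_mult mult_ac)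
    next
      case False then show ?thesis using a by (auto simp: bscalar_def)
    qed
  qed
  then show ?thesis by (simp add: cv_def[abs_def])
qed

lemma smooth_on_cv:
  assumes a: "bscalar R a" and f: "smooth_on UNIV f"
  shows "smooth_on UNIV (cv a f)"
proof -
  have "Ck_on k UNIV (cv a f)" if "smooth_on UNIV f" for k f
    using that
  proof (induction k arbitrary: f)
    case 0
    then show ?case using cv_has_derivative[OF a 0]
      by (auto intro!: continuous_at_imp_continuous_on has_derivative_continuous)
  next
    case (Suc k)
    show ?case
      by (rule Ck_on_SucI[OF open_UNIV cv_has_derivative[OF a Suc.prems]]) (intro Suc.IH smooth_on_frechet Suc.prems)
  qed
  then show ?thesis using f by (simp add: smooth_on_def)
qed

lemma cv_decay:
  assumes a: "bscalar R a" and R: "R \<ge> 0" and d: "d > 0"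
    and f: "\<And>z. \<bar>f z\<bar> \<le> C * sg d z ^ p"
  obtains C' where "C' \<ge> 0" "\<And>x. \<bar>cv a f x\<bar> \<le> C' * sg 1 x ^ p"
proof -
  obtain K where K: "K > 0" "\<And>x y. norm y \<le> R \<Longrightarrow> sg d (x - y) \<le> K * sg 1 x"
    using sg_decay[OF d R] by metis
  have C: "C \<ge> 0"
  proof -
    have "0 \<le> C * sg d 0 ^ p" using f[of 0] by linarith
    moreover have "sg d 0 ^ p > 0" using sg_pos[of d 0] d by simp
    ultimately show ?thesis by (simp add: zero_le_mult_iff)
  qed
  have i: "integrable lborel a" using a by (simp add: bscalar_def)
  define A where "A = (\<integral>y. \<bar>a y\<bar> \<partial>lborel)"
  have A: "A \<ge> 0" by (simp add: A_def)
  have "\<bar>cv a f x\<bar> \<le> A * C * K ^ p * sg 1 x ^ p" for x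
  proof -
    have "\<bar>cv a f x\<bar> \<le> (\<integral>y. \<bar>a y\<bar> * (C * K ^ p * sg 1 x ^ p) \<partial>lborel)"
      unfolding cv_def
    proof (cases "integrable lborel (\<lambda>y. a y * f (x - y))")
      case True
      have "\<bar>\<integral>y. a y * f (x - y) \<partial>lborel\<bar> \<le> (\<integral>y. \<bar>a y * f (x - y)\<bar> \<partial>lborel)"
        by (rule integral_abs_bound)
      also have "\<dots> \<le> (\<integral>y. \<bar>a y\<bar> * (C * K ^ p * sg 1 x ^ p) \<partial>lborel)"
      proof (rule integral_mono)
        fix y
        show "\<bar>a y * f (x - y)\<bar> \<le> \<bar>a y\<bar> * (C * K ^ p * sg 1 x ^ p)"
        proof (cases "norm y \<le> R")
          case y: True
          have "sg d (x - y) ^ p \<le> (K * sg 1 x) ^ p" using K(2)[OF y] d by (intro power_mono sg_nonneg) auto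
          then have "C * sg d (x - y) ^ p \<le> C * (K * sg 1 x) ^ p" using C by (rule mult_left_mono)
          then have "\<bar>f (x - y)\<bar> \<le> C * K ^ p * sg 1 x ^ p" using f[of "x - y"] by (simp add: power_mult_distrib)
          then show ?thesis by (simp add: abs_mult mult_left_mono)
        next
          case False then show ?thesis using a by (auto simp: bscalar_def)
        qed
      qed (use True i in auto)
      finally show "\<bar>\<integral>y. a y * f (x - y) \<partial>lborel\<bar> \<le> (\<integral>y. \<bar>a y\<bar> * (C * K ^ p * sg 1 x ^ p) \<partial>lborel)" .
    next
      \<comment> \<open>A non-integrable product has Bochner integral 0, and the bound is then
        trivial.\<close>
      case False
      then show "\<bar>\<integral>y. a y * f (x - y) \<partial>lborel\<bar> \<le> (\<integral>y. \<bar>a y\<bar> * (C * K ^ p * sg 1 x ^ p) \<partial>lborel)"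
        using C K by (simp add: not_integrable_integral_eq sg_nonneg)
    qed
    then show ?thesis by (simp add: A_def mult_ac)
  qed
  then show ?thesis using that[of "A * C * K ^ p"] A C K by simp
qed

text \<open>\<open>kk d j\<close> is minus the \<open>j\<close>-th partial derivative of the softened kernel.\<close>

definition kk :: "real \<Rightarrow> 3 \<Rightarrow> real^3 \<Rightarrow> real" where
  "kk d j z = z $ j * sg d z ^ 3 / (4 * pi)"
text \<open>The partial derivative of \<open>kk d j\<close> in direction \<open>i\<close>, so minus
  an entry of the Hessian of the softened kernel.\<close>

definition kk1 :: "real \<Rightarrow> 3 \<Rightarrow> 3 \<Rightarrow> real^3 \<Rightarrow> real" where
  "kk1 d j i z = ((if i = j then 1 else 0) * sg d z ^ 3 - 3 * z $ j * z $ i * sg d z ^ 5) / (4 * pi)"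

lemma kk_has_derivative:
  assumes "z \<bullet> z + d > 0"
  shows "(kk d j has_derivative (\<lambda>v. \<Sum>i\<in>UNIV. kk1 d j i z * v $ i)) (at z)"
proof -
  have s: "(\<Sum>i\<in>UNIV. kk1 d j i z * v $ i) = (v $ j * sg d z ^ 3 - 3 * z $ j * (z \<bullet> v) * sg d z ^ 5) / (4 * pi)" for v
  proof -
    have "(\<Sum>i\<in>UNIV. kk1 d j i z * v $ i)
       = (\<Sum>i\<in>UNIV. (if i = j then v $ i * sg d z ^ 3 / (4 * pi) else 0) - 3 * z $ j * sg d z ^ 5 / (4 * pi) * (z $ i * v $ i))"
      by (intro sum.cong) (auto simp: kk1_def field_simps)
    also have "\<dots> = v $ j * sg d z ^ 3 / (4 * pi) - 3 * z $ j * sg d z ^ 5 / (4 * pi) * (z \<bullet> v)"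
      by (simp add: sum_subtractf inner_vec_def sum_distrib_left)
    finally show ?thesis by (simp add: field_simps)
  qed
  show ?thesis unfolding s kk_def[abs_def]
    by (rule derivative_eq_intros sg_has_derivative[OF assms] bounded_linear_imp_has_derivative[OF bounded_linear_vec_nth] refl)+
       (auto simp: power_numeral_reduce field_simps)
qed

lemma smooth_on_component: "open U \<Longrightarrow> smooth_on U (\<lambda>z. z $ i)"
  by (simp add: smooth_on_bounded_linear bounded_linear_vec_nth)

lemma smooth_on_kk:
  assumes "open U" "\<And>z. z \<in> U \<Longrightarrow> z \<bullet> z + d > 0"
  shows "smooth_on U (kk d j)" "smooth_on U (kk1 d j i)" "smooth_on U (rho d)"
proof -
  have "smooth_on U (\<lambda>z. z $ j * sg d z ^ 3 * (1 / (4 * pi)))"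
    by (intro smooth_on_mult smooth_on_power smooth_on_const smooth_on_component smooth_on_sg assms)
  then show "smooth_on U (kk d j)" by (simp add: kk_def[abs_def])
  have "smooth_on U (\<lambda>z. ((if i = j then 1 else 0) * sg d z ^ 3 - 3 * z $ j * z $ i * sg d z ^ 5) * (1 / (4 * pi)))"
    by (intro smooth_on_mult smooth_on_diff smooth_on_power smooth_on_const smooth_on_component smooth_on_sg assms)
  then show "smooth_on U (kk1 d j i)" by (simp add: kk1_def[abs_def])
  show "smooth_on U (rho d)" unfolding rho_def[abs_def]
    by (intro smooth_on_mult smooth_on_power smooth_on_const smooth_on_sg assms)
qed

lemma sg_sq: "z \<bullet> z + d > 0 \<Longrightarrow> sg d z ^ 2 * (z \<bullet> z + d) = 1"
  by (simp add: sg_def power_inverse less_imp_le)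

lemma axis_1_component: "axis i (1::real) $ j = (if j = i then 1 else 0)"
  by (simp add: axis_def)

lemma kk1_has_derivative:
  assumes "z \<bullet> z + d > 0"
  shows "(kk1 d j i has_derivative (\<lambda>v. (- 3 * (if i = j then 1 else 0) * (z \<bullet> v) * sg d z ^ 5
     - 3 * (v $ j * z $ i + z $ j * v $ i) * sg d z ^ 5 + 15 * z $ j * z $ i * (z \<bullet> v) * sg d z ^ 7) / (4 * pi))) (at z)"
proof -
  have "((\<lambda>z. (e * sg d z ^ 3 - 3 * z $ j * z $ i * sg d z ^ 5) * c) has_derivative
    (\<lambda>v. (- 3 * e * (z \<bullet> v) * sg d z ^ 5
     - 3 * (v $ j * z $ i + z $ j * v $ i) * sg d z ^ 5 + 15 * z $ j * z $ i * (z \<bullet> v) * sg d z ^ 7) * c)) (at z)" for e c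
    by (rule derivative_eq_intros sg_has_derivative[OF assms] bounded_linear_imp_has_derivative[OF bounded_linear_vec_nth] refl)+
       (rule ext, simp add: power_numeral_reduce algebra_simps)
  from this[of "if i = j then 1 else 0" "1 / (4 * pi)"]
  show ?thesis by (simp add: kk1_def[abs_def])
qed

lemma rho_has_derivative:
  assumes "z \<bullet> z + d > 0"
  shows "(rho d has_derivative (\<lambda>v. - 15 * d * (z \<bullet> v) * sg d z ^ 7 / (4 * pi))) (at z)"
  unfolding rho_def[abs_def]
  by (rule derivative_eq_intros sg_has_derivative[OF assms] refl)+
     (simp add: power_numeral_reduce field_simps)

text \<open>The identity "minus the Laplacian of the softened kernel is \<open>rho\<close>",
  differentiated once in direction \<open>j\<close> and read as a statement on the rows of its
  Hessian.\<close>

lemma kernel_divergence: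
  assumes "z \<bullet> z + d > 0"
  shows "(\<Sum>i\<in>UNIV. frechet_derivative (kk1 d j i) (at z) (axis i 1)) = frechet_derivative (rho d) (at z) (axis j 1)"
proof -
  let ?s = "sg d z"
  have "(\<Sum>i\<in>UNIV. frechet_derivative (kk1 d j i) (at z) (axis i 1))
     = (\<Sum>i\<in>UNIV. (- 3 * (if i = j then 1 else 0) * z $ i * ?s ^ 5
     - 3 * ((if i = j then 1 else 0) * z $ i + z $ j) * ?s ^ 5 + 15 * z $ j * ?s ^ 7 * (z $ i * z $ i)) / (4 * pi))"
    by (intro sum.cong refl, subst frechet_derivative_at[OF kk1_has_derivative[OF assms], symmetric])
       (auto simp: inner_axis axis_1_component)
  also have "\<dots> = (- 3 * z $ j * ?s ^ 5 - 3 * (z $ j + 3 * z $ j) * ?s ^ 5 + 15 * z $ j * ?s ^ 7 * (z \<bullet> z)) / (4 * pi)"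
  proof -
    have "(\<Sum>i\<in>UNIV. (- 3 * (if i = j then 1 else 0) * z $ i * ?s ^ 5
     - 3 * ((if i = j then 1 else 0) * z $ i + z $ j) * ?s ^ 5 + 15 * z $ j * ?s ^ 7 * (z $ i * z $ i)))
     = (\<Sum>i\<in>UNIV. (if i = j then - 6 * z $ i * ?s ^ 5 else 0) - 3 * z $ j * ?s ^ 5 + 15 * z $ j * ?s ^ 7 * (z $ i * z $ i))"
      by (intro sum.cong) (auto simp: algebra_simps)
    also have "\<dots> = - 6 * z $ j * ?s ^ 5 - 9 * z $ j * ?s ^ 5 + 15 * z $ j * ?s ^ 7 * (z \<bullet> z)"
      by (simp add: sum.distrib sum_subtractf inner_vec_def sum_distrib_left)
    finally show ?thesis by (simp add: sum_divide_distrib[symmetric] algebra_simps)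
  qed
  also have "\<dots> = - 15 * d * z $ j * ?s ^ 7 / (4 * pi)"
  proof -
    \<comment> \<open>Inserting \<open>sg^2 (|z|^2 + d) = 1\<close> brings both terms to the seventh
      power; the parts with \<open>|z|^2\<close> cancel and only the factor \<open>d\<close>
      survives.\<close>
    have "?s ^ 5 = ?s ^ 5 * (?s ^ 2 * (z \<bullet> z + d))" using sg_sq[OF assms] by simp
    then have "?s ^ 5 = ?s ^ 7 * (z \<bullet> z) + ?s ^ 7 * d" by (simp add: power_numeral_reduce algebra_simps)
    then show ?thesis by (simp add: algebra_simps)
  qed
  also have "\<dots> = frechet_derivative (rho d) (at z) (axis j 1)"
    by (subst frechet_derivative_at[OF rho_has_derivative[OF assms], symmetric]) (simp add: inner_axis)
  finally show ?thesis .
qed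

lemma component_sg: "d \<ge> 0 \<Longrightarrow> \<bar>z $ i\<bar> * sg d z \<le> 1"
  using sg_bound_norm[of d z] component_le_norm_cart[of z i] sg_nonneg[of d z]
  by (meson mult_right_mono order_trans)

text \<open>With \<open>t i = z $ i * sg d z\<close>, bounded by 1, every kernel is a polynomial in
  the \<open>t i\<close> times a power of \<open>sg d z\<close>, and that power is all that matters;
  the constants are crude. The case \<open>d = 0\<close> away from the origin is included, since the
  limit needs bounds uniform down to it.\<close>

lemma kernel_decay_gen:
  assumes d: "d \<ge> 0" and z: "z \<bullet> z + d > 0"
  shows "\<bar>kk d j z\<bar> \<le> 1 * sg d z ^ 2"
    and "\<bar>kk1 d j i z\<bar> \<le> 4 * sg d z ^ 3"
    and "\<bar>rho d z\<bar> \<le> d * sg d z ^ 5"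
    and "\<bar>frechet_derivative (kk1 d j i) (at z) (axis i 1)\<bar> \<le> 30 * sg d z ^ 4"
    and "\<bar>frechet_derivative (rho d) (at z) (axis i 1)\<bar> \<le> 15 * d * sg d z ^ 6"
proof -
  let ?s = "sg d z"
  have s: "?s \<ge> 0" using d sg_nonneg by simp
  define t where "t i = z $ i * ?s" for i
  have t: "\<bar>t i\<bar> \<le> 1" for i using component_sg[of d z i] d s by (simp add: t_def abs_mult)
  have tt: "\<bar>t i * t j\<bar> \<le> 1" for i j using mult_mono[OF t[of i] t[of j]] by (simp add: abs_mult)
  have ttt: "\<bar>t i * t j * t k\<bar> \<le> 1" for i j k using mult_mono[OF tt[of i j] t[of k]] by (simp add: abs_mult)
  have pi: "4 * pi > 1" using pi_gt3 by linarith
  have dv: "\<bar>x / (4 * pi)\<bar> \<le> \<bar>x\<bar>" for x :: real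
  proof -
    have "\<bar>x\<bar> / (4 * pi) \<le> \<bar>x\<bar> / 1" using pi by (intro divide_left_mono) auto
    then show ?thesis by (simp add: abs_divide)
  qed
  have "kk d j z = t j * ?s ^ 2 / (4 * pi)" by (simp add: kk_def t_def power_numeral_reduce)
  then have "\<bar>kk d j z\<bar> \<le> \<bar>t j * ?s ^ 2\<bar>" using dv by metis
  also have "\<dots> \<le> 1 * ?s ^ 2" unfolding abs_mult using t[of j] by (intro mult_mono) auto
  finally show "\<bar>kk d j z\<bar> \<le> 1 * ?s ^ 2" .
  define e :: real where "e = (if i = j then 1 else 0)"
  have e: "\<bar>e\<bar> \<le> 1" "e \<ge> 0" by (auto simp: e_def)
  have "kk1 d j i z = (e - 3 * (t j * t i)) * ?s ^ 3 / (4 * pi)"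
    by (simp add: kk1_def t_def e_def power_numeral_reduce algebra_simps)
  then have "\<bar>kk1 d j i z\<bar> \<le> \<bar>(e - 3 * (t j * t i)) * ?s ^ 3\<bar>" using dv by metis
  also have "\<dots> \<le> 4 * ?s ^ 3" unfolding abs_mult[of _ "?s ^ 3"] using tt[of j i] e s by (intro mult_mono) auto
  finally show "\<bar>kk1 d j i z\<bar> \<le> 4 * ?s ^ 3" .
  have "\<bar>rho d z\<bar> \<le> 3 / (4 * pi) * (d * ?s ^ 5)" using d s by (simp add: rho_def abs_mult)
  also have "\<dots> \<le> 1 * (d * ?s ^ 5)" using d s pi_gt3 by (intro mult_right_mono) auto
  finally show "\<bar>rho d z\<bar> \<le> d * ?s ^ 5" by simp
  have "frechet_derivative (kk1 d j i) (at z) (axis i 1) = (- 3 * e * t i - 3 * (e * t i + t j) + 15 * (t j * t i * t i)) * ?s ^ 4 / (4 * pi)"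
    by (subst frechet_derivative_at[OF kk1_has_derivative[OF z], symmetric])
       (auto simp: inner_axis axis_1_component e_def t_def power_numeral_reduce algebra_simps)
  then have "\<bar>frechet_derivative (kk1 d j i) (at z) (axis i 1)\<bar> \<le> \<bar>(- 3 * e * t i - 3 * (e * t i + t j) + 15 * (t j * t i * t i)) * ?s ^ 4\<bar>" using dv by metis
  also have "\<dots> \<le> 30 * ?s ^ 4"
  proof -
    have "\<bar>- 3 * e * t i - 3 * (e * t i + t j) + 15 * (t j * t i * t i)\<bar> \<le> 30"
      using t[of i] t[of j] ttt[of j i i] e by (auto simp: e_def split: if_splits)
    then show ?thesis unfolding abs_mult[of _ "?s ^ 4"] by (intro mult_mono) auto
  qed
  finally show "\<bar>frechet_derivative (kk1 d j i) (at z) (axis i 1)\<bar> \<le> 30 * ?s ^ 4" .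
  have "frechet_derivative (rho d) (at z) (axis i 1) = (- 15 * d * t i) * ?s ^ 6 / (4 * pi)"
    by (subst frechet_derivative_at[OF rho_has_derivative[OF z], symmetric])
       (auto simp: inner_axis t_def power_numeral_reduce algebra_simps)
  then have "\<bar>frechet_derivative (rho d) (at z) (axis i 1)\<bar> \<le> \<bar>(- 15 * d * t i) * ?s ^ 6\<bar>" using dv by metis
  also have "\<dots> \<le> 15 * d * ?s ^ 6"
    unfolding abs_mult[of _ "?s ^ 6"] using mult_left_mono[OF t[of i] d] d by (intro mult_mono) (auto simp: abs_mult)
  finally show "\<bar>frechet_derivative (rho d) (at z) (axis i 1)\<bar> \<le> 15 * d * ?s ^ 6" .
qed

lemma sg_arg_pos': "d > 0 \<Longrightarrow> (z::real^3) \<bullet> z + d > 0" using sg_arg_pos by blast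

lemma kernel_decay:
  assumes d: "d > 0"
  shows "\<bar>kk d j z\<bar> \<le> 1 * sg d z ^ 2"
    and "\<bar>kk1 d j i z\<bar> \<le> 4 * sg d z ^ 3"
    and "\<bar>rho d z\<bar> \<le> d * sg d z ^ 5"
    and "\<bar>frechet_derivative (kk1 d j i) (at z) (axis i 1)\<bar> \<le> 30 * sg d z ^ 4"
    and "\<bar>frechet_derivative (rho d) (at z) (axis i 1)\<bar> \<le> 15 * d * sg d z ^ 6"
  using kernel_decay_gen[OF less_imp_le[OF d] sg_arg_pos'[OF d]] by blast+

subsection \<open>Weak limits of square-integrable fields\<close>

text \<open>The best choice is \<open>t = sqrt (B / A)\<close>; adding \<open>e\<close> to both
  numbers avoids division by zero and is removed by a limit.\<close>

lemma AM_GM_inf: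
  fixes A B x :: real
  assumes "A \<ge> 0" "B \<ge> 0" and h: "\<And>t. t > 0 \<Longrightarrow> x \<le> (t * A + B / t) / 2"
  shows "x \<le> sqrt A * sqrt B"
proof -
  have e: "x \<le> sqrt (A + e) * sqrt (B + e)" if "e > 0" for e
  proof -
    define t where "t = sqrt (B + e) / sqrt (A + e)"
    have p: "sqrt (A + e) > 0" "sqrt (B + e) > 0" using assms that by auto
    then have t: "t > 0" by (simp add: t_def)
    have "x \<le> (t * A + B / t) / 2" by (rule h[OF t])
    also have "\<dots> \<le> (t * (A + e) + (B + e) / t) / 2"
      using t that by (intro divide_right_mono add_mono mult_left_mono) auto
    also have "t * (A + e) = sqrt (A + e) * sqrt (B + e)"
    proof -
      have "A + e = sqrt (A + e) * sqrt (A + e)" using assms that by simp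
      then show ?thesis using p by (metis (no_types, lifting) t_def mult.commute nonzero_eq_divide_eq less_irrefl mult.assoc)
    qed
    also have "(B + e) / t = sqrt (A + e) * sqrt (B + e)"
    proof -
      have "B + e = sqrt (B + e) * sqrt (B + e)" using assms that by simp
      then have "(B + e) / t = (sqrt (B + e) * sqrt (B + e)) / (sqrt (B + e) / sqrt (A + e))" by (simp only: t_def)
      then show ?thesis using p by (simp add: field_simps del: real_sqrt_mult_self)
    qed
    finally show ?thesis by simp
  qed
  have "((\<lambda>e. sqrt (A + e) * sqrt (B + e)) \<longlongrightarrow> sqrt (A + 0) * sqrt (B + 0)) (at_right 0)"
    by (intro tendsto_intros)
  moreover have "eventually (\<lambda>e. x \<le> sqrt (A + e) * sqrt (B + e)) (at_right 0)"
    using e by (auto simp: eventually_at_filter)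
  ultimately have "x \<le> sqrt (A + 0) * sqrt (B + 0)"
    by (rule tendsto_lowerbound) simp
  then show ?thesis by simp
qed

lemma L2_inner:
  fixes f g :: "'a \<Rightarrow> 'b::euclidean_space"
  assumes [measurable]: "f \<in> borel_measurable M" "g \<in> borel_measurable M"
    and i: "integrable M (\<lambda>x. (norm (f x))\<^sup>2)" "integrable M (\<lambda>x. (norm (g x))\<^sup>2)"
  shows "integrable M (\<lambda>x. f x \<bullet> g x)"
    and "integrable M (\<lambda>x. norm (f x) * norm (g x))"
    and "(\<integral>x. norm (f x) * norm (g x) \<partial>M) \<le> sqrt (\<integral>x. (norm (f x))\<^sup>2 \<partial>M) * sqrt (\<integral>x. (norm (g x))\<^sup>2 \<partial>M)"
    and "\<bar>\<integral>x. f x \<bullet> g x \<partial>M\<bar> \<le> sqrt (\<integral>x. (norm (f x))\<^sup>2 \<partial>M) * sqrt (\<integral>x. (norm (g x))\<^sup>2 \<partial>M)"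
proof -
  have am: "norm (f x) * norm (g x) \<le> (t * (norm (f x))\<^sup>2 + (norm (g x))\<^sup>2 / t) / 2" if "t > 0" for t x
  proof -
    have "0 \<le> (t * norm (f x) - norm (g x))\<^sup>2 / (2 * t)" using that by simp
    also have "\<dots> = (t * (norm (f x))\<^sup>2 + (norm (g x))\<^sup>2 / t) / 2 - norm (f x) * norm (g x)"
      using that by (simp add: power2_eq_square field_simps)
    finally show ?thesis by simp
  qed
  show n: "integrable M (\<lambda>x. norm (f x) * norm (g x))"
    by (rule Bochner_Integration.integrable_bound[of M "\<lambda>x. (1 * (norm (f x))\<^sup>2 + (norm (g x))\<^sup>2 / 1) / 2"])
       (use i am[of 1] in auto)
  show ig: "integrable M (\<lambda>x. f x \<bullet> g x)"
    by (rule Bochner_Integration.integrable_bound[OF n]) (auto intro: Cauchy_Schwarz_ineq2)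
  show c: "(\<integral>x. norm (f x) * norm (g x) \<partial>M) \<le> sqrt (\<integral>x. (norm (f x))\<^sup>2 \<partial>M) * sqrt (\<integral>x. (norm (g x))\<^sup>2 \<partial>M)"
  proof (rule AM_GM_inf)
    fix t :: real assume t: "t > 0"
    have "(\<integral>x. norm (f x) * norm (g x) \<partial>M) \<le> (\<integral>x. (t * (norm (f x))\<^sup>2 + (norm (g x))\<^sup>2 / t) / 2 \<partial>M)"
      by (rule integral_mono[OF n]) (use i am[OF t] in auto)
    then show "(\<integral>x. norm (f x) * norm (g x) \<partial>M) \<le> (t * (\<integral>x. (norm (f x))\<^sup>2 \<partial>M) + (\<integral>x. (norm (g x))\<^sup>2 \<partial>M) / t) / 2"
      using i by simp
  qed auto
  have "\<bar>\<integral>x. f x \<bullet> g x \<partial>M\<bar> \<le> (\<integral>x. \<bar>f x \<bullet> g x\<bar> \<partial>M)" by (rule integral_abs_bound)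
  also have "\<dots> \<le> (\<integral>x. norm (f x) * norm (g x) \<partial>M)"
    by (rule integral_mono) (use n ig in \<open>auto intro: Cauchy_Schwarz_ineq2\<close>)
  finally show "\<bar>\<integral>x. f x \<bullet> g x \<partial>M\<bar> \<le> sqrt (\<integral>x. (norm (f x))\<^sup>2 \<partial>M) * sqrt (\<integral>x. (norm (g x))\<^sup>2 \<partial>M)"
    using c by linarith
qed

lemma L2_Fatou:
  fixes f :: "nat \<Rightarrow> 'a \<Rightarrow> 'b::euclidean_space"
  assumes [measurable]: "\<And>n. f n \<in> borel_measurable M" "f' \<in> borel_measurable M"
    and lim: "\<And>x. x \<in> space M \<Longrightarrow> (\<lambda>n. f n x) \<longlonglongrightarrow> f' x"
    and i: "\<And>n. integrable M (\<lambda>x. (norm (f n x))\<^sup>2)"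
    and b: "\<And>n. (\<integral>x. (norm (f n x))\<^sup>2 \<partial>M) \<le> B"
  shows "integrable M (\<lambda>x. (norm (f' x))\<^sup>2)" "(\<integral>x. (norm (f' x))\<^sup>2 \<partial>M) \<le> B"
proof -
  have B: "B \<ge> 0" using order_trans[OF integral_nonneg_AE b[of 0]] by auto
  have "(\<integral>\<^sup>+x. ennreal ((norm (f' x))\<^sup>2) \<partial>M) = (\<integral>\<^sup>+x. liminf (\<lambda>n. ennreal ((norm (f n x))\<^sup>2)) \<partial>M)"
  proof (rule nn_integral_cong)
    fix x assume x: "x \<in> space M"
    have "(\<lambda>n. ennreal ((norm (f n x))\<^sup>2)) \<longlonglongrightarrow> ennreal ((norm (f' x))\<^sup>2)"
      by (intro tendsto_ennrealI tendsto_intros lim x)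
    then show "ennreal ((norm (f' x))\<^sup>2) = liminf (\<lambda>n. ennreal ((norm (f n x))\<^sup>2))"
      by (rule lim_imp_Liminf[OF trivial_limit_sequentially, symmetric])
  qed
  also have "\<dots> \<le> liminf (\<lambda>n. \<integral>\<^sup>+x. ennreal ((norm (f n x))\<^sup>2) \<partial>M)"
    by (rule nn_integral_liminf) measurable
  also have "\<dots> \<le> liminf (\<lambda>n. ennreal B)"
    by (intro Liminf_mono always_eventually allI) (simp add: nn_integral_eq_integral[OF i] b ennreal_leI)
  finally have f: "(\<integral>\<^sup>+x. ennreal ((norm (f' x))\<^sup>2) \<partial>M) \<le> ennreal B" by (simp add: Liminf_const)
  show g: "integrable M (\<lambda>x. (norm (f' x))\<^sup>2)"
    by (rule integrableI_nonneg) (use f in \<open>auto simp: less_top[symmetric] top_unique intro: le_less_trans[OF f]\<close>)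
  show "(\<integral>x. (norm (f' x))\<^sup>2 \<partial>M) \<le> B"
    using f B unfolding nn_integral_eq_integral[OF g zero_le_power2[THEN AE_I2]] by (simp add: ennreal_le_iff)
qed

text \<open>Pointwise convergence with bounded norms gives weak convergence. On \<open>A N\<close>,
  where the whole sequence is bounded by \<open>N\<close>, dominated convergence applies. Convergent
  sequences are bounded, so the sets \<open>A N\<close> exhaust the space and the part of
  \<open>G\<close> outside them has small norm; Cauchy-Schwarz then controls the rest uniformly in
  \<open>n\<close>.\<close>

lemma L2_weak_limit:
  fixes f :: "nat \<Rightarrow> 'a \<Rightarrow> 'b::euclidean_space"
  assumes [measurable]: "\<And>n. f n \<in> borel_measurable M" "f' \<in> borel_measurable M" "G \<in> borel_measurable M"
    and lim: "\<And>x. x \<in> space M \<Longrightarrow> (\<lambda>n. f n x) \<longlonglongrightarrow> f' x"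
    and i: "\<And>n. integrable M (\<lambda>x. (norm (f n x))\<^sup>2)"
    and b: "\<And>n. (\<integral>x. (norm (f n x))\<^sup>2 \<partial>M) \<le> B"
    and G: "integrable M (\<lambda>x. (norm (G x))\<^sup>2)" and G1: "integrable M (\<lambda>x. norm (G x))"
  shows "(\<lambda>n. \<integral>x. f n x \<bullet> G x \<partial>M) \<longlonglongrightarrow> (\<integral>x. f' x \<bullet> G x \<partial>M)"
proof -
  have L: "integrable M (\<lambda>x. (norm (f' x))\<^sup>2)" "(\<integral>x. (norm (f' x))\<^sup>2 \<partial>M) \<le> B"
    by (rule L2_Fatou[OF assms(1,2) lim i b]; assumption)+
  have B: "B \<ge> 0" using order_trans[OF integral_nonneg_AE b[of 0]] by auto
  define A where "A N = {x \<in> space M. \<forall>n. norm (f n x) \<le> real N}" for N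
  have [measurable]: "A N \<in> sets M" for N unfolding A_def by measurable
  define T where "T N = (\<lambda>x. indicator (space M - A N) x *\<^sub>R G x)" for N
  have [measurable]: "T N \<in> borel_measurable M" for N unfolding T_def by measurable
  have Ti: "integrable M (\<lambda>x. (norm (T N x))\<^sup>2)" for N
    by (rule Bochner_Integration.integrable_bound[OF G]) (auto simp: T_def indicator_def)
  have evA: "\<exists>N0. \<forall>N\<ge>N0. x \<in> A N" if "x \<in> space M" for x
  proof -
    have "Bseq (\<lambda>n. f n x)" using lim[OF that] by (intro convergent_imp_Bseq convergentI)
    then obtain K where K: "\<And>n. norm (f n x) \<le> K" by (auto simp: Bseq_def)
    show ?thesis
    proof (intro exI[of _ "nat \<lceil>K\<rceil>"] allI impI)
      fix N assume "nat \<lceil>K\<rceil> \<le> N"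
      then have "K \<le> real N" by linarith
      then show "x \<in> A N" using K that by (auto simp: A_def intro: order_trans)
    qed
  qed
  have T0: "(\<lambda>N. \<integral>x. (norm (T N x))\<^sup>2 \<partial>M) \<longlonglongrightarrow> (\<integral>x. 0 \<partial>M)"
  proof (rule integral_dominated_convergence[OF _ _ G])
    show "AE x in M. (\<lambda>N. (norm (T N x))\<^sup>2) \<longlonglongrightarrow> 0"
    proof (rule AE_I2)
      fix x assume "x \<in> space M"
      then obtain N0 where "\<And>N. N \<ge> N0 \<Longrightarrow> x \<in> A N" using evA by blast
      then show "(\<lambda>N. (norm (T N x))\<^sup>2) \<longlonglongrightarrow> 0"
        by (intro tendsto_eventually eventually_sequentiallyI[of N0]) (auto simp: T_def)
    qed
  qed (auto simp: T_def indicator_def)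
  show ?thesis
  proof (rule LIMSEQ_I)
    fix e :: real assume e: "e > 0"
    have "(\<lambda>N. 2 * sqrt B * sqrt (\<integral>x. (norm (T N x))\<^sup>2 \<partial>M)) \<longlonglongrightarrow> 2 * sqrt B * sqrt 0"
      using T0 by (intro tendsto_intros) simp
    then have "eventually (\<lambda>N. 2 * sqrt B * sqrt (\<integral>x. (norm (T N x))\<^sup>2 \<partial>M) < e / 2) sequentially"
      using e by (intro order_tendstoD(2)) auto
    then obtain N where N: "2 * sqrt B * sqrt (\<integral>x. (norm (T N x))\<^sup>2 \<partial>M) < e / 2"
      by (auto simp: eventually_sequentially)
    define H where "H x = indicator (A N) x *\<^sub>R G x" for x
    have [measurable]: "H \<in> borel_measurable M" unfolding H_def by measurable
    have Hi: "integrable M (\<lambda>x. (norm (H x))\<^sup>2)"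
      by (rule Bochner_Integration.integrable_bound[OF G]) (auto simp: H_def indicator_def)
    have GHT: "G x = H x + T N x" if "x \<in> space M" for x using that by (auto simp: H_def T_def indicator_def)
    have split: "(\<integral>x. h x \<bullet> G x \<partial>M) = (\<integral>x. h x \<bullet> H x \<partial>M) + (\<integral>x. h x \<bullet> T N x \<partial>M)"
      if [measurable]: "h \<in> borel_measurable M" and "integrable M (\<lambda>x. (norm (h x))\<^sup>2)" for h
    proof -
      have "(\<integral>x. h x \<bullet> G x \<partial>M) = (\<integral>x. h x \<bullet> H x + h x \<bullet> T N x \<partial>M)"
        by (intro Bochner_Integration.integral_cong) (auto simp: GHT inner_add)
      also have "\<dots> = (\<integral>x. h x \<bullet> H x \<partial>M) + (\<integral>x. h x \<bullet> T N x \<partial>M)"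
        using that Hi Ti[of N] by (intro Bochner_Integration.integral_add L2_inner(1)) auto
      finally show ?thesis .
    qed
    have tb: "\<bar>\<integral>x. h x \<bullet> T N x \<partial>M\<bar> \<le> sqrt B * sqrt (\<integral>x. (norm (T N x))\<^sup>2 \<partial>M)"
      if [measurable]: "h \<in> borel_measurable M" and h: "integrable M (\<lambda>x. (norm (h x))\<^sup>2)" "(\<integral>x. (norm (h x))\<^sup>2 \<partial>M) \<le> B" for h
    proof -
      have "\<bar>\<integral>x. h x \<bullet> T N x \<partial>M\<bar> \<le> sqrt (\<integral>x. (norm (h x))\<^sup>2 \<partial>M) * sqrt (\<integral>x. (norm (T N x))\<^sup>2 \<partial>M)"
        by (rule L2_inner(4)) (use h Ti in auto)
      also have "\<dots> \<le> sqrt B * sqrt (\<integral>x. (norm (T N x))\<^sup>2 \<partial>M)" using h by (intro mult_right_mono) auto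
      finally show ?thesis .
    qed
    have "(\<lambda>n. \<integral>x. f n x \<bullet> H x \<partial>M) \<longlonglongrightarrow> (\<integral>x. f' x \<bullet> H x \<partial>M)"
    proof (rule integral_dominated_convergence[where w="\<lambda>x. real N * norm (G x)"])
      show "AE x in M. norm (f n x \<bullet> H x) \<le> real N * norm (G x)" for n
      proof (rule AE_I2)
        fix x assume "x \<in> space M"
        have "\<bar>f n x \<bullet> G x\<bar> \<le> real N * norm (G x)" if "x \<in> A N"
          using that Cauchy_Schwarz_ineq2[of "f n x" "G x"] mult_right_mono[of "norm (f n x)" "real N" "norm (G x)"]
          by (auto simp: A_def intro: order_trans)
        then show "norm (f n x \<bullet> H x) \<le> real N * norm (G x)" by (auto simp: H_def indicator_def)
      qed
    qed (use lim G1 in \<open>auto intro!: tendsto_intros\<close>)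
    from LIMSEQ_D[OF this, of "e / 2"] e
    obtain n0 where n0: "\<And>n. n \<ge> n0 \<Longrightarrow> \<bar>(\<integral>x. f n x \<bullet> H x \<partial>M) - (\<integral>x. f' x \<bullet> H x \<partial>M)\<bar> < e / 2"
      by auto
    show "\<exists>n0. \<forall>n\<ge>n0. norm ((\<integral>x. f n x \<bullet> G x \<partial>M) - (\<integral>x. f' x \<bullet> G x \<partial>M)) < e"
    proof (intro exI[of _ n0] allI impI)
      fix n assume "n \<ge> n0"
      have s1: "(\<integral>x. f n x \<bullet> G x \<partial>M) = (\<integral>x. f n x \<bullet> H x \<partial>M) + (\<integral>x. f n x \<bullet> T N x \<partial>M)"
        by (rule split) (use i in auto)
      have s2: "(\<integral>x. f' x \<bullet> G x \<partial>M) = (\<integral>x. f' x \<bullet> H x \<partial>M) + (\<integral>x. f' x \<bullet> T N x \<partial>M)"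
        by (rule split) (use L in auto)
      have "\<bar>\<integral>x. f n x \<bullet> T N x \<partial>M\<bar> \<le> sqrt B * sqrt (\<integral>x. (norm (T N x))\<^sup>2 \<partial>M)"
        by (rule tb) (use i b in auto)
      moreover have "\<bar>\<integral>x. f' x \<bullet> T N x \<partial>M\<bar> \<le> sqrt B * sqrt (\<integral>x. (norm (T N x))\<^sup>2 \<partial>M)"
        by (rule tb) (use L in auto)
      ultimately show "norm ((\<integral>x. f n x \<bullet> G x \<partial>M) - (\<integral>x. f' x \<bullet> G x \<partial>M)) < e"
        unfolding s1 s2 real_norm_def using n0[OF \<open>n \<ge> n0\<close>] N by linarith
    qed
  qed
qed

text \<open>If the iterated limit were negative, indices could be picked one after another, each so
  far out that its entries with all earlier ones lie below a fixed \<open>- q\<close>. A block of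
  size \<open>n\<close> then has sum at most \<open>n M - n (n - 1) q\<close>, which is negative for
  large \<open>n\<close>, against positivity.\<close>

lemma psd_limit_nonneg:
  fixes b :: "nat \<Rightarrow> nat \<Rightarrow> real"
  assumes sym: "\<And>i j. b i j = b j i" and M: "\<And>i. b i i \<le> M"
    and psd: "\<And>I. finite I \<Longrightarrow> 0 \<le> (\<Sum>i\<in>I. \<Sum>j\<in>I. b i j)"
    and lim: "\<And>i. (\<lambda>j. b i j) \<longlonglongrightarrow> t i" and T: "t \<longlonglongrightarrow> T"
  shows "T \<ge> 0"
proof (rule ccontr)
  assume neg: "\<not> T \<ge> 0"
  define q where "q = - T / 2"
  have q: "q > 0" using neg by (simp add: q_def)
  obtain N where N: "\<And>i. i \<ge> N \<Longrightarrow> t i < - q"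
    using order_tendstoD(2)[OF T, of "- q"] neg by (auto simp: q_def eventually_sequentially)
  have "\<exists>I. finite I \<and> card I = n \<and> (\<forall>i\<in>I. i \<ge> N) \<and> (\<forall>i\<in>I. \<forall>j\<in>I. i \<noteq> j \<longrightarrow> b i j < - q)" for n
  proof (induction n)
    case 0 show ?case by (intro exI[of _ "{}"]) auto
  next
    case (Suc n)
    then obtain I where I: "finite I" "card I = n" "\<forall>i\<in>I. i \<ge> N" "\<forall>i\<in>I. \<forall>j\<in>I. i \<noteq> j \<longrightarrow> b i j < - q" by blast
    have "eventually (\<lambda>m. \<forall>i\<in>I. b i m < - q) sequentially"
      using I N order_tendstoD(2)[OF lim] by (intro eventually_ball_finite) auto
    moreover have "eventually (\<lambda>m. m \<ge> N \<and> m > Max (insert 0 I)) sequentially"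
      by (intro eventually_conj eventually_ge_at_top eventually_gt_at_top)
    ultimately have "eventually (\<lambda>m. (\<forall>i\<in>I. b i m < - q) \<and> m \<ge> N \<and> m > Max (insert 0 I)) sequentially"
      by eventually_elim auto
    then obtain m where m: "\<forall>i\<in>I. b i m < - q" "m \<ge> N" "m > Max (insert 0 I)"
      using eventually_happens'[OF sequentially_bot] by blast
    then have "m \<notin> I" using I(1) by (metis Max_ge finite_insert insertCI leD)
    then show ?case using I m sym by (intro exI[of _ "insert m I"]) auto
  qed
  moreover obtain n :: nat where n: "real n > M / q + 1" by (meson reals_Archimedean2)
  ultimately obtain I where I: "finite I" "card I = n" "\<forall>i\<in>I. \<forall>j\<in>I. i \<noteq> j \<longrightarrow> b i j < - q" by blast
  have "M \<ge> 0"
    using order_trans[OF psd[of "{0}"], of M] M[of 0] by simp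
  then have np: "real n > 1" using n q by (smt (verit) divide_nonneg_pos)
  have "0 \<le> (\<Sum>i\<in>I. \<Sum>j\<in>I. b i j)" using psd I by blast
  also have "\<dots> \<le> (\<Sum>i\<in>I. M - q * (real n - 1))"
  proof (rule sum_mono)
    fix i assume i: "i \<in> I"
    have "(\<Sum>j\<in>I. b i j) = b i i + (\<Sum>j\<in>I - {i}. b i j)" using I i by (simp add: sum.remove)
    also have "(\<Sum>j\<in>I - {i}. b i j) \<le> (\<Sum>j\<in>I - {i}. - q)"
      using I i by (intro sum_mono) (auto simp: less_imp_le)
    also have "(\<Sum>j\<in>I - {i}. - q) = - q * (real n - 1)" using I i np by (simp add: of_nat_diff)
    finally show "(\<Sum>j\<in>I. b i j) \<le> M - q * (real n - 1)" using M[of i] by simp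
  qed
  also have "\<dots> = real n * (M - q * (real n - 1))" using I by simp
  finally have "M - q * (real n - 1) \<ge> 0" using np by (simp add: zero_le_mult_iff)
  moreover have "q * (real n - 1) > M" using n q by (simp add: field_simps)
  ultimately show False by linarith
qed

subsection \<open>Energy of the softened potential\<close>

lemma measurable_vec_nth [measurable (raw)]:
  fixes f :: "'a \<Rightarrow> real^3"
  assumes "f \<in> borel_measurable M" shows "(\<lambda>x. f x $ i) \<in> borel_measurable M"
  by (rule measurable_compose[OF assms]) (intro borel_measurable_continuous_onI continuous_intros)

lemma measurable_vecI:
  fixes f :: "'a \<Rightarrow> real^3"
  assumes "\<And>i. (\<lambda>x. f x $ i) \<in> borel_measurable M" shows "f \<in> borel_measurable M"
  using assms by (subst borel_measurable_euclidean_space) (auto simp: Basis_vec_def inner_axis)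

text \<open>The softened Newton potential of \<open>- div F\<close>, integrated by parts.\<close>

definition upot :: "real \<Rightarrow> (real^3 \<Rightarrow> real^3) \<Rightarrow> real^3 \<Rightarrow> real" where
  "upot d F x = (\<Sum>j\<in>UNIV. cv (\<lambda>y. F y $ j) (kk d j) x)"

text \<open>Convolution of \<open>F\<close> with a probability density; it has the same divergence
  as the softened gradient \<open>grad (upot d F)\<close>.\<close>

definition mol :: "real \<Rightarrow> (real^3 \<Rightarrow> real^3) \<Rightarrow> real^3 \<Rightarrow> real^3" where
  "mol d F x = (\<chi> i. cv (\<lambda>y. F y $ i) (rho d) x)"

lemma smooth_kernels:
  "d > 0 \<Longrightarrow> smooth_on UNIV (kk d j)" "d > 0 \<Longrightarrow> smooth_on UNIV (kk1 d j i)" "d > 0 \<Longrightarrow> smooth_on UNIV (rho d)"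
  using smooth_on_kk[OF open_UNIV, of d] sg_arg_pos' by blast+

lemma bfield_integrable:
  assumes "bfield R F"
  shows "integrable lborel (\<lambda>x. norm (F x))"
proof -
  have [measurable]: "F \<in> borel_measurable borel" and z: "\<And>x. norm x > R \<Longrightarrow> F x = 0"
    and i: "integrable lborel (\<lambda>x. (norm (F x))\<^sup>2)" using assms by (auto simp: bfield_def)
  have c: "integrable lborel (indicat_real (cball (0::real^3) R))"
    by (rule integrable_real_indicator) (use emeasure_lborel_cball_finite[of "0::real^3" R] in auto)
  show ?thesis
  proof (rule Bochner_Integration.integrable_bound[OF Bochner_Integration.integrable_add[OF c i]])
    have "norm (F x) \<le> 1 + (norm (F x))\<^sup>2" for x
      using zero_le_power2[of "norm (F x) - 1 / 2"] by (simp add: power2_eq_square algebra_simps)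
    then show "AE x in lborel. norm (norm (F x)) \<le> norm (indicat_real (cball 0 R) x + (norm (F x))\<^sup>2)"
      using z by (intro AE_I2) (auto simp: indicator_def not_le)
  qed auto
qed

lemma bfield_bscalar:
  assumes "bfield R F"
  shows "bscalar R (\<lambda>y. F y $ j)"
  unfolding bscalar_def
proof
  have [measurable]: "F \<in> borel_measurable borel" using assms by (auto simp: bfield_def)
  show "integrable lborel (\<lambda>y. F y $ j)"
    by (rule Bochner_Integration.integrable_bound[OF bfield_integrable[OF assms]])
       (auto intro: component_le_norm_cart)
qed (use assms in \<open>auto simp: bfield_def\<close>)

lemma smooth_on_upot: "d > 0 \<Longrightarrow> bfield R F \<Longrightarrow> smooth_on UNIV (upot d F)"
  unfolding upot_def[abs_def]
  by (intro smooth_on_sum smooth_on_cv[OF bfield_bscalar] smooth_kernels) auto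

lemma frechet_kk:
  "d > 0 \<Longrightarrow> frechet_derivative (kk d j) (at z) (axis i 1) = kk1 d j i z"
  by (subst frechet_derivative_at[OF kk_has_derivative[OF sg_arg_pos'], symmetric])
     (auto simp: axis_1_component if_distrib cong: if_cong)

lemma grad_upot:
  assumes d: "d > 0" and F: "bfield R F"
  shows "grad (upot d F) x $ i = (\<Sum>j\<in>UNIV. cv (\<lambda>y. F y $ j) (kk1 d j i) x)"
proof -
  have "(upot d F has_derivative (\<lambda>v. \<Sum>j\<in>UNIV. cv (\<lambda>y. F y $ j) (\<lambda>z. frechet_derivative (kk d j) (at z) v) x)) (at x)"
    unfolding upot_def[abs_def]
    by (intro has_derivative_sum cv_has_derivative[OF bfield_bscalar[OF F] smooth_kernels(1)[OF d]])
  from frechet_derivative_at[OF this, symmetric]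
  show ?thesis by (simp add: grad_def frechet_kk[OF d])
qed

lemma measurable_cv:
  assumes "bscalar R a" "smooth_on UNIV f"
  shows "cv a f \<in> borel_measurable borel"
  using smooth_on_continuous_on[OF smooth_on_cv[OF assms]] by (rule borel_measurable_continuous_onI)

lemma measurable_mol: "d > 0 \<Longrightarrow> bfield R F \<Longrightarrow> mol d F \<in> borel_measurable borel"
  unfolding mol_def[abs_def]
  by (rule measurable_vecI) (auto intro: measurable_cv bfield_bscalar smooth_kernels)

lemma sum_decay:
  fixes f :: "'i::finite \<Rightarrow> 'a \<Rightarrow> real"
  assumes "\<And>i. \<exists>C\<ge>0. \<forall>x. \<bar>f i x\<bar> \<le> C * g x" 
  shows "\<exists>C\<ge>0. \<forall>x. \<bar>\<Sum>i\<in>UNIV. f i x\<bar> \<le> C * g x"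
proof -
  obtain C where C: "\<And>i. C i \<ge> 0" "\<And>i x. \<bar>f i x\<bar> \<le> C i * g x" using assms by metis
  have "\<bar>\<Sum>i\<in>UNIV. f i x\<bar> \<le> (\<Sum>i\<in>UNIV. C i) * g x" for x
    unfolding sum_distrib_right by (rule order_trans[OF sum_abs sum_mono]) (rule C)
  then show ?thesis using C by (intro exI[of _ "\<Sum>i\<in>UNIV. C i"]) (auto intro: sum_nonneg)
qed

lemma cv_decay':
  assumes "bscalar R a" "R \<ge> 0" "d > 0" "\<And>z. \<bar>f z\<bar> \<le> C * sg d z ^ p"
  shows "\<exists>C\<ge>0. \<forall>x. \<bar>cv a f x\<bar> \<le> C * sg 1 x ^ p"
  using cv_decay[OF assms] by metis

lemma upot_decay:
  assumes d: "d > 0" and F: "bfield R F" and R: "R \<ge> 0"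
  shows "\<exists>C\<ge>0. \<forall>x. \<bar>upot d F x\<bar> \<le> C * sg 1 x ^ 2"
    and "\<exists>C\<ge>0. \<forall>x. \<bar>grad (upot d F) x $ i\<bar> \<le> C * sg 1 x ^ 3"
    and "\<exists>C\<ge>0. \<forall>x. \<bar>mol d F x $ i\<bar> \<le> C * sg 1 x ^ 5"
  unfolding grad_upot[OF d F] upot_def mol_def vec_lambda_beta
  by (rule sum_decay cv_decay'[OF bfield_bscalar[OF F] R d kernel_decay(1)[OF d]]
      cv_decay'[OF bfield_bscalar[OF F] R d kernel_decay(2)[OF d]]
      cv_decay'[OF bfield_bscalar[OF F] R d kernel_decay(3)[OF d]])+

text \<open>The defect between softened gradient and mollified field. It is divergence free because
  \<open>upot\<close> solves \<open>Laplace u = div (mol d F)\<close>, which reduces to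
  \<open>kernel_divergence\<close> under the integral.\<close>

definition wfield :: "real \<Rightarrow> (real^3 \<Rightarrow> real^3) \<Rightarrow> 3 \<Rightarrow> real^3 \<Rightarrow> real" where
  "wfield d F i x = grad (upot d F) x $ i - mol d F x $ i"

lemma frechet_wfield:
  assumes d: "d > 0" and F: "bfield R F"
  shows "smooth_on UNIV (wfield d F i)"
    and "frechet_derivative (wfield d F i) (at x) (axis i 1) =
      (\<Sum>j\<in>UNIV. cv (\<lambda>y. F y $ j) (\<lambda>z. frechet_derivative (kk1 d j i) (at z) (axis i 1)) x)
      - cv (\<lambda>y. F y $ i) (\<lambda>z. frechet_derivative (rho d) (at z) (axis i 1)) x"
proof -
  have e: "wfield d F i = (\<lambda>x. (\<Sum>j\<in>UNIV. cv (\<lambda>y. F y $ j) (kk1 d j i) x) - cv (\<lambda>y. F y $ i) (rho d) x)"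
    by (auto simp: wfield_def grad_upot[OF d F] mol_def)
  show "smooth_on UNIV (wfield d F i)" unfolding e
    by (intro smooth_on_diff smooth_on_sum smooth_on_cv[OF bfield_bscalar[OF F]] smooth_kernels d) auto
  have "(wfield d F i has_derivative (\<lambda>v. (\<Sum>j\<in>UNIV. cv (\<lambda>y. F y $ j) (\<lambda>z. frechet_derivative (kk1 d j i) (at z) v) x)
      - cv (\<lambda>y. F y $ i) (\<lambda>z. frechet_derivative (rho d) (at z) v) x)) (at x)"
    unfolding e
    by (intro has_derivative_diff has_derivative_sum cv_has_derivative[OF bfield_bscalar[OF F]] smooth_kernels d)
  from frechet_derivative_at[OF this, symmetric]
  show "frechet_derivative (wfield d F i) (at x) (axis i 1) =
      (\<Sum>j\<in>UNIV. cv (\<lambda>y. F y $ j) (\<lambda>z. frechet_derivative (kk1 d j i) (at z) (axis i 1)) x)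
      - cv (\<lambda>y. F y $ i) (\<lambda>z. frechet_derivative (rho d) (at z) (axis i 1)) x" by simp
qed

lemma wfield_div_free:
  assumes d: "d > 0" and F: "bfield R F"
  shows "(\<Sum>i\<in>UNIV. frechet_derivative (wfield d F i) (at x) (axis i 1)) = 0"
proof -
  have "(\<Sum>i\<in>UNIV. \<Sum>j\<in>UNIV. cv (\<lambda>y. F y $ j) (\<lambda>z. frechet_derivative (kk1 d j i) (at z) (axis i 1)) x)
      = (\<Sum>j\<in>UNIV. \<Sum>i\<in>UNIV. cv (\<lambda>y. F y $ j) (\<lambda>z. frechet_derivative (kk1 d j i) (at z) (axis i 1)) x)"
    by (rule sum.swap)
  also have "\<dots> = (\<Sum>j\<in>UNIV. cv (\<lambda>y. F y $ j) (\<lambda>z. frechet_derivative (rho d) (at z) (axis j 1)) x)"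
  proof (rule sum.cong[OF refl])
    fix j
    have "(\<Sum>i\<in>UNIV. cv (\<lambda>y. F y $ j) (\<lambda>z. frechet_derivative (kk1 d j i) (at z) (axis i 1)) x)
       = (\<integral>y. (\<Sum>i\<in>UNIV. F y $ j * frechet_derivative (kk1 d j i) (at (x - y)) (axis i 1)) \<partial>lborel)"
      unfolding cv_def
      by (rule Bochner_Integration.integral_sum[symmetric])
         (intro integrable_cv[OF bfield_bscalar[OF F]] smooth_on_continuous_on smooth_on_frechet smooth_kernels d)
    also have "\<dots> = cv (\<lambda>y. F y $ j) (\<lambda>z. frechet_derivative (rho d) (at z) (axis j 1)) x"
      unfolding cv_def sum_distrib_left[symmetric] kernel_divergence[OF sg_arg_pos'[OF d]] ..
    finally show "(\<Sum>i\<in>UNIV. cv (\<lambda>y. F y $ j) (\<lambda>z. frechet_derivative (kk1 d j i) (at z) (axis i 1)) x)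
       = cv (\<lambda>y. F y $ j) (\<lambda>z. frechet_derivative (rho d) (at z) (axis j 1)) x" .
  qed
  finally show ?thesis unfolding frechet_wfield(2)[OF d F] sum_subtractf by simp
qed

lemma sg1_le_1: "sg 1 x \<le> 1" "sg 1 x > 0"
  using sg_pos[of 1 x] by (auto simp: sg_def intro: inverse_le_1_iff[THEN iffD2])

lemma sg1_power_mono: "m \<le> n \<Longrightarrow> sg 1 x ^ n \<le> sg 1 x ^ m"
  using sg1_le_1[of x] by (intro power_decreasing) auto

lemma wfield_decay:
  assumes d: "d > 0" and F: "bfield R F" and R: "R \<ge> 0"
  shows "\<exists>C\<ge>0. \<forall>x. \<bar>wfield d F i x\<bar> \<le> C * sg 1 x ^ 3"
    and "\<exists>C\<ge>0. \<forall>x. \<bar>frechet_derivative (wfield d F i) (at x) (axis i 1)\<bar> \<le> C * sg 1 x ^ 4"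
proof -
  obtain C1 C2 where C: "C1 \<ge> 0" "\<And>x. \<bar>grad (upot d F) x $ i\<bar> \<le> C1 * sg 1 x ^ 3"
     "C2 \<ge> 0" "\<And>x. \<bar>mol d F x $ i\<bar> \<le> C2 * sg 1 x ^ 5" using upot_decay(2,3)[OF assms] by metis
  have "\<bar>wfield d F i x\<bar> \<le> (C1 + C2) * sg 1 x ^ 3" for x
    using C(2)[of x] order_trans[OF C(4)[of x] mult_left_mono[OF sg1_power_mono[of 3 5 x] C(3)]]
    unfolding wfield_def by (simp add: algebra_simps)
  then show "\<exists>C\<ge>0. \<forall>x. \<bar>wfield d F i x\<bar> \<le> C * sg 1 x ^ 3" using C by (intro exI[of _ "C1 + C2"]) auto
  have "\<exists>C\<ge>0. \<forall>x. \<bar>\<Sum>j\<in>UNIV. cv (\<lambda>y. F y $ j) (\<lambda>z. frechet_derivative (kk1 d j i) (at z) (axis i 1)) x\<bar> \<le> C * sg 1 x ^ 4"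
    by (rule sum_decay cv_decay'[OF bfield_bscalar[OF F] R d kernel_decay(4)[OF d]])+
  then obtain D1 where D1: "D1 \<ge> 0" "\<And>x. \<bar>\<Sum>j\<in>UNIV. cv (\<lambda>y. F y $ j) (\<lambda>z. frechet_derivative (kk1 d j i) (at z) (axis i 1)) x\<bar> \<le> D1 * sg 1 x ^ 4"
    by blast
  have "\<exists>C\<ge>0. \<forall>x. \<bar>cv (\<lambda>y. F y $ i) (\<lambda>z. frechet_derivative (rho d) (at z) (axis i 1)) x\<bar> \<le> C * sg 1 x ^ 6"
    by (rule cv_decay'[OF bfield_bscalar[OF F] R d kernel_decay(5)[OF d]])
  then obtain D2 where D2: "D2 \<ge> 0" "\<And>x. \<bar>cv (\<lambda>y. F y $ i) (\<lambda>z. frechet_derivative (rho d) (at z) (axis i 1)) x\<bar> \<le> D2 * sg 1 x ^ 6"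
    by blast
  have "\<bar>frechet_derivative (wfield d F i) (at x) (axis i 1)\<bar> \<le> (D1 + D2) * sg 1 x ^ 4" for x
    using D1(2)[of x] order_trans[OF D2(2)[of x] mult_left_mono[OF sg1_power_mono[of 4 6 x] D2(1)]]
    unfolding frechet_wfield(2)[OF d F] by (simp add: algebra_simps)
  then show "\<exists>C\<ge>0. \<forall>x. \<bar>frechet_derivative (wfield d F i) (at x) (axis i 1)\<bar> \<le> C * sg 1 x ^ 4"
    using D1 D2 by (intro exI[of _ "D1 + D2"]) auto
qed

lemma upot_decay_uniform:
  assumes d: "d > 0" and F: "bfield R F" and R: "R \<ge> 0"
  obtains A where "A \<ge> 0" "\<And>x. \<bar>upot d F x\<bar> \<le> A * sg 1 x ^ 2"
    "\<And>x i. \<bar>grad (upot d F) x $ i\<bar> \<le> A * sg 1 x ^ 3"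
proof -
  obtain A0 where A0: "A0 \<ge> 0" "\<And>x. \<bar>upot d F x\<bar> \<le> A0 * sg 1 x ^ 2" using upot_decay(1)[OF d F R] by blast
  have "\<forall>i. \<exists>C\<ge>0. \<forall>x. \<bar>grad (upot d F) x $ i\<bar> \<le> C * sg 1 x ^ 3" using upot_decay(2)[OF d F R] by blast
  then obtain C where C: "\<And>i. C i \<ge> 0" "\<And>i x. \<bar>grad (upot d F) x $ i\<bar> \<le> C i * sg 1 x ^ 3" by metis
  have s: "C i \<le> (\<Sum>i\<in>UNIV. C i)" for i using C by (intro member_le_sum) auto
  have s0: "(\<Sum>i\<in>UNIV. C i) \<ge> 0" using C by (intro sum_nonneg) auto
  have p: "sg 1 x ^ n \<ge> 0" for x n using sg1_le_1[of x] by simp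
  show ?thesis
  proof (rule that[of "A0 + (\<Sum>i\<in>UNIV. C i)"])
    show "\<bar>upot d F x\<bar> \<le> (A0 + (\<Sum>i\<in>UNIV. C i)) * sg 1 x ^ 2" for x
      by (rule order_trans[OF A0(2) mult_right_mono[OF _ p]]) (use s0 in auto)
    show "\<bar>grad (upot d F) x $ i\<bar> \<le> (A0 + (\<Sum>i\<in>UNIV. C i)) * sg 1 x ^ 3" for x i
      by (rule order_trans[OF C(2) mult_right_mono[OF _ p]]) (use s[of i] A0 in auto)
  qed (use A0 s0 in auto)
qed

text \<open>Comparison with \<open>sg 1 ^ 5\<close>, whose integral was computed above. The
  exponents of the energy identity are arranged to reach 5: decay 2 for a potential and 3 for the
  defect field.\<close>

lemma integrable_decay:
  assumes "f \<in> borel_measurable borel" "\<And>x. \<bar>f x\<bar> \<le> C * sg 1 x ^ p" "p \<ge> 5" "C \<ge> 0"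
  shows "integrable lborel f"
proof (rule Bochner_Integration.integrable_bound)
  show "integrable lborel (\<lambda>x. C * sg 1 x ^ 5)" using integrable_sg5[of 1] by simp
  have "\<bar>f x\<bar> \<le> C * sg 1 x ^ 5" for x
    using order_trans[OF assms(2)[of x] mult_left_mono[OF sg1_power_mono[OF assms(3)] assms(4)]] .
  then show "AE x in lborel. norm (f x) \<le> norm (C * sg 1 x ^ 5)"
    by (intro AE_I2) (auto intro: order_trans[OF _ abs_ge_self])
qed (use assms in auto)

lemma mult_decay:
  assumes "\<bar>a\<bar> \<le> A * s ^ m" "\<bar>b\<bar> \<le> B * s ^ n" "A \<ge> 0" "s \<ge> (0::real)"
  shows "\<bar>a * b\<bar> \<le> (A * B) * s ^ (m + n)"
proof -
  have "\<bar>a\<bar> * \<bar>b\<bar> \<le> (A * s ^ m) * (B * s ^ n)" using assms by (intro mult_mono) auto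
  then show ?thesis by (simp add: abs_mult power_add mult_ac)
qed

text \<open>Integrates the divergence of \<open>v\<close> times the defect field over the whole
  space. Since the defect is divergence free, only \<open>grad v\<close> paired with the defect
  remains, and that integral is 0.\<close>

lemma energy_identity:
  assumes d: "d > 0" and F: "bfield R F" and R: "R \<ge> 0"
    and v: "smooth_on UNIV v" and A: "A \<ge> 0" "\<And>x. \<bar>v x\<bar> \<le> A * sg 1 x ^ 2" "\<And>x i. \<bar>grad v x $ i\<bar> \<le> A * sg 1 x ^ 3"
  shows "integrable lborel (\<lambda>x. grad v x \<bullet> grad (upot d F) x)"
    and "integrable lborel (\<lambda>x. grad v x \<bullet> mol d F x)"
    and "(\<integral>x. grad v x \<bullet> grad (upot d F) x \<partial>lborel) = (\<integral>x. grad v x \<bullet> mol d F x \<partial>lborel)"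
proof -
  note u = smooth_on_upot[OF d F]
  have [measurable]: "grad v \<in> borel_measurable borel" "grad (upot d F) \<in> borel_measurable borel"
    "mol d F \<in> borel_measurable borel" by (rule measurable_grad v u measurable_mol[OF d F])+
  have mW: "wfield d F i \<in> borel_measurable borel" for i
    using smooth_on_continuous_on[OF frechet_wfield(1)[OF d F]] by (rule borel_measurable_continuous_onI)
  have mv: "v \<in> borel_measurable borel"
    using smooth_on_continuous_on[OF v] by (rule borel_measurable_continuous_onI)
  have s0: "sg 1 x \<ge> 0" for x using sg1_le_1[of x] by simp
  have iu: "integrable lborel (\<lambda>x. grad v x $ i * grad (upot d F) x $ i)" for i
  proof -
    obtain C where C: "C \<ge> 0" "\<And>x. \<bar>grad (upot d F) x $ i\<bar> \<le> C * sg 1 x ^ 3" using upot_decay(2)[OF d F R] by metis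
    show ?thesis
      by (rule integrable_decay[OF _ mult_decay[OF A(3) C(2) A(1) s0]]) (use A C in auto)
  qed
  have im: "integrable lborel (\<lambda>x. grad v x $ i * mol d F x $ i)" for i
  proof -
    obtain C where C: "C \<ge> 0" "\<And>x. \<bar>mol d F x $ i\<bar> \<le> C * sg 1 x ^ 5" using upot_decay(3)[OF d F R] by metis
    show ?thesis
      by (rule integrable_decay[OF _ mult_decay[OF A(3) C(2) A(1) s0]]) (use A C in auto)
  qed
  show 1: "integrable lborel (\<lambda>x. grad v x \<bullet> grad (upot d F) x)"
    using iu by (simp add: inner_vec_def)
  show 2: "integrable lborel (\<lambda>x. grad v x \<bullet> mol d F x)"
    using im by (simp add: inner_vec_def)
  define V' where "V' i x = (\<lambda>h. v x * frechet_derivative (wfield d F i) (at x) h + frechet_derivative v (at x) h * wfield d F i x)" for i x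
  \<comment> \<open>Compares the weight at points at distance at most 1, to bound the derivative
    along the unit segments demanded by \<open>integral_directional_derivative_eq_0\<close>.\<close>
  obtain K where K: "K > 0" "\<And>x y. norm (y::real^3) \<le> 1 \<Longrightarrow> sg 1 (x - y) \<le> K * sg 1 x"
    using sg_decay[of 1 1] by auto
  have z: "integrable lborel (\<lambda>x. V' i x (axis i 1)) \<and> (\<integral>x. V' i x (axis i 1) \<partial>lborel) = 0" for i
  proof -
    obtain C where C: "C \<ge> 0" "\<And>x. \<bar>wfield d F i x\<bar> \<le> C * sg 1 x ^ 3" using wfield_decay(1)[OF d F R] by metis
    obtain D where D: "D \<ge> 0" "\<And>x. \<bar>frechet_derivative (wfield d F i) (at x) (axis i 1)\<bar> \<le> D * sg 1 x ^ 4"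
      using wfield_decay(2)[OF d F R] by metis
    have iV: "integrable lborel (\<lambda>x. v x * wfield d F i x)"
      by (rule integrable_decay[OF _ mult_decay[OF A(2) C(2) A(1) s0]]) (use A C mW mv in auto)
    have dV: "((\<lambda>x. v x * wfield d F i x) has_derivative V' i x) (at x)" for x
      unfolding V'_def
      by (intro has_derivative_mult smooth_on_has_derivative[OF v] smooth_on_has_derivative[OF frechet_wfield(1)[OF d F]]) auto
    define B where "B = A * D + A * C"
    have b: "\<bar>V' i x (axis i 1)\<bar> \<le> B * sg 1 x ^ 5" for x
    proof -
      have "\<bar>v x * frechet_derivative (wfield d F i) (at x) (axis i 1)\<bar> \<le> A * D * sg 1 x ^ (2 + 4)"
        by (rule mult_decay) (use A D s0 in auto)
      also have "\<dots> \<le> A * D * sg 1 x ^ 5" using A D by (intro mult_left_mono sg1_power_mono) auto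
      finally have 1: "\<bar>v x * frechet_derivative (wfield d F i) (at x) (axis i 1)\<bar> \<le> A * D * sg 1 x ^ 5" .
      have "\<bar>grad v x $ i * wfield d F i x\<bar> \<le> A * C * sg 1 x ^ (3 + 3)"
        by (rule mult_decay) (use A C s0 in auto)
      also have "\<dots> \<le> A * C * sg 1 x ^ 5" using A C by (intro mult_left_mono sg1_power_mono) auto
      finally have 2: "\<bar>frechet_derivative v (at x) (axis i 1) * wfield d F i x\<bar> \<le> A * C * sg 1 x ^ 5" by (simp add: grad_def)
      show ?thesis unfolding V'_def B_def using 1 2 by (simp add: algebra_simps)
    qed
    have B: "B \<ge> 0" using A C D by (simp add: B_def)
    have w: "integrable lborel (\<lambda>x. B * K ^ 5 * sg 1 x ^ 5)" using integrable_sg5[of 1] by simp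
    have bs: "\<bar>V' i (x + s *\<^sub>R axis i 1) (axis i 1)\<bar> \<le> B * K ^ 5 * sg 1 x ^ 5" if "0 \<le> s" "s \<le> 1" for x s
    proof -
      have "sg 1 (x - (- s *\<^sub>R axis i 1)) \<le> K * sg 1 x" using that by (intro K) simp
      then have "sg 1 (x + s *\<^sub>R axis i 1) ^ 5 \<le> (K * sg 1 x) ^ 5" using s0 by (intro power_mono) auto
      then have "B * sg 1 (x + s *\<^sub>R axis i 1) ^ 5 \<le> B * (K * sg 1 x) ^ 5" using B by (rule mult_left_mono)
      then show ?thesis using b[of "x + s *\<^sub>R axis i 1"] by (simp add: power_mult_distrib mult_ac)
    qed
    show ?thesis using integral_directional_derivative_eq_0[OF dV iV w bs] by blast
  qed
  have "0 = (\<Sum>i\<in>UNIV. \<integral>x. V' i x (axis i 1) \<partial>lborel)" using z by simp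
  also have "\<dots> = (\<integral>x. (\<Sum>i\<in>UNIV. V' i x (axis i 1)) \<partial>lborel)"
    using z by (intro Bochner_Integration.integral_sum[symmetric]) auto
  also have "\<dots> = (\<integral>x. grad v x \<bullet> grad (upot d F) x - grad v x \<bullet> mol d F x \<partial>lborel)"
  proof (rule Bochner_Integration.integral_cong[OF refl])
    fix x
    have "(\<Sum>i\<in>UNIV. V' i x (axis i 1)) = v x * (\<Sum>i\<in>UNIV. frechet_derivative (wfield d F i) (at x) (axis i 1))
        + (\<Sum>i\<in>UNIV. grad v x $ i * wfield d F i x)"
      by (simp add: V'_def sum.distrib sum_distrib_left grad_def)
    then show "(\<Sum>i\<in>UNIV. V' i x (axis i 1)) = grad v x \<bullet> grad (upot d F) x - grad v x \<bullet> mol d F x"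
      unfolding wfield_div_free[OF d F] by (simp add: wfield_def inner_vec_def algebra_simps sum_subtractf)
  qed
  also have "\<dots> = (\<integral>x. grad v x \<bullet> grad (upot d F) x \<partial>lborel) - (\<integral>x. grad v x \<bullet> mol d F x \<partial>lborel)"
    using 1 2 by simp
  finally show "(\<integral>x. grad v x \<bullet> grad (upot d F) x \<partial>lborel) = (\<integral>x. grad v x \<bullet> mol d F x \<partial>lborel)" by simp
qed

lemma inner_mol:
  assumes d: "d > 0" and F: "bfield R F"
  shows "integrable lborel (\<lambda>y. rho d (x - y) * (F y \<bullet> w))"
    and "w \<bullet> mol d F x = (\<integral>y. rho d (x - y) * (F y \<bullet> w) \<partial>lborel)"
proof -
  have i: "integrable lborel (\<lambda>y. F y $ i * rho d (x - y))" for i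
    by (rule integrable_cv[OF bfield_bscalar[OF F] smooth_on_continuous_on[OF smooth_kernels(3)[OF d]]])
  have e: "rho d (x - y) * (F y \<bullet> w) = (\<Sum>i\<in>UNIV. w $ i * (F y $ i * rho d (x - y)))" for y
    by (simp add: inner_vec_def sum_distrib_left mult_ac)
  show "integrable lborel (\<lambda>y. rho d (x - y) * (F y \<bullet> w))" unfolding e using i by auto
  show "w \<bullet> mol d F x = (\<integral>y. rho d (x - y) * (F y \<bullet> w) \<partial>lborel)" unfolding e
    using i by (simp add: mol_def inner_vec_def cv_def Bochner_Integration.integral_sum)
qed

lemma nn_integral_rho_shift:
  assumes d: "d > 0"
  shows "(\<integral>\<^sup>+y. ennreal (rho d (x - y)) \<partial>lborel) = 1" "(\<integral>\<^sup>+y. ennreal (rho d (y - x)) \<partial>lborel) = 1"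
  using nn_integral_lborel_affine[of "\<lambda>y. ennreal (rho d y)" "-1" x]
    nn_integral_lborel_affine[of "\<lambda>y. ennreal (rho d y)" "1" "-x"] nn_integral_rho[OF d]
  by (simp_all add: add.commute)

text \<open>Young's inequality with the unit mass of the mollifier absorbs one half of the energy.\<close>

lemma upot_grad_L2:
  assumes d: "d > 0" and F: "bfield R F" and R: "R \<ge> 0"
  shows "integrable lborel (\<lambda>x. (norm (grad (upot d F) x))\<^sup>2)"
    and "(\<integral>x. (norm (grad (upot d F) x))\<^sup>2 \<partial>lborel) \<le> (\<integral>x. (norm (F x))\<^sup>2 \<partial>lborel)"
    and "(\<integral>x. (norm (grad (upot d F) x))\<^sup>2 \<partial>lborel) = (\<integral>x. grad (upot d F) x \<bullet> mol d F x \<partial>lborel)"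
proof -
  let ?g = "grad (upot d F)"
  have [measurable]: "?g \<in> borel_measurable borel" by (rule measurable_grad[OF smooth_on_upot[OF d F]])
  have [measurable]: "F \<in> borel_measurable borel" and iF: "integrable lborel (\<lambda>x. (norm (F x))\<^sup>2)"
    using F by (auto simp: bfield_def)
  obtain A where A: "A \<ge> 0" "\<And>x. \<bar>upot d F x\<bar> \<le> A * sg 1 x ^ 2" "\<And>x i. \<bar>?g x $ i\<bar> \<le> A * sg 1 x ^ 3"
    by (rule upot_decay_uniform[OF d F R]) (rule that)
  note E = energy_identity[OF d F R smooth_on_upot[OF d F] A]
  show i: "integrable lborel (\<lambda>x. (norm (?g x))\<^sup>2)" using E(1) by (simp add: power2_norm_eq_inner)
  show eq: "(\<integral>x. (norm (?g x))\<^sup>2 \<partial>lborel) = (\<integral>x. ?g x \<bullet> mol d F x \<partial>lborel)"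
    using E(3) by (simp add: power2_norm_eq_inner)
  have pt: "ennreal (?g x \<bullet> mol d F x) \<le> (\<integral>\<^sup>+y. ennreal (rho d (x - y) * (norm (F y))\<^sup>2 / 2) \<partial>lborel) + ennreal ((norm (?g x))\<^sup>2 / 2)" for x
  proof -
    have "?g x \<bullet> mol d F x = (\<integral>y. rho d (x - y) * (F y \<bullet> ?g x) \<partial>lborel)" by (rule inner_mol(2)[OF d F])
    then have "ennreal (?g x \<bullet> mol d F x) \<le> (\<integral>\<^sup>+y. ennreal \<bar>rho d (x - y) * (F y \<bullet> ?g x)\<bar> \<partial>lborel)"
      using integral_norm_bound_ennreal[OF inner_mol(1)[OF d F, of x "?g x"]]
      by (auto intro: order_trans[OF ennreal_leI[OF abs_ge_self]])
    also have "\<dots> \<le> (\<integral>\<^sup>+y. ennreal (rho d (x - y) * (norm (F y))\<^sup>2 / 2) + ennreal (rho d (x - y)) * ennreal ((norm (?g x))\<^sup>2 / 2) \<partial>lborel)"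
    proof (rule nn_integral_mono)
      fix y
      have r: "rho d (x - y) \<ge> 0" using d by (simp add: rho_nonneg)
      have "\<bar>F y \<bullet> ?g x\<bar> \<le> norm (F y) * norm (?g x)" by (rule Cauchy_Schwarz_ineq2)
      also have "\<dots> \<le> (norm (F y))\<^sup>2 / 2 + (norm (?g x))\<^sup>2 / 2"
        using zero_le_power2[of "norm (F y) - norm (?g x)"] by (simp add: power2_eq_square algebra_simps)
      finally have "rho d (x - y) * \<bar>F y \<bullet> ?g x\<bar> \<le> rho d (x - y) * ((norm (F y))\<^sup>2 / 2 + (norm (?g x))\<^sup>2 / 2)"
        using r by (rule mult_left_mono)
      then have "ennreal \<bar>rho d (x - y) * (F y \<bullet> ?g x)\<bar> \<le> ennreal (rho d (x - y) * (norm (F y))\<^sup>2 / 2 + rho d (x - y) * ((norm (?g x))\<^sup>2 / 2))"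
        using r by (intro ennreal_leI) (simp add: abs_mult distrib_left)
      also have "\<dots> = ennreal (rho d (x - y) * (norm (F y))\<^sup>2 / 2) + ennreal (rho d (x - y)) * ennreal ((norm (?g x))\<^sup>2 / 2)"
        using r by (simp add: ennreal_plus flip: ennreal_mult)
      finally show "ennreal \<bar>rho d (x - y) * (F y \<bullet> ?g x)\<bar> \<le> ennreal (rho d (x - y) * (norm (F y))\<^sup>2 / 2) + ennreal (rho d (x - y)) * ennreal ((norm (?g x))\<^sup>2 / 2)" .
    qed
    also have "\<dots> = (\<integral>\<^sup>+y. ennreal (rho d (x - y) * (norm (F y))\<^sup>2 / 2) \<partial>lborel) + (\<integral>\<^sup>+y. ennreal (rho d (x - y)) \<partial>lborel) * ennreal ((norm (?g x))\<^sup>2 / 2)"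
      by (subst nn_integral_add) (auto simp: nn_integral_multc)
    finally show ?thesis by (simp add: nn_integral_rho_shift[OF d])
  qed
  have "ennreal (\<integral>x. (norm (?g x))\<^sup>2 \<partial>lborel) = (\<integral>\<^sup>+x. ennreal ((norm (?g x))\<^sup>2) \<partial>lborel)"
    by (rule nn_integral_eq_integral[symmetric, OF i]) auto
  have g2: "(\<integral>\<^sup>+x. ennreal ((norm (?g x))\<^sup>2 / 2) \<partial>lborel) = ennreal ((\<integral>x. (norm (?g x))\<^sup>2 \<partial>lborel) / 2)"
    using i by (subst nn_integral_eq_integral) auto
  have f2: "(\<integral>\<^sup>+x. \<integral>\<^sup>+y. ennreal (rho d (x - y) * (norm (F y))\<^sup>2 / 2) \<partial>lborel \<partial>lborel) = ennreal ((\<integral>x. (norm (F x))\<^sup>2 \<partial>lborel) / 2)"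
  proof -
    have "(\<integral>\<^sup>+x. \<integral>\<^sup>+y. ennreal (rho d (x - y) * (norm (F y))\<^sup>2 / 2) \<partial>lborel \<partial>lborel)
      = (\<integral>\<^sup>+y. \<integral>\<^sup>+x. ennreal (rho d (x - y) * (norm (F y))\<^sup>2 / 2) \<partial>lborel \<partial>lborel)"
      by (rule lborel_pair.Fubini') measurable
    also have "\<dots> = (\<integral>\<^sup>+y. \<integral>\<^sup>+x. ennreal (rho d (x - y)) * ennreal ((norm (F y))\<^sup>2 / 2) \<partial>lborel \<partial>lborel)"
      using d by (simp add: ennreal_mult[symmetric] rho_nonneg)
    also have "\<dots> = (\<integral>\<^sup>+y. ennreal ((norm (F y))\<^sup>2 / 2) \<partial>lborel)"
      by (simp add: nn_integral_multc nn_integral_rho_shift[OF d])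
    also have "\<dots> = ennreal ((\<integral>x. (norm (F x))\<^sup>2 \<partial>lborel) / 2)"
      using iF by (subst nn_integral_eq_integral) auto
    finally show ?thesis .
  qed
  have "ennreal (\<integral>x. ?g x \<bullet> mol d F x \<partial>lborel) \<le> (\<integral>\<^sup>+x. ennreal (?g x \<bullet> mol d F x) \<partial>lborel)"
  proof -
    have "(\<integral>x. ?g x \<bullet> mol d F x \<partial>lborel) \<le> (\<integral>x. max 0 (?g x \<bullet> mol d F x) \<partial>lborel)"
      using E(2) by (intro integral_mono) auto
    then have "ennreal (\<integral>x. ?g x \<bullet> mol d F x \<partial>lborel) \<le> ennreal (\<integral>x. max 0 (?g x \<bullet> mol d F x) \<partial>lborel)" by (rule ennreal_leI)
    also have "\<dots> = (\<integral>\<^sup>+x. ennreal (max 0 (?g x \<bullet> mol d F x)) \<partial>lborel)"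
      using E(2) by (intro nn_integral_eq_integral[symmetric]) auto
    also have "\<dots> = (\<integral>\<^sup>+x. ennreal (?g x \<bullet> mol d F x) \<partial>lborel)"
      by (intro nn_integral_cong) (auto simp: max_def ennreal_neg)
    finally show ?thesis .
  qed
  also have "\<dots> \<le> (\<integral>\<^sup>+x. (\<integral>\<^sup>+y. ennreal (rho d (x - y) * (norm (F y))\<^sup>2 / 2) \<partial>lborel) + ennreal ((norm (?g x))\<^sup>2 / 2) \<partial>lborel)"
    by (rule nn_integral_mono) (rule pt)
  also have "\<dots> = ennreal ((\<integral>x. (norm (F x))\<^sup>2 \<partial>lborel) / 2) + ennreal ((\<integral>x. (norm (?g x))\<^sup>2 \<partial>lborel) / 2)"
    by (subst nn_integral_add) (auto simp: f2 g2)
  also have "\<dots> = ennreal ((\<integral>x. (norm (F x))\<^sup>2 \<partial>lborel) / 2 + (\<integral>x. (norm (?g x))\<^sup>2 \<partial>lborel) / 2)"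
    by (rule ennreal_plus[symmetric]) auto
  finally have "(\<integral>x. ?g x \<bullet> mol d F x \<partial>lborel) \<le> (\<integral>x. (norm (F x))\<^sup>2 \<partial>lborel) / 2 + (\<integral>x. (norm (?g x))\<^sup>2 \<partial>lborel) / 2"
    by (subst (asm) ennreal_le_iff) (auto intro!: add_nonneg_nonneg)
  then show "(\<integral>x. (norm (?g x))\<^sup>2 \<partial>lborel) \<le> (\<integral>x. (norm (F x))\<^sup>2 \<partial>lborel)" unfolding eq[symmetric] by simp
qed

lemma integrable_Fubini_lborel:
  fixes f :: "real^3 \<Rightarrow> real^3 \<Rightarrow> real"
  assumes [measurable]: "(\<lambda>(x, y). f x y) \<in> borel_measurable (borel \<Otimes>\<^sub>M borel)"
    and b: "\<And>x. (\<integral>\<^sup>+y. ennreal \<bar>f x y\<bar> \<partial>lborel) \<le> ennreal (w x)" and w: "integrable lborel w" and w0: "\<And>x. w x \<ge> 0"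
  shows "(\<integral>x. \<integral>y. f x y \<partial>lborel \<partial>lborel) = (\<integral>y. \<integral>x. f x y \<partial>lborel \<partial>lborel)"
proof -
  have "integrable (lborel \<Otimes>\<^sub>M lborel) (\<lambda>(x, y). f x y)"
  proof (rule integrableI_bounded)
    have "(\<integral>\<^sup>+p. ennreal (norm (case p of (x, y) \<Rightarrow> f x y)) \<partial>(lborel \<Otimes>\<^sub>M lborel)) = (\<integral>\<^sup>+x. \<integral>\<^sup>+y. ennreal \<bar>f x y\<bar> \<partial>lborel \<partial>lborel)"
      by (subst lborel.nn_integral_fst[symmetric]) (auto simp: split_beta')
    also have "\<dots> \<le> (\<integral>\<^sup>+x. ennreal (w x) \<partial>lborel)" by (rule nn_integral_mono) (rule b)
    also have "\<dots> = ennreal (\<integral>x. w x \<partial>lborel)" by (rule nn_integral_eq_integral[OF w]) (simp add: w0)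
    finally show "(\<integral>\<^sup>+p. ennreal (norm (case p of (x, y) \<Rightarrow> f x y)) \<partial>(lborel \<Otimes>\<^sub>M lborel)) < \<infinity>"
      by (auto intro: le_less_trans)
  qed auto
  from lborel_pair.Fubini_integral[OF this] show ?thesis by simp
qed

section \<open>Symmetry of the Hessian kernel\<close>

lemma cv_symmetric:
  assumes a: "bscalar R a" and b: "bscalar R b" and f: "continuous_on UNIV f"
  shows "(\<integral>x. a x * cv b f x \<partial>lborel) = (\<integral>y. b y * cv a (\<lambda>z. f (- z)) y \<partial>lborel)"
proof -
  have ia: "integrable lborel a" and ib: "integrable lborel b" using a b by (auto simp: bscalar_def)
  have [measurable]: "a \<in> borel_measurable borel" "b \<in> borel_measurable borel" "f \<in> borel_measurable borel"
    using borel_measurable_integrable[OF ia] borel_measurable_integrable[OF ib] f borel_measurable_continuous_onI by auto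
  obtain B where "B \<ge> 0" "\<And>z. z \<in> cball 0 (R + R) \<Longrightarrow> norm (f z) \<le> B"
    using continuous_bounded_on_compact[OF continuous_on_subset[OF f] compact_cball] by blast
  then have B: "\<bar>f z\<bar> \<le> \<bar>B\<bar>" if "norm z \<le> R + R" for z using that by auto
  have bd: "\<bar>a x * (b y * f (x - y))\<bar> \<le> \<bar>a x\<bar> * \<bar>B\<bar> * \<bar>b y\<bar>" for x y
  proof (cases "norm x \<le> R \<and> norm y \<le> R")
    case True
    then have "norm (x - y) \<le> R + R" using norm_triangle_ineq4[of x y] by linarith
    then have "\<bar>a x\<bar> * \<bar>b y\<bar> * \<bar>f (x - y)\<bar> \<le> \<bar>a x\<bar> * \<bar>b y\<bar> * \<bar>B\<bar>" by (intro mult_left_mono B) auto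
    then show ?thesis by (simp add: abs_mult mult_ac)
  next
    case False then show ?thesis using a b by (auto simp: bscalar_def not_le)
  qed
  have "(\<integral>x. a x * cv b f x \<partial>lborel) = (\<integral>x. \<integral>y. a x * (b y * f (x - y)) \<partial>lborel \<partial>lborel)"
    by (simp add: cv_def)
  also have "\<dots> = (\<integral>y. \<integral>x. a x * (b y * f (x - y)) \<partial>lborel \<partial>lborel)"
  proof (rule integrable_Fubini_lborel[where w="\<lambda>x. \<bar>a x\<bar> * \<bar>B\<bar> * (\<integral>y. \<bar>b y\<bar> \<partial>lborel)"])
    fix x
    have "(\<integral>\<^sup>+y. ennreal \<bar>a x * (b y * f (x - y))\<bar> \<partial>lborel) \<le> (\<integral>\<^sup>+y. ennreal (\<bar>a x\<bar> * \<bar>B\<bar> * \<bar>b y\<bar>) \<partial>lborel)"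
      by (intro nn_integral_mono ennreal_leI bd)
    also have "\<dots> = ennreal (\<bar>a x\<bar> * \<bar>B\<bar> * (\<integral>y. \<bar>b y\<bar> \<partial>lborel))"
      using ib by (subst nn_integral_eq_integral) auto
    finally show "(\<integral>\<^sup>+y. ennreal \<bar>a x * (b y * f (x - y))\<bar> \<partial>lborel) \<le> ennreal (\<bar>a x\<bar> * \<bar>B\<bar> * (\<integral>y. \<bar>b y\<bar> \<partial>lborel))" .
  qed (use ia in auto)
  also have "\<dots> = (\<integral>y. b y * cv a (\<lambda>z. f (- z)) y \<partial>lborel)"
    unfolding cv_def
    by (intro Bochner_Integration.integral_cong refl, subst integral_mult_right_zero[symmetric]) (simp add: mult_ac)
  finally show ?thesis .
qed

text \<open>Evenness of the kernel and symmetry of its Hessian in one equation, in exactly the form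
  produced when \<open>cv_symmetric\<close> exchanges the two fields.\<close>

lemma kk1_even: "kk1 d j i (- z) = kk1 d i j z"
  by (simp add: kk1_def sg_def mult_ac)

lemma upot_symmetric:
  assumes d: "d > 0" and F: "bfield R F" and G: "bfield R G"
  shows "(\<integral>x. F x \<bullet> grad (upot d G) x \<partial>lborel) = (\<integral>x. G x \<bullet> grad (upot d F) x \<partial>lborel)"
proof -
  note c = smooth_on_continuous_on[OF smooth_kernels(2)[OF d]]
  have i: "integrable lborel (\<lambda>x. F x $ i * cv (\<lambda>y. G y $ j) (kk1 d j i) x)" if "bfield R F" "bfield R G" for F G i j
  proof -
    have "continuous_on UNIV (cv (\<lambda>y. G y $ j) (kk1 d j i))"
      by (intro smooth_on_continuous_on smooth_on_cv[OF bfield_bscalar[OF that(2)]] smooth_kernels d)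
    \<comment> \<open>The product is seen as the convolution integrand at the point 0 with the
      reflected second factor.\<close>
    then show ?thesis using integrable_cv[OF bfield_bscalar[OF that(1)], of "\<lambda>z. cv (\<lambda>y. G y $ j) (kk1 d j i) (- z)" i 0]
      by (simp add: continuous_on_compose2 continuous_intros)
  qed
  have e: "(\<integral>x. F x \<bullet> grad (upot d G) x \<partial>lborel) = (\<Sum>i\<in>UNIV. \<Sum>j\<in>UNIV. \<integral>x. F x $ i * cv (\<lambda>y. G y $ j) (kk1 d j i) x \<partial>lborel)"
    if "bfield R F" "bfield R G" for F G
  proof -
    have "(\<integral>x. F x \<bullet> grad (upot d G) x \<partial>lborel) = (\<integral>x. (\<Sum>i\<in>UNIV. \<Sum>j\<in>UNIV. F x $ i * cv (\<lambda>y. G y $ j) (kk1 d j i) x) \<partial>lborel)"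
      by (simp add: inner_vec_def grad_upot[OF d that(2)] sum_distrib_left)
    then show ?thesis using i[OF that] by (simp add: Bochner_Integration.integral_sum)
  qed
  have "(\<Sum>i\<in>UNIV. \<Sum>j\<in>UNIV. \<integral>x. F x $ i * cv (\<lambda>y. G y $ j) (kk1 d j i) x \<partial>lborel)
    = (\<Sum>i\<in>UNIV. \<Sum>j\<in>UNIV. \<integral>x. G x $ j * cv (\<lambda>y. F y $ i) (kk1 d i j) x \<partial>lborel)"
    by (simp add: cv_symmetric[OF bfield_bscalar[OF F] bfield_bscalar[OF G] c] kk1_even)
  also have "\<dots> = (\<Sum>j\<in>UNIV. \<Sum>i\<in>UNIV. \<integral>x. G x $ j * cv (\<lambda>y. F y $ i) (kk1 d i j) x \<partial>lborel)"
    by (rule sum.swap)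
  finally show ?thesis by (simp add: e F G)
qed

section \<open>The mollifier as an approximate identity\<close>

lemma rho_scaling: "d > 0 \<Longrightarrow> sqrt d ^ 3 * rho d (sqrt d *\<^sub>R z) = rho 1 z"
proof -
  assume d: "d > 0"
  have "sqrt d ^ 2 * (z \<bullet> z) + d = d * (z \<bullet> z + 1)" using d by (simp add: algebra_simps)
  moreover have "(sqrt d *\<^sub>R z) \<bullet> (sqrt d *\<^sub>R z) = sqrt d ^ 2 * (z \<bullet> z)" by (simp only: inner_scaleR_left inner_scaleR_right power2_eq_square mult.assoc)
  ultimately have "(sqrt d *\<^sub>R z) \<bullet> (sqrt d *\<^sub>R z) + d = d * (z \<bullet> z + 1)" by (simp only:)
  then have "sg d (sqrt d *\<^sub>R z) = inverse (sqrt d) * sg 1 z" by (simp add: sg_def real_sqrt_mult)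
  moreover have "sqrt d ^ 3 * (d * inverse (sqrt d) ^ 5) = 1"
  proof -
    have "d = sqrt d ^ 2" using d by simp
    then have "sqrt d ^ 3 * (d * inverse (sqrt d) ^ 5) = sqrt d ^ 5 * inverse (sqrt d) ^ 5"
      by (simp add: power_numeral_reduce)
    then show ?thesis using d by (simp add: power_mult_distrib[symmetric])
  qed
  ultimately show ?thesis
    by (simp add: rho_def power_mult_distrib)
qed

text \<open>The substitution \<open>x = y + sqrt d z\<close> replaces the shrinking kernel by the
  fixed density \<open>rho 1\<close>, which dominates.\<close>

lemma rho_average_limit:
  fixes g :: "real^3 \<Rightarrow> real"
  assumes d: "\<And>n. d n > 0" "d \<longlonglongrightarrow> 0" and g: "continuous_on UNIV g" and B: "\<And>x. \<bar>g x\<bar> \<le> B"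
  shows "(\<lambda>n. \<integral>x. rho (d n) (x - y) * g x \<partial>lborel) \<longlonglongrightarrow> g y"
    and "\<bar>\<integral>x. rho (d n) (x - y) * g x \<partial>lborel\<bar> \<le> B"
proof -
  have [measurable]: "g \<in> borel_measurable borel" using g by (rule borel_measurable_continuous_onI)
  have B0: "B \<ge> 0" using B[of 0] by linarith
  have i: "integrable lborel (\<lambda>x. rho (d n) (x - y) * g x)" for n
  proof (rule Bochner_Integration.integrable_bound)
    have "integrable lborel (\<lambda>x. rho (d n) (- y + 1 *\<^sub>R x))"
      by (rule integrable_lborel_affine[OF integrable_rho[OF d(1)]]) simp
    then show "integrable lborel (\<lambda>x. B * rho (d n) (x - y))" by simp
    show "AE x in lborel. norm (rho (d n) (x - y) * g x) \<le> norm (B * rho (d n) (x - y))"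
    proof (rule AE_I2)
      fix x
      have "\<bar>rho (d n) (x - y)\<bar> * \<bar>g x\<bar> \<le> \<bar>rho (d n) (x - y)\<bar> * \<bar>B\<bar>"
        using B[of x] B0 by (intro mult_left_mono) auto
      then show "norm (rho (d n) (x - y) * g x) \<le> norm (B * rho (d n) (x - y))" by (simp add: abs_mult mult.commute)
    qed
  qed auto
  have e: "(\<integral>x. rho (d n) (x - y) * g x \<partial>lborel) = (\<integral>z. rho 1 z * g (y + sqrt (d n) *\<^sub>R z) \<partial>lborel)" for n
  proof -
    have "(\<integral>x. rho (d n) (x - y) * g x \<partial>lborel) = sqrt (d n) ^ 3 * (\<integral>z. rho (d n) (sqrt (d n) *\<^sub>R z) * g (y + sqrt (d n) *\<^sub>R z) \<partial>lborel)"
      using integral_lborel_affine[OF i[of n], of "sqrt (d n)" y] d(1)[of n] by simp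
    also have "\<dots> = (\<integral>z. (sqrt (d n) ^ 3 * rho (d n) (sqrt (d n) *\<^sub>R z)) * g (y + sqrt (d n) *\<^sub>R z) \<partial>lborel)"
      by (simp add: mult.assoc)
    finally show ?thesis unfolding rho_scaling[OF d(1)] .
  qed
  have bd: "AE z in lborel. norm (rho 1 z * g (y + sqrt (d n) *\<^sub>R z)) \<le> B * rho 1 z" for n
    by (intro AE_I2) (simp add: abs_mult rho_nonneg mult.commute[of B] mult_left_mono B)
  have "(\<lambda>n. \<integral>z. rho 1 z * g (y + sqrt (d n) *\<^sub>R z) \<partial>lborel) \<longlonglongrightarrow> (\<integral>z. rho 1 z * g y \<partial>lborel)"
  proof (rule integral_dominated_convergence[where w="\<lambda>z. B * rho 1 z"])
    show "AE z in lborel. (\<lambda>n. rho 1 z * g (y + sqrt (d n) *\<^sub>R z)) \<longlonglongrightarrow> rho 1 z * g y"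
    proof (rule AE_I2)
      fix z
      have "(\<lambda>n. y + sqrt (d n) *\<^sub>R z) \<longlonglongrightarrow> y + sqrt 0 *\<^sub>R z" using d(2) by (intro tendsto_intros)
      moreover have "isCont g y" using g by (simp add: continuous_on_eq_continuous_at)
      ultimately have "(\<lambda>n. g (y + sqrt (d n) *\<^sub>R z)) \<longlonglongrightarrow> g y" by (intro isCont_tendsto_compose[of y g]) auto
      then show "(\<lambda>n. rho 1 z * g (y + sqrt (d n) *\<^sub>R z)) \<longlonglongrightarrow> rho 1 z * g y" by (intro tendsto_intros)
    qed
  qed (use bd integrable_rho[of 1] in auto)
  then show "(\<lambda>n. \<integral>x. rho (d n) (x - y) * g x \<partial>lborel) \<longlonglongrightarrow> g y"
    by (simp add: e integral_rho)
  have b': "norm (rho 1 z * g (y + sqrt (d n) *\<^sub>R z)) \<le> B * rho 1 z" for z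
    by (simp add: abs_mult rho_nonneg mult.commute[of B] mult_left_mono B)
  have ir: "integrable lborel (\<lambda>z. B * rho 1 z)" using integrable_rho[of 1] by simp
  have "integrable lborel (\<lambda>z. rho 1 z * g (y + sqrt (d n) *\<^sub>R z))"
    by (rule Bochner_Integration.integrable_bound[OF ir]) (use b' in \<open>auto intro!: AE_I2 intro: order_trans[OF _ abs_ge_self]\<close>)
  then have "norm (\<integral>z. rho 1 z * g (y + sqrt (d n) *\<^sub>R z) \<partial>lborel) \<le> (\<integral>z. B * rho 1 z \<partial>lborel)"
    by (rule Bochner_Integration.integral_norm_bound_integral[OF _ ir b'])
  then show "\<bar>\<integral>x. rho (d n) (x - y) * g x \<partial>lborel\<bar> \<le> B" by (simp add: e integral_rho)
qed

text \<open>Fubini moves the mollification from the rough field \<open>F\<close> to the continuous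
  bounded field \<open>g\<close>, where it converges pointwise and boundedly.\<close>

lemma mol_weak_limit:
  assumes d: "\<And>n. d n > 0" "d \<longlonglongrightarrow> 0" and F: "bfield R F"
    and g: "continuous_on UNIV g" and gi: "\<And>x i. \<bar>g x $ i\<bar> \<le> B"
  shows "(\<lambda>n. \<integral>x. g x \<bullet> mol (d n) F x \<partial>lborel) \<longlonglongrightarrow> (\<integral>x. g x \<bullet> F x \<partial>lborel)"
proof -
  have gc: "continuous_on UNIV (\<lambda>x. g x $ i)" for i using g by (intro continuous_intros)
  have [measurable]: "g \<in> borel_measurable borel" using g by (rule borel_measurable_continuous_onI)
  have [measurable]: "F \<in> borel_measurable borel" using F by (auto simp: bfield_def)
  have B0: "B \<ge> 0" using gi[of 0 undefined] by linarith
  have iF: "integrable lborel (\<lambda>y. F y $ i)" for i using bfield_bscalar[OF F] by (simp add: bscalar_def)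
  have f: "integrable lborel (\<lambda>x. g x $ i * cv (\<lambda>y. F y $ i) (rho (d n)) x) \<and>
     (\<integral>x. g x $ i * cv (\<lambda>y. F y $ i) (rho (d n)) x \<partial>lborel) = (\<integral>y. F y $ i * (\<integral>x. rho (d n) (x - y) * g x $ i \<partial>lborel) \<partial>lborel)" for i n
  proof
    have r0: "rho (d n) z \<ge> 0" for z using d(1)[of n] by (simp add: rho_nonneg)
    have m: "cv (\<lambda>y. F y $ i) (rho (d n)) \<in> borel_measurable borel"
      by (rule measurable_cv[OF bfield_bscalar[OF F] smooth_kernels(3)[OF d(1)]])
    have p: "integrable (lborel \<Otimes>\<^sub>M lborel) (\<lambda>(y, x). F y $ i * (rho (d n) (x - y) * g x $ i))"
    proof (rule integrableI_bounded)
      have "(\<integral>\<^sup>+p. ennreal (norm (case p of (y, x) \<Rightarrow> F y $ i * (rho (d n) (x - y) * g x $ i))) \<partial>(lborel \<Otimes>\<^sub>M lborel))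
         = (\<integral>\<^sup>+y. \<integral>\<^sup>+x. ennreal \<bar>F y $ i * (rho (d n) (x - y) * g x $ i)\<bar> \<partial>lborel \<partial>lborel)"
        by (subst lborel.nn_integral_fst[symmetric]) (auto simp: split_beta')
      also have "\<dots> \<le> (\<integral>\<^sup>+y. \<integral>\<^sup>+x. ennreal (\<bar>F y $ i\<bar> * B) * ennreal (rho (d n) (x - y)) \<partial>lborel \<partial>lborel)"
      proof (intro nn_integral_mono)
        fix x y :: "real^3"
        have "\<bar>F y $ i\<bar> * (rho (d n) (x - y) * \<bar>g x $ i\<bar>) \<le> \<bar>F y $ i\<bar> * (rho (d n) (x - y) * B)"
          using gi[of x i] r0 by (intro mult_left_mono) auto
        then have "\<bar>F y $ i * (rho (d n) (x - y) * g x $ i)\<bar> \<le> \<bar>F y $ i\<bar> * B * rho (d n) (x - y)"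
          using r0[of "x - y"] by (simp add: abs_mult mult_ac)
        then show "ennreal \<bar>F y $ i * (rho (d n) (x - y) * g x $ i)\<bar> \<le> ennreal (\<bar>F y $ i\<bar> * B) * ennreal (rho (d n) (x - y))"
          using r0[of "x - y"] B0 by (subst ennreal_mult[symmetric]) (auto intro: ennreal_leI)
      qed
      also have "\<dots> = (\<integral>\<^sup>+y. ennreal (\<bar>F y $ i\<bar> * B) \<partial>lborel)"
        by (simp add: nn_integral_cmult nn_integral_rho_shift[OF d(1)])
      also have "\<dots> < \<infinity>"
        using iF[of i] B0 by (subst nn_integral_eq_integral) auto
      finally show "(\<integral>\<^sup>+p. ennreal (norm (case p of (y, x) \<Rightarrow> F y $ i * (rho (d n) (x - y) * g x $ i))) \<partial>(lborel \<Otimes>\<^sub>M lborel)) < \<infinity>" .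
    qed auto
    have "integrable lborel (\<lambda>x. \<integral>y. F y $ i * (rho (d n) (x - y) * g x $ i) \<partial>lborel)"
      using lborel_pair.integrable_snd[OF p] by simp
    moreover have e: "(\<integral>y. F y $ i * (rho (d n) (x - y) * g x $ i) \<partial>lborel) = g x $ i * cv (\<lambda>y. F y $ i) (rho (d n)) x" for x
      unfolding cv_def by (subst integral_mult_right_zero[symmetric]) (simp add: mult_ac)
    ultimately show "integrable lborel (\<lambda>x. g x $ i * cv (\<lambda>y. F y $ i) (rho (d n)) x)" by simp
    show "(\<integral>x. g x $ i * cv (\<lambda>y. F y $ i) (rho (d n)) x \<partial>lborel) = (\<integral>y. F y $ i * (\<integral>x. rho (d n) (x - y) * g x $ i \<partial>lborel) \<partial>lborel)"
      using lborel_pair.Fubini_integral[OF p] by (simp add: e)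
  qed
  have l: "(\<lambda>n. \<integral>y. F y $ i * (\<integral>x. rho (d n) (x - y) * g x $ i \<partial>lborel) \<partial>lborel) \<longlonglongrightarrow> (\<integral>y. F y $ i * g y $ i \<partial>lborel)" for i
  proof (rule integral_dominated_convergence[where w="\<lambda>y. B * \<bar>F y $ i\<bar>"])
    show "AE y in lborel. (\<lambda>n. F y $ i * (\<integral>x. rho (d n) (x - y) * g x $ i \<partial>lborel)) \<longlonglongrightarrow> F y $ i * g y $ i"
      by (intro AE_I2 tendsto_intros rho_average_limit(1)[OF d gc gi])
    show "AE y in lborel. norm (F y $ i * (\<integral>x. rho (d n) (x - y) * g x $ i \<partial>lborel)) \<le> B * \<bar>F y $ i\<bar>" for n
      by (intro AE_I2) (simp add: abs_mult mult.commute[of B] mult_left_mono rho_average_limit(2)[OF d gc gi])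
  qed (use iF in auto)
  have "(\<lambda>n. \<Sum>i\<in>UNIV. \<integral>y. F y $ i * (\<integral>x. rho (d n) (x - y) * g x $ i \<partial>lborel) \<partial>lborel) \<longlonglongrightarrow> (\<Sum>i\<in>UNIV. \<integral>y. F y $ i * g y $ i \<partial>lborel)"
    by (intro tendsto_sum l)
  moreover have "(\<Sum>i\<in>UNIV. \<integral>y. F y $ i * (\<integral>x. rho (d n) (x - y) * g x $ i \<partial>lborel) \<partial>lborel) = (\<integral>x. g x \<bullet> mol (d n) F x \<partial>lborel)" for n
    using f by (simp add: inner_vec_def mol_def Bochner_Integration.integral_sum)
  moreover have "(\<Sum>i\<in>UNIV. \<integral>y. F y $ i * g y $ i \<partial>lborel) = (\<integral>x. g x \<bullet> F x \<partial>lborel)"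
  proof -
    have "integrable lborel (\<lambda>y. F y $ i * g y $ i)" for i
      by (rule integrable_bscalar_mult[OF bfield_bscalar[OF F] _ gi]) auto
    then show ?thesis by (simp add: inner_vec_def Bochner_Integration.integral_sum mult.commute)
  qed
  ultimately show ?thesis by simp
qed

subsection \<open>Orthogonality to functions vanishing on the boundary\<close>

text \<open>The translates of the set by small multiples of \<open>e\<close> are pairwise disjoint, so it is null.\<close>

lemma negligible_zero_set_nonvanishing_derivative:
  fixes h :: "'a::euclidean_space \<Rightarrow> real"
  assumes D: "\<And>x. (h has_derivative h' x) (at x)" and c: "continuous_on UNIV (\<lambda>x. h' x e)"
  shows "AE x in lborel. h x = 0 \<longrightarrow> h' x e = 0"
proof -
  have hc: "continuous_on UNIV h"
    using D by (auto intro!: continuous_at_imp_continuous_on has_derivative_continuous)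
  \<comment> \<open>Compact pieces on which the derivative is bounded away from 0: compactness
    supplies uniform continuity and finite measure.\<close>
  define S where "S n = {x \<in> cball 0 (real n). h x = 0 \<and> inverse (real (Suc n)) \<le> \<bar>h' x e\<bar>}" for n
  have cl: "closed {x. h x = 0 \<and> inverse (real (Suc n)) \<le> \<bar>h' x e\<bar>}" for n
    by (intro closed_Collect_conj closed_Collect_eq closed_Collect_le continuous_intros hc c)
  have cS: "compact (S n)" for n
  proof -
    have "S n = cball 0 (real n) \<inter> {x. h x = 0 \<and> inverse (real (Suc n)) \<le> \<bar>h' x e\<bar>}" by (auto simp: S_def)
    then show ?thesis using cl[of n] by (simp add: compact_Int_closed)
  qed
  have null: "S n \<in> null_sets lborel" for n
  proof -
    define q where "q = inverse (real (Suc n))"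
    have q: "q > 0" by (simp add: q_def)
    let ?K = "cball (0::'a) (real n + norm e)"
    have "uniformly_continuous_on ?K (\<lambda>x. h' x e)"
      by (intro compact_uniformly_continuous continuous_on_subset[OF c]) auto
    then obtain t where t: "t > 0" "\<And>x y. x \<in> ?K \<Longrightarrow> y \<in> ?K \<Longrightarrow> dist y x < t \<Longrightarrow> dist (h' y e) (h' x e) < q"
      using q unfolding uniformly_continuous_on_def by metis
    define u where "u = min 1 (t / (norm e + 1))"
    have u: "u > 0" "u \<le> 1" using t by (auto simp: u_def add_nonneg_pos)
    have ut: "s * norm e < t" if "0 < s" "s < u" for s
    proof -
      have "s * norm e \<le> s * (norm e + 1)" using that by simp
      also have "\<dots> < t / (norm e + 1) * (norm e + 1)"
        using that by (intro mult_strict_right_mono) (auto simp: u_def add_nonneg_pos)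
      also have "\<dots> = t" by (simp add: add_nonneg_eq_0_iff)
      finally show ?thesis .
    qed
    \<comment> \<open>Two zeros on a short segment would force the directional derivative to vanish
      between them, although it is at least \<open>q\<close> in absolute value at \<open>x\<close>
      and varies by less than \<open>q\<close>.\<close>
    have iso: "h (x + s *\<^sub>R e) \<noteq> 0" if x: "x \<in> S n" and s: "0 < s" "s < u" for x s
    proof
      assume z: "h (x + s *\<^sub>R e) = 0"
      have d: "((\<lambda>r. h (x + r *\<^sub>R e)) has_real_derivative h' (x + r *\<^sub>R e) e) (at r)" for r
      proof -
        have "((\<lambda>r. h (x + r *\<^sub>R e)) has_derivative (\<lambda>k. h' (x + r *\<^sub>R e) (k *\<^sub>R e))) (at r)"
          by (rule has_derivative_compose[OF _ D]) (auto intro!: derivative_eq_intros)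
        then show ?thesis using has_derivative_linear[OF D]
          by (simp add: has_field_derivative_def linear_cmul mult.commute[of _ "h' (x + r *\<^sub>R e) e"])
      qed
      obtain r where r: "0 < r" "r < s" "h (x + s *\<^sub>R e) - h (x + 0 *\<^sub>R e) = (s - 0) * h' (x + r *\<^sub>R e) e"
        using MVT2[OF s(1) d] by blast
      then have 0: "h' (x + r *\<^sub>R e) e = 0" using z x s by (simp add: S_def)
      have "norm (x + r *\<^sub>R e) \<le> real n + norm e"
        using x r s u norm_triangle_ineq[of x "r *\<^sub>R e"] mult_right_mono[of r 1 "norm e"] by (simp add: S_def)
      then have "dist (h' (x + r *\<^sub>R e) e) (h' x e) < q"
        using x r s ut[of r] by (intro t(2)) (auto simp: S_def add_increasing2, simp add: dist_norm)
      then show False using x 0 by (simp add: S_def q_def)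
    qed
    \<comment> \<open>Infinitely many offsets below \<open>u\<close>, so that any two differ by less
      than \<open>u\<close> and \<open>iso\<close> separates the translates; \<open>N\<close>
      disjoint copies of \<open>S n\<close> fit into one ball for every \<open>N\<close>.\<close>
    define w where "w k = u * inverse (real (Suc (Suc k)))" for k
    have w: "0 < w k" "w k < u" for k using u by (auto simp: w_def field_simps add_pos_nonneg)
    have winj: "w k \<noteq> w l" if "k \<noteq> l" for k l using that u by (auto simp: w_def)
    have lm: "S n \<in> lmeasurable" using cS by (rule lmeasurable_compact)
    have disj: "disjnt ((+) (w k *\<^sub>R e) ` S n) ((+) (w l *\<^sub>R e) ` S n)" if "w k < w l" for k l
    proof -
      have False if "x \<in> S n" "y \<in> S n" "w k *\<^sub>R e + x = w l *\<^sub>R e + y" for x y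
      proof -
        have "x = y + (w l - w k) *\<^sub>R e" using that by (simp add: algebra_simps)
        moreover have "h (y + (w l - w k) *\<^sub>R e) \<noteq> 0"
          using that \<open>w k < w l\<close> w[of k] w[of l] by (intro iso) auto
        ultimately show False using that by (simp add: S_def)
      qed
      then show ?thesis by (auto simp: disjnt_def)
    qed
    have pw: "pairwise (\<lambda>k l. disjnt ((+) (w k *\<^sub>R e) ` S n) ((+) (w l *\<^sub>R e) ` S n)) I" for I
      unfolding pairwise_def using disj winj by (metis disjnt_sym linorder_less_linear)
    have "real N * measure lebesgue (S n) \<le> measure lebesgue ?K" for N
    proof -
      have "real N * measure lebesgue (S n) = (\<Sum>k<N. measure lebesgue ((+) (w k *\<^sub>R e) ` S n))"
        by (simp add: measure_translation)
      also have "\<dots> = measure lebesgue (\<Union>k<N. (+) (w k *\<^sub>R e) ` S n)"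
        by (rule measure_UNION'[symmetric]) (auto intro: measurable_translation lm pw)
      also have "\<dots> \<le> measure lebesgue ?K"
      proof (rule measure_mono_fmeasurable)
        show "(\<Union>k<N. (+) (w k *\<^sub>R e) ` S n) \<subseteq> ?K"
        proof (clarsimp)
          fix k x assume "x \<in> S n"
          have "norm (w k *\<^sub>R e + x) \<le> w k * norm e + norm x"
            using norm_triangle_ineq[of "w k *\<^sub>R e" x] w[of k] by simp
          also have "\<dots> \<le> 1 * norm e + real n"
            using \<open>x \<in> S n\<close> w[of k] u by (intro add_mono mult_right_mono) (auto simp: S_def)
          finally show "norm (w k *\<^sub>R e + x) \<le> real n + norm e" by simp
        qed
        show "(\<Union>k<N. (+) (w k *\<^sub>R e) ` S n) \<in> sets lebesgue"
          using measurable_translation[OF lm] by (intro sets.finite_UN) (auto simp: fmeasurableD)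
      qed auto
      finally show ?thesis .
    qed
    then have "measure lebesgue (S n) \<le> 0"
      using real_archimedian_rdiv_eq_0[of "measure lebesgue (S n)" "measure lebesgue ?K"] by simp
    then have "measure lebesgue (S n) = 0" using measure_nonneg[of lebesgue "S n"] by linarith
    then have "emeasure lebesgue (S n) = 0"
      using lm by (simp add: emeasure_eq_measure2)
    moreover have "S n \<in> sets borel" using cS by (simp add: borel_compact)
    ultimately show ?thesis by (simp add: null_sets_def)
  qed
  have "AE x in lborel. \<forall>n. x \<notin> S n"
    unfolding AE_all_countable using null by (auto intro: AE_not_in)
  then show ?thesis
  proof eventually_elim
    case (elim x)
    show ?case
    proof (rule ccontr)
      assume "\<not> (h x = 0 \<longrightarrow> h' x e = 0)"
      then have z: "h x = 0" "h' x e \<noteq> 0" by auto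
      obtain n1 where n1: "inverse (real (Suc n1)) < \<bar>h' x e\<bar>" using reals_Archimedean z by (metis zero_less_abs_iff)
      obtain n2 :: nat where n2: "norm x \<le> real n2" using real_arch_simple by blast
      have "x \<in> S (max n1 n2)"
      proof -
        have "inverse (real (Suc (max n1 n2))) \<le> inverse (real (Suc n1))" by (intro le_imp_inverse_le) auto
        then have "inverse (real (Suc (max n1 n2))) \<le> \<bar>h' x e\<bar>" using n1 by linarith
        moreover have "norm x \<le> real (max n1 n2)" using n2 by simp
        ultimately show ?thesis using z by (simp add: S_def del: of_nat_Suc)
      qed
      then show False using elim by blast
    qed
  qed
qed

text \<open>The Borel counterpart of \<open>closed2\<close>, extended by zero to the whole space, so
  that Lebesgue integrals and convolutions apply directly.\<close>

definition dfield :: "(real^3) set \<Rightarrow> real \<Rightarrow> (real^3 \<Rightarrow> real^3) \<Rightarrow> bool" where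
  "dfield \<Omega> R F \<longleftrightarrow> bfield R F \<and> (\<forall>x. x \<notin> \<Omega> \<longrightarrow> F x = 0) \<and>
     (\<forall>\<phi>. test_fun \<Omega> \<phi> \<longrightarrow> (\<integral>x. F x \<bullet> grad \<phi> x \<partial>lborel) = 0)"

lemma integrable_bfield_inner:
  assumes F: "bfield R F" and g: "g \<in> borel_measurable borel" and b: "\<And>y. norm y \<le> R \<Longrightarrow> norm (g y) \<le> B"
  shows "integrable lborel (\<lambda>y. F y \<bullet> g y)"
proof -
  have [measurable]: "F \<in> borel_measurable borel" using F by (auto simp: bfield_def)
  note [measurable] = g
  show ?thesis
  proof (rule Bochner_Integration.integrable_bound)
    show "integrable lborel (\<lambda>y. \<bar>B\<bar> * norm (F y))" using bfield_integrable[OF F] by simp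
    show "AE y in lborel. norm (F y \<bullet> g y) \<le> norm (\<bar>B\<bar> * norm (F y))"
    proof (rule AE_I2)
      fix y
      show "norm (F y \<bullet> g y) \<le> norm (\<bar>B\<bar> * norm (F y))"
      proof (cases "norm y \<le> R")
        case True
        have "\<bar>F y \<bullet> g y\<bar> \<le> norm (F y) * norm (g y)" by (rule Cauchy_Schwarz_ineq2)
        also have "\<dots> \<le> norm (F y) * \<bar>B\<bar>" using b[OF True] by (intro mult_left_mono) auto
        finally show ?thesis by (simp add: mult.commute)
      next
        case False then show ?thesis using F by (auto simp: bfield_def)
      qed
    qed
  qed auto
qed

lemma integrable_bfield_inner_cont:
  assumes "bfield R F" "continuous_on UNIV g"
  shows "integrable lborel (\<lambda>y. F y \<bullet> g y)"
proof -
  obtain B where "B \<ge> 0" "\<And>y. y \<in> cball 0 R \<Longrightarrow> norm (g y) \<le> B"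
    using continuous_bounded_on_compact[OF continuous_on_subset[OF assms(2)] compact_cball] by blast
  then show ?thesis
    by (intro integrable_bfield_inner[OF assms(1) borel_measurable_continuous_onI[OF assms(2)]]) auto
qed

text \<open>For \<open>q = h\<^sup>2 N\<^sup>2\<close> the gradient of \<open>h * bump (q - 1)\<close> is \<open>trunc_factor q *\<^sub>R grad h\<close>.\<close>

definition trunc_factor :: "real \<Rightarrow> real" where
  "trunc_factor q = bump (q - 1) + 2 * q * (if q > 1 then exp (- inverse (q - 1)) / (q - 1)\<^sup>2 else 0)"

lemma trunc_factor_alt:
  "q > 1 \<Longrightarrow> trunc_factor q = exp (- inverse (q - 1)) * (1 + 2 * (inverse (q - 1) + (inverse (q - 1))\<^sup>2))"
proof -
  assume q: "q > 1"
  have "q / (q - 1)\<^sup>2 = inverse (q - 1) + (inverse (q - 1))\<^sup>2"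
  proof -
    have "(t + 1) / t\<^sup>2 = inverse t + (inverse t)\<^sup>2" if "t > 0" for t :: real
      using that by (simp add: field_simps power2_eq_square)
    from this[of "q - 1"] show ?thesis using q by simp
  qed
  moreover have "trunc_factor q = exp (- inverse (q - 1)) * (1 + 2 * (q / (q - 1)\<^sup>2))"
    using q by (simp add: trunc_factor_def bump_def algebra_simps)
  ultimately show ?thesis by simp
qed

text \<open>Supplies the dominating function for the truncation. With \<open>p = 1 / (q - 1)\<close>
  the factor is \<open>exp (- p)\<close> times a quadratic polynomial in \<open>p\<close>, and
  \<open>exp p \<ge> 1 + p + p^2 / 2\<close> absorbs it; 7 is a generous constant.\<close>

lemma trunc_factor_bound: "\<bar>trunc_factor q\<bar> \<le> 7"
proof (cases "q > 1")
  case True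
  define p where "p = inverse (q - 1)"
  have p: "p > 0" using True by (simp add: p_def)
  have e: "1 + p + p\<^sup>2 / 2 \<le> exp p" using p exp_lower_Taylor_quadratic[of p] by simp
  have "1 + 2 * (p + p\<^sup>2) \<le> 7 * (1 + p + p\<^sup>2 / 2)" 
  proof -
    have "0 \<le> 6 + 5 * p + 3 / 2 * p\<^sup>2" using p by (intro add_nonneg_nonneg) auto
    then show ?thesis by (simp add: field_simps)
  qed
  also have "\<dots> \<le> 7 * exp p" using e by simp
  finally have "exp (- p) * (1 + 2 * (p + p\<^sup>2)) \<le> exp (- p) * (7 * exp p)" by (intro mult_left_mono) auto
  moreover have "0 \<le> exp (- p) * (1 + 2 * (p + p\<^sup>2))" using p by simp
  moreover have "exp (- p) * (7 * exp p) = 7" by (simp add: exp_minus field_simps)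
  moreover have "trunc_factor q = exp (- p) * (1 + 2 * (p + p\<^sup>2))" using True by (simp only: trunc_factor_alt p_def)
  ultimately show ?thesis by linarith
qed (simp add: trunc_factor_def bump_zero)

lemma trunc_factor_tendsto: "(trunc_factor \<longlongrightarrow> 1) at_top"
proof -
  have l0: "((\<lambda>q. inverse (q - 1)) \<longlongrightarrow> (0::real)) at_top"
    by (rule tendsto_inverse_0_at_top)
       (use filterlim_tendsto_add_at_top[OF tendsto_const filterlim_ident, of "-1::real"] in simp)
  have "((\<lambda>q::real. exp (- inverse (q - 1)) * (1 + 2 * (inverse (q - 1) + (inverse (q - 1))\<^sup>2))) \<longlongrightarrow> exp (- 0) * (1 + 2 * (0 + 0\<^sup>2))) at_top"
    by (intro tendsto_intros l0)
  moreover have "eventually (\<lambda>q. exp (- inverse (q - 1)) * (1 + 2 * (inverse (q - 1) + (inverse (q - 1))\<^sup>2)) = trunc_factor q) at_top"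
    by (rule eventually_mono[OF eventually_gt_at_top[of 1]]) (rule trunc_factor_alt[symmetric])
  ultimately have "(trunc_factor \<longlongrightarrow> exp (- 0) * (1 + 2 * (0 + 0\<^sup>2))) at_top"
    by (rule Lim_transform_eventually)
  then show ?thesis by simp
qed

text \<open>The truncations \<open>h * bump (h^2 N^2 - 1)\<close> vanish wherever
  \<open>|h| \<le> 1 / N\<close>, in particular near the frontier, so they are test functions inside
  \<open>\<Omega>\<close>. Their gradients are bounded multiples of \<open>grad h\<close> and
  converge to it where \<open>h\<close> is nonzero; on the zero set of \<open>h\<close> the gradient
  itself vanishes almost everywhere.\<close>

lemma dfield_orthogonal:
  assumes \<Omega>: "open \<Omega>" "bounded \<Omega>" and F: "dfield \<Omega> R F"
    and h: "smooth_on UNIV h" "\<And>x. x \<in> frontier \<Omega> \<Longrightarrow> h x = 0"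
  shows "(\<integral>x. F x \<bullet> grad h x \<partial>lborel) = 0"
proof -
  have bF: "bfield R F" and F0: "\<And>x. x \<notin> \<Omega> \<Longrightarrow> F x = 0"
    and Ft: "\<And>\<phi>. test_fun \<Omega> \<phi> \<Longrightarrow> (\<integral>x. F x \<bullet> grad \<phi> x \<partial>lborel) = 0"
    using F by (auto simp: dfield_def)
  have Fm [measurable]: "F \<in> borel_measurable borel" using bF by (auto simp: bfield_def)
  have gm [measurable]: "grad h \<in> borel_measurable borel" by (rule measurable_grad[OF h(1)])
  have hm [measurable]: "h \<in> borel_measurable borel"
    using smooth_on_continuous_on[OF h(1)] by (rule borel_measurable_continuous_onI)
  have [measurable]: "trunc_factor \<in> borel_measurable borel"
    unfolding trunc_factor_def[abs_def] bump_def[abs_def] by measurable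
  define q where "q n x = (h x)\<^sup>2 * (real (Suc n))\<^sup>2" for n x
  define \<phi> where "\<phi> n x = (if x \<in> \<Omega> then h x * bump (q n x - 1) else 0)" for n x
  have sq: "smooth_on UNIV (\<lambda>x. h x * bump (q n x - 1))" for n
    unfolding q_def by (intro smooth_on_mult smooth_on_bump smooth_on_diff smooth_on_power smooth_on_const h open_UNIV)
  have test: "test_fun \<Omega> (\<phi> n)" for n
  proof -
    \<comment> \<open>Closed and bounded, and it misses the frontier because \<open>h = 0\<close>
      there; hence it lies in the open set \<open>\<Omega>\<close>.\<close>
    define K where "K = closure \<Omega> \<inter> {x. 1 \<le> q n x}"
    have cK: "compact K" unfolding K_def q_def
      by (intro compact_Int_closed compact_closure[THEN iffD2] \<Omega> closed_Collect_le continuous_intros smooth_on_continuous_on[OF h(1)])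
    have sub: "K \<subseteq> \<Omega>"
    proof
      fix x assume "x \<in> K"
      then have "x \<in> closure \<Omega>" "h x \<noteq> 0" by (auto simp: K_def q_def)
      then show "x \<in> \<Omega>" using h(2)[of x] \<Omega> by (auto simp: frontier_def interior_open)
    qed
    have z: "\<phi> n x = 0" if "x \<notin> K" for x
      using that closure_subset[of \<Omega>] by (auto simp: \<phi>_def K_def intro!: bump_zero)
    have "smooth_on \<Omega> (\<phi> n)"
      by (rule smooth_on_cong[OF \<Omega>(1) _ smooth_on_subset[OF sq[of n]]]) (auto simp: \<phi>_def)
    then have "smooth_on UNIV (\<phi> n)"
      using \<Omega>(1) compact_imp_closed[OF cK] sub z by (intro smooth_on_zero_extension[of \<Omega> K])
    then show ?thesis using cK sub z by (auto simp: test_fun_def)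
  qed
  have g: "grad (\<phi> n) x = trunc_factor (q n x) *\<^sub>R grad h x" if x: "x \<in> \<Omega>" for n x
  proof (rule grad_eqI)
    define B where "B = (if q n x - 1 > 0 then exp (- inverse (q n x - 1)) / (q n x - 1)\<^sup>2 else 0)"
    have dh: "(h has_derivative (\<lambda>v. grad h x \<bullet> v)) (at x)" by (rule has_derivative_grad[OF h(1)]) simp
    have dq: "((\<lambda>x. q n x - 1) has_derivative (\<lambda>v. 2 * h x * (grad h x \<bullet> v) * (real (Suc n))\<^sup>2)) (at x)"
      unfolding q_def by (rule derivative_eq_intros dh refl)+ (simp add: power2_eq_square algebra_simps)
    have db: "((\<lambda>x. bump (q n x - 1)) has_derivative (\<lambda>v. B * (2 * h x * (grad h x \<bullet> v) * (real (Suc n))\<^sup>2))) (at x)"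
      using has_derivative_compose[OF dq bump_has_derivative[of "q n x - 1", unfolded has_field_derivative_def]]
      by (simp add: B_def)
    have "((\<lambda>x. h x * bump (q n x - 1)) has_derivative
       (\<lambda>v. h x * (B * (2 * h x * (grad h x \<bullet> v) * (real (Suc n))\<^sup>2)) + (grad h x \<bullet> v) * bump (q n x - 1))) (at x)"
      by (rule has_derivative_mult[OF dh db])
    then show "(\<phi> n has_derivative
       (\<lambda>v. h x * (B * (2 * h x * (grad h x \<bullet> v) * (real (Suc n))\<^sup>2)) + (grad h x \<bullet> v) * bump (q n x - 1))) (at x)"
      by (rule has_derivative_transform_within_open[OF _ \<Omega>(1) x]) (auto simp: \<phi>_def)
    have tf: "trunc_factor (q n x) = bump (q n x - 1) + 2 * q n x * B" by (simp add: trunc_factor_def B_def)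
    show "h x * (B * (2 * h x * (grad h x \<bullet> v) * (real (Suc n))\<^sup>2)) + (grad h x \<bullet> v) * bump (q n x - 1)
       = (trunc_factor (q n x) *\<^sub>R grad h x) \<bullet> v" for v
      unfolding tf by (simp add: q_def power2_eq_square algebra_simps)
  qed
  have ae: "AE x in lborel. h x = 0 \<longrightarrow> grad h x = 0"
  proof -
    have "AE x in lborel. \<forall>i. h x = 0 \<longrightarrow> frechet_derivative h (at x) (axis i 1) = 0"
      unfolding AE_all_countable
      by (intro allI negligible_zero_set_nonvanishing_derivative smooth_on_has_derivative[OF h(1)]
            smooth_on_continuous_on smooth_on_frechet h) auto
    then show ?thesis by eventually_elim (auto simp: grad_def vec_eq_iff)
  qed
  have ig: "integrable lborel (\<lambda>x. F x \<bullet> grad h x)"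
    by (rule integrable_bfield_inner_cont[OF bF continuous_on_grad[OF h(1)]])
  have "(\<lambda>n. \<integral>x. trunc_factor (q n x) * (F x \<bullet> grad h x) \<partial>lborel) \<longlonglongrightarrow> (\<integral>x. F x \<bullet> grad h x \<partial>lborel)"
  proof (rule integral_dominated_convergence[where w="\<lambda>x. 7 * \<bar>F x \<bullet> grad h x\<bar>"])
    show "AE x in lborel. (\<lambda>n. trunc_factor (q n x) * (F x \<bullet> grad h x)) \<longlonglongrightarrow> F x \<bullet> grad h x"
      using ae
    proof eventually_elim
      case (elim x)
      show ?case
      proof (cases "h x = 0")
        case True then show ?thesis using elim by simp
      next
        case False
        have "filterlim (\<lambda>n. real (Suc n)) at_top sequentially"
          by (rule filterlim_compose[OF filterlim_real_sequentially filterlim_Suc])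
        then have "filterlim (\<lambda>n. q n x) at_top sequentially"
          unfolding q_def using False
          by (intro filterlim_tendsto_pos_mult_at_top[OF tendsto_const] filterlim_pow_at_top) auto
        then have "(\<lambda>n. trunc_factor (q n x)) \<longlonglongrightarrow> 1"
          by (rule filterlim_compose[OF trunc_factor_tendsto])
        then have "(\<lambda>n. trunc_factor (q n x) * (F x \<bullet> grad h x)) \<longlonglongrightarrow> 1 * (F x \<bullet> grad h x)" by (intro tendsto_intros)
        then show ?thesis by simp
      qed
    qed
    show "AE x in lborel. norm (trunc_factor (q n x) * (F x \<bullet> grad h x)) \<le> 7 * \<bar>F x \<bullet> grad h x\<bar>" for n
      using trunc_factor_bound by (intro AE_I2) (simp add: abs_mult mult_right_mono)
  qed (use ig in \<open>auto simp: q_def\<close>)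
  moreover have "(\<integral>x. trunc_factor (q n x) * (F x \<bullet> grad h x) \<partial>lborel) = 0" for n
  proof -
    have "(\<integral>x. trunc_factor (q n x) * (F x \<bullet> grad h x) \<partial>lborel) = (\<integral>x. F x \<bullet> grad (\<phi> n) x \<partial>lborel)"
      by (rule Bochner_Integration.integral_cong[OF refl]) (metis F0 g inner_scaleR_right inner_zero_left mult_zero_right)
    then show ?thesis using Ft[OF test[of n]] by simp
  qed
  ultimately show ?thesis by (simp add: LIMSEQ_const_iff)
qed

subsection \<open>The single layer potential as a limit\<close>

lemma integral_dfield:
  assumes F0: "\<And>x. x \<notin> \<Omega> \<Longrightarrow> F x = 0" and i: "integrable lborel (\<lambda>x. F x \<bullet> g x)"
  shows "integral \<Omega> (\<lambda>x. F x \<bullet> g x) = (\<integral>x. F x \<bullet> g x \<partial>lborel)"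
    and "(\<lambda>x. F x \<bullet> g x) integrable_on \<Omega>"
proof -
  have h: "((\<lambda>x. F x \<bullet> g x) has_integral (\<integral>x. F x \<bullet> g x \<partial>lborel)) UNIV"
    by (rule has_integral_integral_lborel[OF i])
  moreover have "(\<lambda>x. F x \<bullet> g x) = (\<lambda>x. if x \<in> \<Omega> then F x \<bullet> g x else 0)"
    using F0 by auto
  ultimately have "((\<lambda>x. F x \<bullet> g x) has_integral (\<integral>x. F x \<bullet> g x \<partial>lborel)) \<Omega>"
    using has_integral_restrict_UNIV by metis
  then show "integral \<Omega> (\<lambda>x. F x \<bullet> g x) = (\<integral>x. F x \<bullet> g x \<partial>lborel)" "(\<lambda>x. F x \<bullet> g x) integrable_on \<Omega>"
    by auto
qed

section \<open>Kernels cut off near the evaluation point\<close>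

definition newt :: "real \<Rightarrow> real^3 \<Rightarrow> real" where "newt d z = sg d z / (4 * pi)"

definition kvec :: "real \<Rightarrow> real^3 \<Rightarrow> real^3" where "kvec d z = (\<chi> j. kk d j z)"

lemma kvec_eq: "kvec d z = (sg d z ^ 3 / (4 * pi)) *\<^sub>R z"
  by (simp add: kvec_def vec_eq_iff kk_def)

lemma newt_has_derivative:
  "z \<bullet> z + d > 0 \<Longrightarrow> (newt d has_derivative (\<lambda>v. - (kvec d z \<bullet> v))) (at z)"
  using has_derivative_mult_left[OF sg_has_derivative, of z d "1 / (4 * pi)"]
  by (simp add: newt_def[abs_def] kvec_eq mult.commute)

lemma smooth_on_newt_shift:
  assumes U: "open U" and p: "\<And>y. y \<in> U \<Longrightarrow> (p - y) \<bullet> (p - y) + d > 0"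
  shows "smooth_on U (\<lambda>y. newt d (p - y))"
proof -
  have e: "(p - y) \<bullet> (p - y) = (y - p) \<bullet> (y - p)" for y by (simp add: inner_diff inner_commute)
  have "smooth_on U (\<lambda>y. ((y - p) \<bullet> (y - p) + d) powr (- 1 / 2) * (1 / (4 * pi)))"
    using p by (intro smooth_on_mult smooth_on_powr smooth_on_add smooth_on_const smooth_on_inner_self U) (auto simp: e)
  then show ?thesis
  proof (rule smooth_on_cong[OF U, rotated])
    fix y assume "y \<in> U"
    then have t: "(y - p) \<bullet> (y - p) + d > 0" using p[of y] by (simp add: e)
    have "((y - p) \<bullet> (y - p) + d) powr (- 1 / 2) = inverse (sqrt ((y - p) \<bullet> (y - p) + d))"
      using powr_minus[of "(y - p) \<bullet> (y - p) + d" "1 / 2"] powr_half_sqrt[OF less_imp_le[OF t]] by simp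
    then show "((y - p) \<bullet> (y - p) + d) powr (- 1 / 2) * (1 / (4 * pi)) = newt d (p - y)"
      by (simp add: newt_def sg_def e)
  qed
qed

lemma grad_newt_shift:
  assumes "(p - y) \<bullet> (p - y) + d > 0"
  shows "((\<lambda>y. newt d (p - y)) has_derivative (\<lambda>v. kvec d (p - y) \<bullet> v)) (at y)"
proof -
  have "((\<lambda>y. newt d (p - y)) has_derivative (\<lambda>v. - (kvec d (p - y) \<bullet> (- v)))) (at y)"
    by (rule has_derivative_compose[where f="\<lambda>y. p - y" and g="newt d" and f'="\<lambda>v. - v", OF _ newt_has_derivative[OF assms]])
       (auto intro!: derivative_eq_intros)
  then show ?thesis by simp
qed

text \<open>For \<open>z\<close> within \<open>r\<close> of \<open>x\<close>, the kernel times
  \<open>1 - \<eta>\<close> is smooth everywhere and unchanged on the frontier, while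
  \<open>\<eta>\<close> times the softened kernel is a test function. Since
  \<open>\<eta> = 1\<close> up to radius \<open>2 r\<close>, kernels are evaluated only at distance
  at least \<open>r\<close> from their singularity.\<close>

locale cutoff_at =
  fixes \<Omega> :: "(real^3) set" and x :: "real^3" and r :: real and \<eta> :: "real^3 \<Rightarrow> real"
  assumes r: "r > 0" and sub: "cball x (4 * r) \<subseteq> \<Omega>"
    and \<eta>: "smooth_on UNIV \<eta>" and \<eta>1: "\<And>y. dist x y \<le> 2 * r \<Longrightarrow> \<eta> y = 1" and \<eta>0: "\<And>y. dist x y \<ge> 3 * r \<Longrightarrow> \<eta> y = 0"
begin

text \<open>The gradient of \<open>g d z\<close> (see \<open>g_props\<close>), written out because
  it is differentiated next with respect to \<open>z\<close>.\<close>

definition P :: "real \<Rightarrow> real^3 \<Rightarrow> real^3 \<Rightarrow> real^3" where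
  "P d z y = (1 - \<eta> y) *\<^sub>R kvec d (z - y) - newt d (z - y) *\<^sub>R grad \<eta> y"

definition g :: "real \<Rightarrow> real^3 \<Rightarrow> real^3 \<Rightarrow> real" where
  "g d z y = (1 - \<eta> y) * newt d (z - y)"

lemma grad_\<eta>: "y \<in> ball x (2 * r) \<Longrightarrow> grad \<eta> y = 0"
proof (rule grad_eqI)
  assume y: "y \<in> ball x (2 * r)"
  have "((\<lambda>y. 1) has_derivative (\<lambda>v. 0)) (at y)" by simp
  then show "(\<eta> has_derivative (\<lambda>v. 0)) (at y)"
    by (rule has_derivative_transform_within_open[OF _ open_ball y]) (simp add: \<eta>1)
qed simp

lemma near: "z \<in> ball x r \<Longrightarrow> y \<notin> ball x (2 * r) \<Longrightarrow> norm (z - y) \<ge> r"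
  using dist_triangle[of x y z] by (simp add: dist_norm)

lemma near_pos: "z \<in> ball x r \<Longrightarrow> y \<notin> ball x (2 * r) \<Longrightarrow> d \<ge> 0 \<Longrightarrow> (z - y) \<bullet> (z - y) + d > 0"
  using near[of z y] r sg_arg_pos[of d "z - y"] by fastforce

lemma g_props:
  assumes z: "z \<in> ball x r" and d: "d \<ge> 0"
  shows "smooth_on UNIV (g d z)" "grad (g d z) y = P d z y"
proof -
  have "smooth_on (- {z}) (g d z)" unfolding g_def
    by (intro smooth_on_mult smooth_on_diff smooth_on_const smooth_on_newt_shift smooth_on_subset[OF \<eta>])
       (auto intro!: sg_arg_pos simp: d)
  moreover have "smooth_on (ball x (2 * r)) (g d z)"
    by (rule smooth_on_cong[where f="\<lambda>y. 0"]) (auto simp: g_def \<eta>1)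
  ultimately have "smooth_on (- {z} \<union> ball x (2 * r)) (g d z)" by (intro smooth_on_Un) auto
  moreover have "- {z} \<union> ball x (2 * r) = UNIV" using z r by auto
  ultimately show "smooth_on UNIV (g d z)" by simp
  show "grad (g d z) y = P d z y"
  proof (cases "y \<in> ball x (2 * r)")
    case True
    have "((\<lambda>y. 0) has_derivative (\<lambda>v. 0)) (at y)" by simp
    then have "(g d z has_derivative (\<lambda>v. 0)) (at y)"
      by (rule has_derivative_transform_within_open[OF _ open_ball True]) (simp add: \<eta>1 g_def)
    then have "grad (g d z) y = 0" by (rule grad_eqI) simp
    then show ?thesis using True by (simp add: P_def grad_\<eta> \<eta>1)
  next
    case False
    have e: "(\<eta> has_derivative (\<lambda>v. grad \<eta> y \<bullet> v)) (at y)" by (rule has_derivative_grad[OF \<eta>]) simp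
    have "(g d z has_derivative (\<lambda>v. (1 - \<eta> y) * (kvec d (z - y) \<bullet> v) + (0 - grad \<eta> y \<bullet> v) * newt d (z - y))) (at y)"
      unfolding g_def[abs_def]
      by (intro has_derivative_mult has_derivative_diff has_derivative_const e grad_newt_shift near_pos[OF z False d])
    then show ?thesis by (rule grad_eqI) (simp add: P_def inner_diff_left mult.commute)
  qed
qed

lemma laplace_kernel_newt: "laplace_kernel z y = newt 0 (z - y)"
  by (simp add: laplace_kernel_def newt_def sg_def norm_eq_sqrt_inner divide_simps)

lemma frontier_far: "open \<Omega> \<Longrightarrow> y \<in> frontier \<Omega> \<Longrightarrow> dist x y \<ge> 3 * r"
  using sub r by (force simp: frontier_def interior_open)

text \<open>The chosen extension and \<open>g 0 z\<close> agree on the frontier, so by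
  \<open>dfield_orthogonal\<close> the field \<open>F\<close> does not distinguish their gradients.
  The function \<open>g 0 z\<close> also witnesses that an extension exists.\<close>

lemma single_layer_eq:
  assumes \<Omega>: "open \<Omega>" "bounded \<Omega>" and F: "dfield \<Omega> R F" and z: "z \<in> ball x r"
  shows "single_layer_trace \<Omega> F z = (\<integral>y. F y \<bullet> P 0 z y \<partial>lborel)"
proof -
  have bF: "bfield R F" and F0: "\<And>x. x \<notin> \<Omega> \<Longrightarrow> F x = 0" using F by (auto simp: dfield_def)
  define G where "G = (SOME g. smooth_on UNIV g \<and> (\<forall>y\<in>frontier \<Omega>. g y = laplace_kernel z y))"
  have "smooth_on UNIV (g 0 z) \<and> (\<forall>y\<in>frontier \<Omega>. g 0 z y = laplace_kernel z y)"
    using g_props(1)[OF z] frontier_far[OF \<Omega>(1)] \<eta>0 by (auto simp: g_def laplace_kernel_newt)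
  then have G: "smooth_on UNIV G" "\<And>y. y \<in> frontier \<Omega> \<Longrightarrow> G y = g 0 z y"
    using someI[of "\<lambda>g. smooth_on UNIV g \<and> (\<forall>y\<in>frontier \<Omega>. g y = laplace_kernel z y)" "g 0 z"]
    by (auto simp: G_def)
  have g0: "smooth_on UNIV (g 0 z)" using g_props(1)[OF z] by simp
  have i: "integrable lborel (\<lambda>y. F y \<bullet> grad G y)" "integrable lborel (\<lambda>y. F y \<bullet> grad (g 0 z) y)"
    by (intro integrable_bfield_inner_cont[OF bF] continuous_on_grad G g0)+
  have "0 = (\<integral>y. F y \<bullet> grad (\<lambda>y. G y - g 0 z y) y \<partial>lborel)"
    by (rule dfield_orthogonal[OF \<Omega> F, symmetric]) (use G g0 in \<open>auto intro: smooth_on_diff\<close>)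
  also have "\<dots> = (\<integral>y. F y \<bullet> grad G y - F y \<bullet> grad (g 0 z) y \<partial>lborel)"
  proof (rule Bochner_Integration.integral_cong[OF refl])
    fix y
    have "grad (\<lambda>y. G y - g 0 z y) y = grad G y - grad (g 0 z) y"
      by (rule grad_eqI[OF has_derivative_diff[OF has_derivative_grad[OF G(1)] has_derivative_grad[OF g0]]])
         (auto simp: inner_diff_left)
    then show "F y \<bullet> grad (\<lambda>y. G y - g 0 z y) y = F y \<bullet> grad G y - F y \<bullet> grad (g 0 z) y"
      by (simp add: inner_diff_right)
  qed
  finally have "(\<integral>y. F y \<bullet> grad G y \<partial>lborel) = (\<integral>y. F y \<bullet> grad (g 0 z) y \<partial>lborel)" using i by simp
  moreover have "single_layer_trace \<Omega> F z = (\<integral>y. F y \<bullet> grad G y \<partial>lborel)"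
    unfolding single_layer_trace_def G_def[symmetric] by (rule integral_dfield(1)[OF F0 i(1)])
  ultimately show ?thesis using g_props(2)[OF z] by simp
qed

text \<open>The full kernel differs from \<open>g d z\<close> by the test function
  \<open>\<eta> y * newt d (z - y)\<close>, to whose gradient \<open>F\<close> is orthogonal. The
  resulting formula stays regular as \<open>d\<close> tends to 0 and becomes that of
  \<open>single_layer_eq\<close>.\<close>

lemma upot_eq:
  assumes F: "dfield \<Omega> R F" and z: "z \<in> ball x r" and d: "d > 0"
  shows "upot d F z = (\<integral>y. F y \<bullet> P d z y \<partial>lborel)"
proof -
  have bF: "bfield R F" and Ft: "\<And>\<phi>. test_fun \<Omega> \<phi> \<Longrightarrow> (\<integral>x. F x \<bullet> grad \<phi> x \<partial>lborel) = 0"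
    using F by (auto simp: dfield_def)
  have ns: "smooth_on UNIV (\<lambda>y. newt d (z - y))"
    by (rule smooth_on_newt_shift) (use sg_arg_pos'[OF d] in auto)
  have gn: "grad (\<lambda>y. newt d (z - y)) y = kvec d (z - y)" for y
    by (rule grad_eqI[OF grad_newt_shift[OF sg_arg_pos'[OF d]]]) simp
  have ps: "smooth_on UNIV (\<lambda>y. \<eta> y * newt d (z - y))" by (intro smooth_on_mult \<eta> ns open_UNIV)
  have gp: "grad (\<lambda>y. \<eta> y * newt d (z - y)) y = kvec d (z - y) - P d z y" for y
    by (rule grad_eqI[OF has_derivative_mult[OF has_derivative_grad[OF \<eta>] grad_newt_shift[OF sg_arg_pos'[OF d]]]])
       (auto simp: P_def algebra_simps inner_commute)
  have "test_fun \<Omega> (\<lambda>y. \<eta> y * newt d (z - y))"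
    unfolding test_fun_def using ps sub r
    by (intro conjI exI[of _ "cball x (4 * r)"]) (auto simp: \<eta>0)
  then have "0 = (\<integral>y. F y \<bullet> (kvec d (z - y) - P d z y) \<partial>lborel)"
    using Ft[of "\<lambda>y. \<eta> y * newt d (z - y)"] by (simp add: gp)
  moreover have "integrable lborel (\<lambda>y. F y \<bullet> kvec d (z - y))"
    using integrable_bfield_inner_cont[OF bF continuous_on_grad[OF ns]] by (simp add: gn)
  moreover have "integrable lborel (\<lambda>y. F y \<bullet> P d z y)"
    using integrable_bfield_inner_cont[OF bF continuous_on_grad[OF g_props(1)[OF z less_imp_le[OF d]]]]
    by (simp add: g_props(2)[OF z less_imp_le[OF d]])
  ultimately have "(\<integral>y. F y \<bullet> P d z y \<partial>lborel) = (\<integral>y. F y \<bullet> kvec d (z - y) \<partial>lborel)"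
    by (simp add: inner_diff_right)
  also have "\<dots> = upot d F z"
  proof -
    have "integrable lborel (\<lambda>y. F y $ j * kk d j (z - y))" for j
      by (rule integrable_cv[OF bfield_bscalar[OF bF] smooth_on_continuous_on[OF smooth_kernels(1)[OF d]]])
    then show ?thesis by (simp add: upot_def cv_def kvec_def inner_vec_def Bochner_Integration.integral_sum)
  qed
  finally show ?thesis by simp
qed

text \<open>The derivative of \<open>P d z y\<close> in \<open>z\<close> in direction
  \<open>v\<close> (see \<open>P_has_derivative\<close>).\<close>

definition Q :: "real \<Rightarrow> real^3 \<Rightarrow> real^3 \<Rightarrow> real^3 \<Rightarrow> real^3" where
  "Q d z y v = (1 - \<eta> y) *\<^sub>R (\<chi> j. \<Sum>i\<in>UNIV. kk1 d j i (z - y) * v $ i) + (kvec d (z - y) \<bullet> v) *\<^sub>R grad \<eta> y"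

lemma P_has_derivative:
  assumes z: "z \<in> ball x r" and d: "d \<ge> 0"
  shows "((\<lambda>z. w \<bullet> P d z y) has_derivative (\<lambda>v. w \<bullet> Q d z y v)) (at z)"
proof (cases "y \<in> ball x (2 * r)")
  case True
  then show ?thesis by (simp add: P_def Q_def grad_\<eta> \<eta>1)
next
  case False
  have s: "((\<lambda>z. z - y) has_derivative (\<lambda>v. v)) (at z)" by (auto intro!: derivative_eq_intros)
  note p = near_pos[OF z False d]
  have k: "((\<lambda>z. kvec d (z - y) $ j) has_derivative (\<lambda>v. \<Sum>i\<in>UNIV. kk1 d j i (z - y) * v $ i)) (at z)" for j
    unfolding kvec_def vec_lambda_beta using has_derivative_compose[OF s kk_has_derivative[OF p, of j]] by simp
  have n: "((\<lambda>z. newt d (z - y)) has_derivative (\<lambda>v. - (kvec d (z - y) \<bullet> v))) (at z)"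
    using has_derivative_compose[OF s newt_has_derivative[OF p]] by simp
  have e1: "w \<bullet> P d z y = (\<Sum>j\<in>UNIV. (w $ j * (1 - \<eta> y)) * (kvec d (z - y) $ j)) - newt d (z - y) * (w \<bullet> grad \<eta> y)" for z
    by (simp add: P_def inner_vec_def sum_distrib_left sum_subtractf sum.distrib algebra_simps)
  have e2: "w \<bullet> Q d z y v = (\<Sum>j\<in>UNIV. (w $ j * (1 - \<eta> y)) * (\<Sum>i\<in>UNIV. kk1 d j i (z - y) * v $ i)) - (- (kvec d (z - y) \<bullet> v)) * (w \<bullet> grad \<eta> y)" for v
    by (simp add: Q_def inner_add_right) (simp add: inner_vec_def sum_distrib_left sum_distrib_right mult_ac)
  show ?thesis unfolding e1 e2
    by (intro has_derivative_diff has_derivative_sum has_derivative_mult_right has_derivative_mult_left k n)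
qed

text \<open>Where \<open>Q\<close> is nonzero the kernels are evaluated at distance at least
  \<open>r\<close>, where \<open>sg d \<le> 1 / r\<close> for every \<open>d \<ge> 0\<close>; this
  makes the bound uniform in \<open>d\<close>.\<close>

lemma Q_bound: "\<exists>C\<ge>0. \<forall>z\<in>ball x r. \<forall>d\<ge>0. \<forall>y v. norm (Q d z y v) \<le> C * norm v"
proof -
  define s where "s = inverse r"
  have s: "s > 0" using r by (simp add: s_def)
  obtain B1 where B1: "B1 \<ge> 0" "\<And>y. y \<in> cball x (3 * r) \<Longrightarrow> norm (\<eta> y) \<le> B1"
    using continuous_bounded_on_compact[OF continuous_on_subset[OF smooth_on_continuous_on[OF \<eta>]] compact_cball] by blast
  obtain B2 where B2: "B2 \<ge> 0" "\<And>y. y \<in> cball x (3 * r) \<Longrightarrow> norm (grad \<eta> y) \<le> B2"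
    using continuous_bounded_on_compact[OF continuous_on_subset[OF continuous_on_grad[OF \<eta>]] compact_cball] by blast
  define B where "B = B1 + B2 + 1"
  have B: "\<bar>1 - \<eta> y\<bar> \<le> B" "norm (grad \<eta> y) \<le> B" for y
  proof (atomize (full), cases "y \<in> cball x (3 * r)")
    case True
    then show "\<bar>1 - \<eta> y\<bar> \<le> B \<and> norm (grad \<eta> y) \<le> B"
      using B1(1) B1(2)[OF True] B2(1) B2(2)[OF True] by (simp add: B_def)
  next
    case False
    then have "\<eta> y = 0" "grad \<eta> y = 0"
      using \<eta>0 grad_eq_0_outside[of "cball x (3 * r)" \<eta> y] by auto
    then show "\<bar>1 - \<eta> y\<bar> \<le> B \<and> norm (grad \<eta> y) \<le> B" using B1 B2 by (simp add: B_def)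
  qed
  have B0: "B \<ge> 0" using B1 B2 by (simp add: B_def)
  define C where "C = B * (3 * (3 * (4 * s ^ 3))) + 3 * s ^ 2 * B"
  have "norm (Q d z y v) \<le> C * norm v" if z: "z \<in> ball x r" and d: "d \<ge> 0" for d z y v
  proof (cases "y \<in> ball x (2 * r)")
    case True
    have "C \<ge> 0" using B0 s by (simp add: C_def)
    then show ?thesis using True by (simp add: Q_def grad_\<eta> \<eta>1)
  next
    case False
    note p = near_pos[OF z False d]
    have nr: "norm (z - y) \<ge> r" by (rule near[OF z False])
    have sg: "0 \<le> sg d (z - y)" "sg d (z - y) \<le> s"
    proof -
      show "0 \<le> sg d (z - y)" using d by (rule sg_nonneg)
      then have "r * sg d (z - y) \<le> 1"
        using sg_bound_norm[OF d, of "z - y"] mult_right_mono[OF nr, of "sg d (z - y)"] by linarith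
      then show "sg d (z - y) \<le> s" using r by (simp add: s_def field_simps)
    qed
    have k1: "\<bar>kk1 d j i (z - y)\<bar> \<le> 4 * s ^ 3" for i j
      using kernel_decay_gen(2)[OF d p, of j i] power_mono[OF sg(2,1), of 3] by linarith
    have k0: "\<bar>kk d j (z - y)\<bar> \<le> s ^ 2" for j
      using kernel_decay_gen(1)[OF d p, of j] power_mono[OF sg(2,1), of 2] by linarith
    have n1: "norm (\<chi> j. \<Sum>i\<in>UNIV. kk1 d j i (z - y) * v $ i) \<le> 3 * (3 * (4 * s ^ 3)) * norm v"
    proof -
      have "\<bar>\<Sum>i\<in>UNIV. kk1 d j i (z - y) * v $ i\<bar> \<le> 3 * (4 * s ^ 3) * norm v" for j
      proof -
        have "\<bar>\<Sum>i\<in>UNIV. kk1 d j i (z - y) * v $ i\<bar> \<le> (\<Sum>i\<in>UNIV. \<bar>kk1 d j i (z - y) * v $ i\<bar>)" by (rule sum_abs)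
        also have "\<dots> \<le> (\<Sum>i\<in>(UNIV::3 set). 4 * s ^ 3 * norm v)"
          unfolding abs_mult using k1 s by (intro sum_mono mult_mono component_le_norm_cart) auto
        finally show ?thesis by simp
      qed
      then have "(\<Sum>j\<in>UNIV. \<bar>(\<chi> j. \<Sum>i\<in>UNIV. kk1 d j i (z - y) * v $ i) $ j\<bar>) \<le> (\<Sum>j\<in>(UNIV::3 set). 3 * (4 * s ^ 3) * norm v)"
        by (intro sum_mono) simp
      then show ?thesis using norm_le_l1_cart[of "\<chi> j. \<Sum>i\<in>UNIV. kk1 d j i (z - y) * v $ i"] by simp
    qed
    have n2: "\<bar>kvec d (z - y) \<bullet> v\<bar> \<le> 3 * s ^ 2 * norm v"
    proof -
      have "\<bar>kvec d (z - y) \<bullet> v\<bar> \<le> (\<Sum>j\<in>UNIV. \<bar>kk d j (z - y) * v $ j\<bar>)"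
        using sum_abs[of "\<lambda>j. kk d j (z - y) * v $ j" UNIV] by (simp add: inner_vec_def kvec_def)
      also have "\<dots> \<le> (\<Sum>j\<in>(UNIV::3 set). s ^ 2 * norm v)"
        unfolding abs_mult using k0 s by (intro sum_mono mult_mono component_le_norm_cart) auto
      finally show ?thesis by simp
    qed
    have "norm (Q d z y v) \<le> \<bar>1 - \<eta> y\<bar> * norm (\<chi> j. \<Sum>i\<in>UNIV. kk1 d j i (z - y) * v $ i) + \<bar>kvec d (z - y) \<bullet> v\<bar> * norm (grad \<eta> y)"
      unfolding Q_def by (rule order_trans[OF norm_triangle_ineq]) simp
    also have "\<dots> \<le> B * (3 * (3 * (4 * s ^ 3)) * norm v) + (3 * s ^ 2 * norm v) * B"
      using B[of y] n1 n2 B0 s by (intro add_mono mult_mono) auto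
    also have "\<dots> = C * norm v" by (simp add: C_def algebra_simps)
    finally show ?thesis .
  qed
  moreover have "C \<ge> 0" using B0 s by (simp add: C_def)
  ultimately show ?thesis by blast
qed

lemma P_integral_has_derivative:
  assumes F: "bfield R F" and d: "d \<ge> 0"
  shows "\<And>v. integrable lborel (\<lambda>y. F y \<bullet> Q d x y v)"
    and "((\<lambda>z. \<integral>y. F y \<bullet> P d z y \<partial>lborel) has_derivative (\<lambda>v. \<integral>y. F y \<bullet> Q d x y v \<partial>lborel)) (at x)"
proof -
  obtain C where C: "C \<ge> 0" "\<And>z d y v. z \<in> ball x r \<Longrightarrow> d \<ge> 0 \<Longrightarrow> norm (Q d z y v) \<le> C * norm v"
    using Q_bound by blast
  have w: "integrable lborel (\<lambda>y. C * norm (F y))" using bfield_integrable[OF F] by simp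
  have i: "integrable lborel (\<lambda>y. F y \<bullet> P d z y)" if "z \<in> ball x r" for z
    using integrable_bfield_inner_cont[OF F continuous_on_grad[OF g_props(1)[OF that d]]]
    by (simp add: g_props(2)[OF that d])
  have b: "\<bar>F y \<bullet> Q d z y v\<bar> \<le> C * norm (F y) * norm v" if "z \<in> ball x r" for y z v
  proof -
    have "\<bar>F y \<bullet> Q d z y v\<bar> \<le> norm (F y) * norm (Q d z y v)" by (rule Cauchy_Schwarz_ineq2)
    also have "\<dots> \<le> norm (F y) * (C * norm v)" using C(2)[OF that d] by (intro mult_left_mono) auto
    finally show ?thesis by (simp add: mult_ac)
  qed
  show "\<And>v. integrable lborel (\<lambda>y. F y \<bullet> Q d x y v)"
    by (rule has_derivative_integral(1)[OF r i _ w, where f'="\<lambda>y z v. F y \<bullet> Q d z y v"])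
       (use P_has_derivative[OF _ d] b in auto)
  show "((\<lambda>z. \<integral>y. F y \<bullet> P d z y \<partial>lborel) has_derivative (\<lambda>v. \<integral>y. F y \<bullet> Q d x y v \<partial>lborel)) (at x)"
    by (rule has_derivative_integral(2)[OF r i _ w, where f'="\<lambda>y z v. F y \<bullet> Q d z y v"])
       (use P_has_derivative[OF _ d] b in auto)
qed

text \<open>Near \<open>x\<close> both potentials are integrals of \<open>F\<close> against
  \<open>P\<close>, with parameters \<open>d n\<close> and 0. Their derivatives are integrals
  against \<open>Q\<close>, which converges pointwise under a bound that does not depend on
  \<open>d\<close>.\<close>

lemma grad_single_layer_limit:
  assumes \<Omega>: "open \<Omega>" "bounded \<Omega>" and F: "dfield \<Omega> R F" and d: "\<And>n. d n > 0" "d \<longlonglongrightarrow> 0"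
  shows "(\<lambda>n. grad (upot (d n) F) x) \<longlonglongrightarrow> grad (single_layer_trace \<Omega> F) x"
proof -
  have bF: "bfield R F" using F by (auto simp: dfield_def)
  have x: "x \<in> ball x r" using r by simp
  obtain C where C: "C \<ge> 0" "\<And>z d y v. z \<in> ball x r \<Longrightarrow> d \<ge> 0 \<Longrightarrow> norm (Q d z y v) \<le> C * norm v"
    using Q_bound by blast
  have s: "frechet_derivative (single_layer_trace \<Omega> F) (at x) = (\<lambda>v. \<integral>y. F y \<bullet> Q 0 x y v \<partial>lborel)"
    by (rule frechet_derivative_at[symmetric], rule has_derivative_transform_within_open[OF P_integral_has_derivative(2)[OF bF order_refl] open_ball x])
       (simp add: single_layer_eq[OF \<Omega> F])
  have u: "frechet_derivative (upot (d n) F) (at x) = (\<lambda>v. \<integral>y. F y \<bullet> Q (d n) x y v \<partial>lborel)" for n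
    by (rule frechet_derivative_at[symmetric], rule has_derivative_transform_within_open[OF P_integral_has_derivative(2)[OF bF less_imp_le[OF d(1)]] open_ball x])
       (simp add: upot_eq[OF F _ d(1)])
  have lim: "(\<lambda>n. F y \<bullet> Q (d n) x y v) \<longlonglongrightarrow> F y \<bullet> Q 0 x y v" for y v
  proof (cases "y \<in> ball x (2 * r)")
    case True
    then show ?thesis by (simp add: Q_def grad_\<eta> \<eta>1)
  next
    case False
    have "(x - y) \<bullet> (x - y) + 0 > 0" by (rule near_pos[OF x False]) simp
    then have p: "sqrt ((x - y) \<bullet> (x - y) + 0) \<noteq> 0" by simp
    have sl: "(\<lambda>n. sg (d n) (x - y)) \<longlonglongrightarrow> sg 0 (x - y)"
      unfolding sg_def using p d(2) by (intro tendsto_intros)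
    show ?thesis unfolding Q_def kvec_def kk_def kk1_def inner_vec_def
      by (intro tendsto_intros sl tendsto_vec_lambda) auto
  qed
  have "(\<lambda>n. \<integral>y. F y \<bullet> Q (d n) x y v \<partial>lborel) \<longlonglongrightarrow> (\<integral>y. F y \<bullet> Q 0 x y v \<partial>lborel)" for v
  proof (rule integral_dominated_convergence[where w="\<lambda>y. norm (F y) * (C * norm v)"])
    show "(\<lambda>y. F y \<bullet> Q 0 x y v) \<in> borel_measurable lborel"
      using P_integral_has_derivative(1)[OF bF order_refl] borel_measurable_integrable by blast
    show "(\<lambda>y. F y \<bullet> Q (d n) x y v) \<in> borel_measurable lborel" for n
      using P_integral_has_derivative(1)[OF bF less_imp_le[OF d(1)]] borel_measurable_integrable by blast
    show "integrable lborel (\<lambda>y. norm (F y) * (C * norm v))" using bfield_integrable[OF bF] by simp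
    show "AE y in lborel. norm (F y \<bullet> Q (d n) x y v) \<le> norm (F y) * (C * norm v)" for n
    proof (rule AE_I2)
      fix y
      have "\<bar>F y \<bullet> Q (d n) x y v\<bar> \<le> norm (F y) * norm (Q (d n) x y v)" by (rule Cauchy_Schwarz_ineq2)
      also have "\<dots> \<le> norm (F y) * (C * norm v)" using C(2)[OF x less_imp_le[OF d(1)]] by (intro mult_left_mono) auto
      finally show "norm (F y \<bullet> Q (d n) x y v) \<le> norm (F y) * (C * norm v)" by simp
    qed
  qed (use lim in auto)
  then show ?thesis
    unfolding grad_def s u by (intro tendsto_vec_lambda)
qed

end

lemma grad_upot_tendsto_single_layer:
  assumes \<Omega>: "open \<Omega>" "bounded \<Omega>" and F: "dfield \<Omega> R F" and d: "\<And>n. d n > 0" "d \<longlonglongrightarrow> 0" and x: "x \<in> \<Omega>"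
  shows "(\<lambda>n. grad (upot (d n) F) x) \<longlonglongrightarrow> grad (single_layer_trace \<Omega> F) x"
proof -
  obtain e where e: "e > 0" "cball x e \<subseteq> \<Omega>" using \<Omega> x open_contains_cball by blast
  obtain \<eta> where \<eta>: "smooth_on UNIV \<eta>" "\<And>y. dist x y \<le> 2 * (e / 4) \<Longrightarrow> \<eta> y = 1" "\<And>y. dist x y \<ge> 3 * (e / 4) \<Longrightarrow> \<eta> y = 0"
    by (rule smooth_cutoff[of "2 * (e / 4)" "3 * (e / 4)" x]) (use e in auto)
  interpret cutoff_at \<Omega> x "e / 4" \<eta> by unfold_locales (use e \<eta> in auto)
  show ?thesis by (rule grad_single_layer_limit[OF \<Omega> F d])
qed

subsection \<open>Boundedness, symmetry and bounds of the operator\<close>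

lemma closed2_representative:
  assumes \<Omega>: "open \<Omega>" "\<Omega> \<subseteq> cball 0 R" and F: "closed2 \<Omega> F"
  obtains F0 N where "dfield \<Omega> R F0" "negligible N" "\<And>x. x \<in> \<Omega> \<Longrightarrow> x \<notin> N \<Longrightarrow> F0 x = F x"
proof -
  have Fm: "F measurable_on \<Omega>" and Fi: "(\<lambda>x. (norm (F x))\<^sup>2) integrable_on \<Omega>"
    and Ft: "\<And>\<phi>. test_fun \<Omega> \<phi> \<Longrightarrow> integral \<Omega> (\<lambda>x. F x \<bullet> grad \<phi> x) = 0"
    using F by (auto simp: closed2_def L2_field_def)
  from Fm obtain N g where Ng: "negligible N \<and> (\<forall>n. continuous_on UNIV (g n)) \<and>
      (\<forall>x. x \<notin> N \<longrightarrow> (\<lambda>n. g n x) \<longlonglongrightarrow> (if x \<in> \<Omega> then F x else 0))"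
    unfolding measurable_on_def by (elim exE) (rule that)
  then have N: "negligible N" and g: "\<And>n. continuous_on UNIV (g n)"
    and lim: "\<And>x. x \<notin> N \<Longrightarrow> (\<lambda>n. g n x) \<longlonglongrightarrow> (if x \<in> \<Omega> then F x else 0)"
    by (iprover, iprover, iprover)
  have [measurable]: "g n \<in> borel_measurable borel" for n using g by (rule borel_measurable_continuous_onI)
  have [measurable]: "\<Omega> \<in> sets borel" using \<Omega> by simp
  \<comment> \<open>A pointwise \<open>lim\<close> of continuous functions is Borel even where the
    sequence diverges; inside \<open>\<Omega>\<close> divergence is confined to the negligible set
    \<open>N\<close>.\<close>
  define F0 where "F0 x = indicator \<Omega> x *\<^sub>R lim (\<lambda>n. g n x)" for x
  have [measurable]: "F0 \<in> borel_measurable borel" unfolding F0_def by measurable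
  have e: "F0 x = F x" if "x \<in> \<Omega>" "x \<notin> N" for x
    using limI[OF lim[OF that(2)]] that by (simp add: F0_def)
  have z: "F0 x = 0" if "x \<notin> \<Omega>" for x using that by (simp add: F0_def)
  have "((\<lambda>x. (norm (F0 x))\<^sup>2) has_integral integral \<Omega> (\<lambda>x. (norm (F x))\<^sup>2)) \<Omega>"
    by (rule has_integral_spike[OF N _ integrable_integral[OF Fi]]) (simp add: e)
  then have "((\<lambda>x. if x \<in> \<Omega> then (norm (F0 x))\<^sup>2 else 0) has_integral integral \<Omega> (\<lambda>x. (norm (F x))\<^sup>2)) UNIV"
    by (simp only: has_integral_restrict_UNIV)
  moreover have "(\<lambda>x. if x \<in> \<Omega> then (norm (F0 x))\<^sup>2 else 0) = (\<lambda>x. (norm (F0 x))\<^sup>2)" using z by auto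
  ultimately have "(\<integral>\<^sup>+x. ennreal ((norm (F0 x))\<^sup>2) \<partial>lborel) = ennreal (integral \<Omega> (\<lambda>x. (norm (F x))\<^sup>2))"
    by (intro nn_integral_has_integral_lborel) auto
  then have i: "integrable lborel (\<lambda>x. (norm (F0 x))\<^sup>2)" by (intro integrableI_nonneg) auto
  have b: "bfield R F0" unfolding bfield_def
  proof (intro conjI allI impI i)
    fix x :: "real^3" assume "R < norm x"
    then have "x \<notin> \<Omega>" using \<Omega>(2) by auto
    then show "F0 x = 0" by (rule z)
  qed auto
  have "dfield \<Omega> R F0" unfolding dfield_def
  proof (intro conjI allI impI b z)
    fix \<phi> assume t: "test_fun \<Omega> \<phi>"
    then have "integrable lborel (\<lambda>x. F0 x \<bullet> grad \<phi> x)"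
      by (intro integrable_bfield_inner_cont[OF b] continuous_on_grad) (simp add: test_fun_def)
    then have "(\<integral>x. F0 x \<bullet> grad \<phi> x \<partial>lborel) = integral \<Omega> (\<lambda>x. F0 x \<bullet> grad \<phi> x)"
      using integral_dfield(1)[of \<Omega> F0 "grad \<phi>"] z by simp
    also have "\<dots> = integral \<Omega> (\<lambda>x. F x \<bullet> grad \<phi> x)"
      by (rule integral_spike[OF N]) (simp add: e)
    finally show "(\<integral>x. F0 x \<bullet> grad \<phi> x \<partial>lborel) = 0" using Ft[OF t] by simp
  qed
  then show ?thesis using that N e by blast
qed

lemma bfield_inner_integrable:
  "bfield R F \<Longrightarrow> bfield R G \<Longrightarrow> integrable lborel (\<lambda>x. F x \<bullet> G x)"
  by (rule L2_inner(1)) (auto simp: bfield_def)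

lemma dfield_imp_closed2:
  assumes \<Omega>: "open \<Omega>" and F: "dfield \<Omega> R F"
  shows "closed2 \<Omega> F"
proof -
  have b: "bfield R F" and z: "\<And>x. x \<notin> \<Omega> \<Longrightarrow> F x = 0" and t: "\<And>\<phi>. test_fun \<Omega> \<phi> \<Longrightarrow> (\<integral>x. F x \<bullet> grad \<phi> x \<partial>lborel) = 0"
    using F by (auto simp: dfield_def)
  have [measurable]: "F \<in> borel_measurable borel" using b by (simp add: bfield_def)
  have "F \<in> borel_measurable lebesgue" by (simp add: measurable_completion)
  then have "F \<in> borel_measurable (lebesgue_on \<Omega>)" by (rule measurable_restrict_space1)
  then have "F measurable_on \<Omega>"
    using \<Omega> by (subst measurable_on_iff_borel_measurable) (auto intro: lebesgue_openin)
  moreover have "(\<lambda>x. (norm (F x))\<^sup>2) integrable_on \<Omega>"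
    using integral_dfield(2)[OF z bfield_inner_integrable[OF b b]] by (simp add: power2_norm_eq_inner)
  moreover have "integral \<Omega> (\<lambda>x. F x \<bullet> grad \<phi> x) = 0" if "test_fun \<Omega> \<phi>" for \<phi>
  proof -
    have "integrable lborel (\<lambda>x. F x \<bullet> grad \<phi> x)"
      using that by (intro integrable_bfield_inner_cont[OF b] continuous_on_grad) (simp add: test_fun_def)
    then show ?thesis using integral_dfield(1)[of \<Omega> F "grad \<phi>"] z t[OF that] by simp
  qed
  ultimately show ?thesis by (simp add: closed2_def L2_field_def)
qed

text \<open>\<open>F\<close> enters the trace only through an integral: the chosen extension depends
  on the kernel and the frontier alone. So \<open>B_op\<close> is well defined on classes modulo
  negligible sets, even as an equality of functions.\<close>

lemma B_op_cong:
  assumes N: "negligible N" "\<And>x. x \<in> \<Omega> \<Longrightarrow> x \<notin> N \<Longrightarrow> F0 x = F x"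
  shows "B_op \<Omega> F0 = B_op \<Omega> F"
proof -
  have "single_layer_trace \<Omega> F0 = single_layer_trace \<Omega> F"
    unfolding single_layer_trace_def[abs_def] by (intro ext integral_spike[OF N(1)]) (simp add: N(2))
  then show ?thesis by (intro ext) (simp add: B_op_def)
qed

abbreviation ip :: "(real^3 \<Rightarrow> real^3) \<Rightarrow> (real^3 \<Rightarrow> real^3) \<Rightarrow> real" where
  "ip F G \<equiv> (\<integral>x. F x \<bullet> G x \<partial>lborel)"

lemma l2_inner_eq:
  assumes "negligible N" "\<And>x. x \<in> \<Omega> \<Longrightarrow> x \<notin> N \<Longrightarrow> F0 x = F x"
    and "negligible M" "\<And>x. x \<in> \<Omega> \<Longrightarrow> x \<notin> M \<Longrightarrow> G0 x = G x"
    and F: "bfield R F0" "\<And>x. x \<notin> \<Omega> \<Longrightarrow> F0 x = 0" and G: "bfield R G0"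
  shows "l2_inner \<Omega> F G = ip F0 G0"
proof -
  have "l2_inner \<Omega> F G = integral \<Omega> (\<lambda>x. F0 x \<bullet> G0 x)"
    unfolding l2_inner_def
    by (rule integral_spike[OF negligible_Un[OF assms(1,3)], symmetric]) (use assms(2,4) in auto)
  also have "\<dots> = ip F0 G0" by (rule integral_dfield(1)[OF F(2) bfield_inner_integrable[OF F(1) G]])
  finally show ?thesis .
qed

text \<open>Brings test functions under the decay hypotheses of
  \<open>energy_identity\<close>.\<close>

lemma test_fun_decay:
  assumes "test_fun \<Omega> \<phi>"
  shows "\<exists>A\<ge>0. (\<forall>x. \<bar>\<phi> x\<bar> \<le> A * sg 1 x ^ 2) \<and> (\<forall>x i. \<bar>grad \<phi> x $ i\<bar> \<le> A * sg 1 x ^ 3)"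
proof -
  obtain K where K: "smooth_on UNIV \<phi>" "compact K" "\<And>x. x \<notin> K \<Longrightarrow> \<phi> x = 0"
    using assms by (auto simp: test_fun_def)
  note gz = grad_eq_0_outside[OF compact_imp_closed[OF K(2)] K(3)]
  have co: "continuous_on UNIV (\<lambda>x. \<bar>\<phi> x\<bar> / sg 1 x ^ 2 + norm (grad \<phi> x) / sg 1 x ^ 3)"
    using sg1_le_1(2) less_imp_neq[OF sg1_le_1(2), symmetric]
    by (intro continuous_intros smooth_on_continuous_on[OF K(1)] continuous_on_grad[OF K(1)] smooth_on_continuous_on[OF smooth_on_sg])
       (auto simp: sg_arg_pos')
  from continuous_bounded_on_compact[OF continuous_on_subset[OF co] K(2)]
  obtain A where A0: "A \<ge> 0" "\<And>x. x \<in> K \<Longrightarrow> norm (\<bar>\<phi> x\<bar> / sg 1 x ^ 2 + norm (grad \<phi> x) / sg 1 x ^ 3) \<le> A" by blast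
  have A: "\<bar>\<phi> x\<bar> / sg 1 x ^ 2 + norm (grad \<phi> x) / sg 1 x ^ 3 \<le> \<bar>A\<bar>" if "x \<in> K" for x
    using A0(2)[OF that] by simp
  have p: "sg 1 x ^ n > 0" for x n using sg1_le_1(2)[of x] by simp
  have "\<bar>\<phi> x\<bar> \<le> \<bar>A\<bar> * sg 1 x ^ 2 \<and> norm (grad \<phi> x) \<le> \<bar>A\<bar> * sg 1 x ^ 3" for x
  proof (cases "x \<in> K")
    case True
    have "0 \<le> \<bar>\<phi> x\<bar> / sg 1 x ^ 2" "0 \<le> norm (grad \<phi> x) / sg 1 x ^ 3" using p[of x 2] p[of x 3] by auto
    then have "\<bar>\<phi> x\<bar> / sg 1 x ^ 2 \<le> \<bar>A\<bar>" "norm (grad \<phi> x) / sg 1 x ^ 3 \<le> \<bar>A\<bar>" using A[OF True] by linarith+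
    then show ?thesis using p[of x 2] p[of x 3] by (simp add: divide_le_eq)
  next
    case False
    then show ?thesis using K(3) gz p[of x 2] p[of x 3] by simp
  qed
  then show ?thesis using component_le_norm_cart order_trans by (intro exI[of _ "\<bar>A\<bar>"]) (auto, blast)
qed

section \<open>The operator on Borel representatives\<close>

locale domain =
  fixes \<Omega> :: "(real^3) set" and R :: real
  assumes op: "open \<Omega>" and bd: "bounded \<Omega>" and sub: "\<Omega> \<subseteq> cball 0 R" and R0: "R \<ge> 0"
begin

definition scale :: "nat \<Rightarrow> real" where "scale n = inverse (real (Suc n))"

lemma scale_pos_null: "scale n > 0" "scale \<longlonglongrightarrow> 0"
proof -
  show "scale n > 0" by (simp add: scale_def)
  show "scale \<longlonglongrightarrow> 0" unfolding scale_def[abs_def] by (rule LIMSEQ_inverse_real_of_nat)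
qed

text \<open>Smooth approximations whose restrictions to \<open>\<Omega>\<close> converge pointwise
  to \<open>- B_op \<Omega> F\<close>.\<close>

definition gn :: "(real^3 \<Rightarrow> real^3) \<Rightarrow> nat \<Rightarrow> real^3 \<Rightarrow> real^3" where
  "gn F n = grad (upot (scale n) F)"

lemma gn_cont: "bfield R F \<Longrightarrow> continuous_on UNIV (gn F n)"
  unfolding gn_def by (intro continuous_on_grad smooth_on_upot scale_pos_null)

lemma gn_measurable: "bfield R F \<Longrightarrow> gn F n \<in> borel_measurable borel"
  by (rule borel_measurable_continuous_onI[OF gn_cont])

lemma gn_L2:
  assumes "bfield R F"
  shows "integrable lborel (\<lambda>x. (norm (gn F n x))\<^sup>2)"
    "(\<integral>x. (norm (gn F n x))\<^sup>2 \<partial>lborel) \<le> (\<integral>x. (norm (F x))\<^sup>2 \<partial>lborel)"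
  unfolding gn_def using upot_grad_L2[OF scale_pos_null(1) assms R0] by auto

lemma dfieldD: "dfield \<Omega> R F \<Longrightarrow> bfield R F" "dfield \<Omega> R F \<Longrightarrow> x \<notin> \<Omega> \<Longrightarrow> F x = 0"
  by (auto simp: dfield_def)

lemma gn_tendsto: "dfield \<Omega> R F \<Longrightarrow> (\<lambda>n. indicator \<Omega> x *\<^sub>R gn F n x) \<longlonglongrightarrow> - B_op \<Omega> F x"
  using grad_upot_tendsto_single_layer[OF op bd _ scale_pos_null, of R F x]
  by (auto simp: B_op_def gn_def indicator_def)

lemma Om_measurable [measurable]: "\<Omega> \<in> sets borel" using op by simp

lemma gn_ind_L2:
  assumes F: "bfield R F"
  shows "(\<lambda>x. indicator \<Omega> x *\<^sub>R gn F n x) \<in> borel_measurable lborel"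
    "integrable lborel (\<lambda>x. (norm (indicator \<Omega> x *\<^sub>R gn F n x))\<^sup>2)"
    "(\<integral>x. (norm (indicator \<Omega> x *\<^sub>R gn F n x))\<^sup>2 \<partial>lborel) \<le> (\<integral>x. (norm (F x))\<^sup>2 \<partial>lborel)"
proof -
  note [measurable] = gn_measurable[OF F]
  show m: "(\<lambda>x. indicator \<Omega> x *\<^sub>R gn F n x) \<in> borel_measurable lborel" by measurable
  show i: "integrable lborel (\<lambda>x. (norm (indicator \<Omega> x *\<^sub>R gn F n x))\<^sup>2)"
    by (rule Bochner_Integration.integrable_bound[OF gn_L2(1)[OF F, of n]]) (auto simp: indicator_def)
  have "(\<integral>x. (norm (indicator \<Omega> x *\<^sub>R gn F n x))\<^sup>2 \<partial>lborel) \<le> (\<integral>x. (norm (gn F n x))\<^sup>2 \<partial>lborel)"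
    by (rule integral_mono[OF i gn_L2(1)[OF F]]) (auto simp: indicator_def)
  then show "(\<integral>x. (norm (indicator \<Omega> x *\<^sub>R gn F n x))\<^sup>2 \<partial>lborel) \<le> (\<integral>x. (norm (F x))\<^sup>2 \<partial>lborel)"
    using gn_L2(2)[OF F, of n] by linarith
qed

lemma B_measurable:
  assumes F: "dfield \<Omega> R F"
  shows "B_op \<Omega> F \<in> borel_measurable borel"
proof -
  have "(\<lambda>x. - B_op \<Omega> F x) \<in> borel_measurable borel"
    using borel_measurable_LIMSEQ_metric[OF gn_ind_L2(1)[OF dfieldD(1)[OF F]] gn_tendsto[OF F]] by simp
  then have "(\<lambda>x. - (- B_op \<Omega> F x)) \<in> borel_measurable borel" by measurable
  then show ?thesis by simp
qed

lemma B_L2: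
  assumes F: "dfield \<Omega> R F"
  shows "bfield R (B_op \<Omega> F)"
    "(\<integral>x. (norm (B_op \<Omega> F x))\<^sup>2 \<partial>lborel) \<le> (\<integral>x. (norm (F x))\<^sup>2 \<partial>lborel)"
proof -
  note m[measurable] = B_measurable[OF F]
  note g = gn_ind_L2[OF dfieldD(1)[OF F]]
  have L: "integrable lborel (\<lambda>x. (norm (- B_op \<Omega> F x))\<^sup>2)"
    "(\<integral>x. (norm (- B_op \<Omega> F x))\<^sup>2 \<partial>lborel) \<le> (\<integral>x. (norm (F x))\<^sup>2 \<partial>lborel)"
    by (rule L2_Fatou[OF g(1) _ gn_tendsto[OF F] g(2,3)]; measurable)+
  then show "(\<integral>x. (norm (B_op \<Omega> F x))\<^sup>2 \<partial>lborel) \<le> (\<integral>x. (norm (F x))\<^sup>2 \<partial>lborel)" by simp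
  show "bfield R (B_op \<Omega> F)" unfolding bfield_def
  proof (intro conjI allI impI)
    fix x :: "real^3" assume "R < norm x"
    then have "x \<notin> \<Omega>" using sub by auto
    then show "B_op \<Omega> F x = 0" by (simp add: B_op_def)
  qed (use L m in auto)
qed

text \<open>Pointwise convergence is known only inside \<open>\<Omega>\<close>, so the indicator of
  \<open>\<Omega>\<close> is inserted; it does not change the pairing, since \<open>G\<close>
  vanishes outside.\<close>

lemma B_weak:
  assumes F: "dfield \<Omega> R F" and G: "bfield R G" "\<And>x. x \<notin> \<Omega> \<Longrightarrow> G x = 0"
  shows "(\<lambda>n. ip G (gn F n)) \<longlonglongrightarrow> - ip (B_op \<Omega> F) G"
proof -
  note [measurable] = B_measurable[OF F]
  note g = gn_ind_L2[OF dfieldD(1)[OF F]]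
  have "(\<lambda>n. \<integral>x. (indicator \<Omega> x *\<^sub>R gn F n x) \<bullet> G x \<partial>lborel) \<longlonglongrightarrow> (\<integral>x. (- B_op \<Omega> F x) \<bullet> G x \<partial>lborel)"
    by (rule L2_weak_limit[OF g(1) _ _ gn_tendsto[OF F] g(2,3)])
       (use G bfield_integrable[OF G(1)] in \<open>auto simp: bfield_def\<close>)
  moreover have "(\<integral>x. (indicator \<Omega> x *\<^sub>R gn F n x) \<bullet> G x \<partial>lborel) = ip G (gn F n)" for n
    by (rule Bochner_Integration.integral_cong[OF refl]) (auto simp: indicator_def inner_commute G(2))
  ultimately show ?thesis by simp
qed

text \<open>Against a test function, the softened gradient pairs like the mollified field by
  \<open>energy_identity\<close>. The limit is the pairing of \<open>F\<close> itself with
  \<open>grad \<phi>\<close>, which is 0.\<close>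

lemma B_dfield:
  assumes F: "dfield \<Omega> R F"
  shows "dfield \<Omega> R (B_op \<Omega> F)"
  unfolding dfield_def
proof (intro conjI allI impI B_L2[OF F])
  fix \<phi> assume t: "test_fun \<Omega> \<phi>"
  then have s: "smooth_on UNIV \<phi>" by (simp add: test_fun_def)
  obtain A where A: "A \<ge> 0" "\<And>x. \<bar>\<phi> x\<bar> \<le> A * sg 1 x ^ 2" "\<And>x i. \<bar>grad \<phi> x $ i\<bar> \<le> A * sg 1 x ^ 3"
    using test_fun_decay[OF t] by blast
  obtain K where K: "compact K" "K \<subseteq> \<Omega>" "\<And>x. x \<notin> K \<Longrightarrow> \<phi> x = 0" using t by (auto simp: test_fun_def)
  note gz = grad_eq_0_outside[OF compact_imp_closed[OF K(1)] K(3)]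
  obtain B where "B \<ge> 0" "\<And>x. x \<in> cball 0 R \<Longrightarrow> norm (grad \<phi> x) \<le> B"
    using continuous_bounded_on_compact[OF continuous_on_subset[OF continuous_on_grad[OF s]] compact_cball] by blast
  then have B: "norm (grad \<phi> x) \<le> B" if "norm x \<le> R" for x using that by simp
  have [measurable]: "grad \<phi> \<in> borel_measurable borel" by (rule measurable_grad[OF s])
  have z: "grad \<phi> x = 0" if "x \<notin> \<Omega>" for x by (rule gz) (use K(2) that in auto)
  have bg: "bfield R (grad \<phi>)" unfolding bfield_def
  proof (intro conjI allI impI)
    show gR: "grad \<phi> x = 0" if "R < norm x" for x
    proof (rule z)
      show "x \<notin> \<Omega>" using that sub by auto
    qed
    have "(norm (grad \<phi> x))\<^sup>2 \<le> B\<^sup>2 * indicator (cball 0 R) x" for x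
      using B[of x] gR[of x] by (auto simp: indicator_def power_mono not_le)
    note le = this
    have ci: "integrable lborel (indicat_real (cball (0::real^3) R))"
      by (rule integrable_real_indicator) (use emeasure_lborel_cball_finite[of "0::real^3" R] in auto)
    show "integrable lborel (\<lambda>x. (norm (grad \<phi> x))\<^sup>2)"
      by (rule Bochner_Integration.integrable_bound[where f="\<lambda>x. B\<^sup>2 * indicat_real (cball 0 R) x"])
         (use le ci in \<open>auto intro!: AE_I2 intro: order_trans\<close>)
  qed auto
  note bF = dfieldD(1)[OF F]
  have "(\<lambda>n. ip (grad \<phi>) (gn F n)) \<longlonglongrightarrow> - ip (B_op \<Omega> F) (grad \<phi>)" by (rule B_weak[OF F bg z])
  moreover have "ip (grad \<phi>) (gn F n) = ip (grad \<phi>) (mol (scale n) F)" for n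
    unfolding gn_def by (rule energy_identity(3)[OF scale_pos_null(1) bF R0 s A])
  moreover have "(\<lambda>n. ip (grad \<phi>) (mol (scale n) F)) \<longlonglongrightarrow> ip (grad \<phi>) F"
  proof (rule mol_weak_limit[OF scale_pos_null bF continuous_on_grad[OF s]])
    show "\<bar>grad \<phi> x $ i\<bar> \<le> A" for x i
      using A(3)[of x i] mult_left_mono[OF sg1_power_mono[of 0 3 x] A(1)] by simp
  qed
  moreover have "ip (grad \<phi>) F = 0"
    using F t by (simp add: dfield_def inner_commute)
  ultimately have "- ip (B_op \<Omega> F) (grad \<phi>) = 0" using LIMSEQ_unique by fastforce
  then show "ip (B_op \<Omega> F) (grad \<phi>) = 0" by simp
qed (auto simp: B_op_def)

lemma B_symmetric:
  assumes F: "dfield \<Omega> R F" and G: "dfield \<Omega> R G"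
  shows "ip (B_op \<Omega> F) G = ip F (B_op \<Omega> G)"
proof -
  have "ip G (gn F n) = ip F (gn G n)" for n
    unfolding gn_def by (rule upot_symmetric[OF scale_pos_null(1) dfieldD(1)[OF G] dfieldD(1)[OF F]])
  then have "- ip (B_op \<Omega> F) G = - ip (B_op \<Omega> G) F"
    using LIMSEQ_unique[OF B_weak[OF F dfieldD(1)[OF G] dfieldD(2)[OF G]]] B_weak[OF G dfieldD(1)[OF F] dfieldD(2)[OF F]]
    by simp
  then show ?thesis by (simp add: inner_commute)
qed

text \<open>The Gram entries of softened gradients at two scales equal pairings of one gradient with
  \<open>F\<close> mollified at the other scale. Letting the second scale tend to 0, and then the
  first, produces \<open>- ip (B_op \<Omega> F) F\<close> as the iterated limit of
  \<open>psd_limit_nonneg\<close>.\<close>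

lemma B_nonpos:
  assumes F: "dfield \<Omega> R F"
  shows "ip (B_op \<Omega> F) F \<le> 0"
proof -
  note bF = dfieldD(1)[OF F]
  note [measurable] = gn_measurable[OF bF]
  define b where "b i j = ip (gn F i) (gn F j)" for i j
  have bi: "integrable lborel (\<lambda>x. gn F i x \<bullet> gn F j x)" for i j
    by (rule L2_inner(1)) (use gn_L2[OF bF] in auto)
  have "- ip (B_op \<Omega> F) F \<ge> 0"
  proof (rule psd_limit_nonneg[where b=b and t="\<lambda>i. ip F (gn F i)" and M="\<integral>x. (norm (F x))\<^sup>2 \<partial>lborel"])
    show "b i j = b j i" for i j by (simp add: b_def inner_commute)
    show "b i i \<le> (\<integral>x. (norm (F x))\<^sup>2 \<partial>lborel)" for i
      using gn_L2(2)[OF bF, of i] by (simp add: b_def power2_norm_eq_inner)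
    show "0 \<le> (\<Sum>i\<in>I. \<Sum>j\<in>I. b i j)" for I
    proof -
      have "(\<Sum>i\<in>I. \<Sum>j\<in>I. b i j) = (\<integral>x. (\<Sum>i\<in>I. gn F i x) \<bullet> (\<Sum>j\<in>I. gn F j x) \<partial>lborel)"
        using bi by (simp add: b_def inner_sum_left inner_sum_right Bochner_Integration.integral_sum) (rule sum.swap)
      also have "\<dots> \<ge> 0" by (rule integral_nonneg_AE) auto
      finally show ?thesis .
    qed
    show "(\<lambda>j. b i j) \<longlonglongrightarrow> ip F (gn F i)" for i
    proof -
      obtain A where A: "A \<ge> 0" "\<And>x. \<bar>upot (scale i) F x\<bar> \<le> A * sg 1 x ^ 2" "\<And>x k. \<bar>grad (upot (scale i) F) x $ k\<bar> \<le> A * sg 1 x ^ 3"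
        by (rule upot_decay_uniform[OF scale_pos_null(1) bF R0]) (rule that)
      have "b i j = ip (gn F i) (mol (scale j) F)" for j
        unfolding b_def gn_def by (rule energy_identity(3)[OF scale_pos_null(1) bF R0 smooth_on_upot[OF scale_pos_null(1) bF] A])
      moreover have "(\<lambda>j. ip (gn F i) (mol (scale j) F)) \<longlonglongrightarrow> ip (gn F i) F"
      proof (rule mol_weak_limit[OF scale_pos_null bF gn_cont[OF bF]])
        show "\<bar>gn F i x $ k\<bar> \<le> A" for x k
          using A(3)[of x k] mult_left_mono[OF sg1_power_mono[of 0 3 x] A(1)] by (simp add: gn_def)
      qed
      ultimately show ?thesis by (simp add: inner_commute)
    qed
    show "(\<lambda>i. ip F (gn F i)) \<longlonglongrightarrow> - ip (B_op \<Omega> F) F" by (rule B_weak[OF F bF dfieldD(2)[OF F]])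
  qed
  then show ?thesis by simp
qed

text \<open>The estimate is made for the softened potentials, where interior and exterior energy add
  up to at most the norm squared of \<open>F\<close>, and only the resulting inequality is passed to
  the limit.\<close>

lemma B_lower_bound:
  assumes K: "K > 0"
    and ext: "\<And>F \<phi>. dfield \<Omega> R F \<Longrightarrow> smooth_on UNIV \<phi> \<Longrightarrow> integrable lborel (\<lambda>x. (norm (grad \<phi> x))\<^sup>2) \<Longrightarrow>
      \<bar>ip F (grad \<phi>)\<bar> \<le> K * sqrt (ip F F) * sqrt (\<integral>x. indicator (- \<Omega>) x * (norm (grad \<phi> x))\<^sup>2 \<partial>lborel)"
    and F: "dfield \<Omega> R F"
  shows "- ip (B_op \<Omega> F) F \<le> sqrt (K\<^sup>2 / (1 + K\<^sup>2)) * ip F F"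
proof -
  note bF = dfieldD(1)[OF F]
  note [measurable] = gn_measurable[OF bF]
  have [measurable]: "F \<in> borel_measurable borel" and iF: "integrable lborel (\<lambda>x. (norm (F x))\<^sup>2)"
    using bF by (auto simp: bfield_def)
  have FF: "(\<integral>x. (norm (F x))\<^sup>2 \<partial>lborel) = ip F F" "ip F F \<ge> 0" by (auto simp: power2_norm_eq_inner intro: integral_nonneg_AE)
  have "ip F (gn F n) \<le> sqrt (K\<^sup>2 / (1 + K\<^sup>2)) * ip F F" for n
  proof -
    define a where "a = (\<integral>x. (norm (indicator \<Omega> x *\<^sub>R gn F n x))\<^sup>2 \<partial>lborel)"
    define b where "b = (\<integral>x. indicator (- \<Omega>) x * (norm (gn F n x))\<^sup>2 \<partial>lborel)"
    have ib: "integrable lborel (\<lambda>x. indicator (- \<Omega>) x * (norm (gn F n x))\<^sup>2)"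
      by (rule Bochner_Integration.integrable_bound[OF gn_L2(1)[OF bF, of n]]) (auto simp: indicator_def)
    have a0: "a \<ge> 0" "b \<ge> 0" by (auto simp: a_def b_def)
    have "a + b = (\<integral>x. (norm (indicator \<Omega> x *\<^sub>R gn F n x))\<^sup>2 + indicator (- \<Omega>) x * (norm (gn F n x))\<^sup>2 \<partial>lborel)"
      unfolding a_def b_def using gn_ind_L2(2)[OF bF] ib by simp
    also have "\<dots> = (\<integral>x. (norm (gn F n x))\<^sup>2 \<partial>lborel)"
      by (rule Bochner_Integration.integral_cong) (auto simp: indicator_def)
    finally have ab: "a + b \<le> ip F F" using gn_L2(2)[OF bF, of n] FF by simp
    define t where "t = ip F (gn F n)"
    have "t = (\<integral>x. F x \<bullet> (indicator \<Omega> x *\<^sub>R gn F n x) \<partial>lborel)"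
      unfolding t_def by (rule Bochner_Integration.integral_cong[OF refl]) (auto simp: indicator_def dfieldD(2)[OF F])
    also have "\<bar>\<dots>\<bar> \<le> sqrt (\<integral>x. (norm (F x))\<^sup>2 \<partial>lborel) * sqrt a"
      unfolding a_def by (rule L2_inner(4)) (use iF gn_ind_L2(2)[OF bF] in auto)
    finally have "t\<^sup>2 \<le> (sqrt (ip F F) * sqrt a)\<^sup>2" unfolding FF
      using abs_le_square_iff[of t "sqrt (ip F F) * sqrt a"] a0 FF by simp
    then have 1: "t\<^sup>2 \<le> ip F F * a" using a0 FF by (simp add: power_mult_distrib)
    have "\<bar>t\<bar> \<le> K * sqrt (ip F F) * sqrt b"
      unfolding t_def b_def gn_def
      by (rule ext[OF F smooth_on_upot[OF scale_pos_null(1) bF]]) (use gn_L2(1)[OF bF, of n] in \<open>simp add: gn_def\<close>)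
    then have "t\<^sup>2 \<le> (K * sqrt (ip F F) * sqrt b)\<^sup>2"
      using abs_le_square_iff[of t "K * sqrt (ip F F) * sqrt b"] a0 FF K by simp
    then have 2: "t\<^sup>2 \<le> K\<^sup>2 * (ip F F * b)" using a0 FF by (simp add: power_mult_distrib)
    \<comment> \<open>The exterior bound plus \<open>K^2\<close> times the interior bound: with
      these weights the two energies appear only as the sum \<open>a + b\<close>.\<close>
    have "t\<^sup>2 * (1 + K\<^sup>2) = t\<^sup>2 + K\<^sup>2 * t\<^sup>2" by (simp add: algebra_simps)
    also have "\<dots> \<le> K\<^sup>2 * (ip F F * b) + K\<^sup>2 * (ip F F * a)"
      using 1 2 by (intro add_mono mult_left_mono) auto
    also have "\<dots> = K\<^sup>2 * (ip F F * (a + b))" by (simp add: algebra_simps)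
    also have "\<dots> \<le> K\<^sup>2 * (ip F F * ip F F)" using ab FF by (intro mult_left_mono) auto
    finally have "t\<^sup>2 \<le> K\<^sup>2 / (1 + K\<^sup>2) * (ip F F)\<^sup>2"
      using K by (simp add: field_simps power2_eq_square add_pos_pos)
    also have "\<dots> = (sqrt (K\<^sup>2 / (1 + K\<^sup>2)) * ip F F)\<^sup>2"
    proof -
      have "(sqrt (K\<^sup>2 / (1 + K\<^sup>2)))\<^sup>2 = K\<^sup>2 / (1 + K\<^sup>2)" by (rule real_sqrt_pow2) simp
      then show ?thesis by (simp only: power_mult_distrib)
    qed
    finally have "t \<le> sqrt (K\<^sup>2 / (1 + K\<^sup>2)) * ip F F"
      by (rule power2_le_imp_le) (rule mult_nonneg_nonneg[OF real_sqrt_ge_zero FF(2)], simp)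
    then show ?thesis by (simp only: t_def)
  qed
  then show ?thesis
    using LIMSEQ_le_const2[OF B_weak[OF F bF dfieldD(2)[OF F]]] by blast
qed

end

subsection \<open>The boundary from outside\<close>

text \<open>The defining function is divided by the length of its gradient at \<open>p\<close> and
  cut off to become globally smooth. Near \<open>p\<close> it is then a function of slope almost 1
  along the outward normal \<open>n\<close>; the tolerance \<open>1 / 10\<close> leaves room for all
  later geometric estimates.\<close>

lemma boundary_chart:
  assumes \<Omega>: "open \<Omega>" "smooth_boundary \<Omega>" and p: "p \<in> frontier \<Omega>"
  obtains r m n where "r > 0" "smooth_on UNIV m" "norm n = 1"
    "\<And>x y. x \<in> ball p r \<Longrightarrow> y \<in> ball p r \<Longrightarrow> \<bar>m y - m x - n \<bullet> (y - x)\<bar> \<le> norm (y - x) / 10"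
    "\<And>x. x \<in> ball p r \<Longrightarrow> norm (grad m x - n) \<le> 1 / 10"
    "\<And>x. x \<in> ball p r \<Longrightarrow> x \<in> \<Omega> \<longleftrightarrow> m x < 0"
    "\<And>x. x \<in> ball p r \<Longrightarrow> x \<in> frontier \<Omega> \<Longrightarrow> m x = 0"
proof -
  obtain U \<rho> where U: "open U" "p \<in> U" "smooth_on U \<rho>" "\<forall>x\<in>U. grad \<rho> x \<noteq> 0" "\<Omega> \<inter> U = {x\<in>U. \<rho> x < 0}"
    using \<Omega>(2) p unfolding smooth_boundary_def by blast
  obtain e where e: "e > 0" "cball p e \<subseteq> U" using U(1,2) open_contains_cball by blast
  obtain \<kappa> where \<kappa>: "smooth_on UNIV \<kappa>" "\<And>x. dist p x \<le> e / 3 \<Longrightarrow> \<kappa> x = 1" "\<And>x. dist p x \<ge> 2 * e / 3 \<Longrightarrow> \<kappa> x = 0"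
    by (rule smooth_cutoff[of "e / 3" "2 * e / 3" p]) (use e in auto)
  define a where "a = norm (grad \<rho> p)"
  have a: "a > 0" using U by (simp add: a_def)
  define m where "m x = \<kappa> x * (\<rho> x * (1 / a))" for x
  define n where "n = (1 / a) *\<^sub>R grad \<rho> p"
  have n: "norm n = 1" using a by (simp add: n_def a_def)
  have sm: "smooth_on UNIV m"
  proof (rule smooth_on_zero_extension[of U "cball p (2 * e / 3)"])
    show "cball p (2 * e / 3) \<subseteq> U" using e by (auto intro: order_trans)
    show "smooth_on U m" unfolding m_def
      by (intro smooth_on_mult smooth_on_const U smooth_on_subset[OF \<kappa>(1)]) auto
    show "m x = 0" if "x \<notin> cball p (2 * e / 3)" for x using that by (simp add: m_def \<kappa>(3))
  qed (use U in auto)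
  have m: "m x = \<rho> x * (1 / a)" if "x \<in> ball p (e / 3)" for x using that \<kappa>(2)[of x] by (simp add: m_def)
  have pb: "p \<in> ball p (e / 3)" using e by simp
  have gp: "grad m p = n"
  proof (rule grad_eqI)
    have "((\<lambda>x. \<rho> x * (1 / a)) has_derivative (\<lambda>v. (grad \<rho> p \<bullet> v) * (1 / a))) (at p)"
      by (intro has_derivative_mult_left has_derivative_grad[OF U(3,2)])
    then show "(m has_derivative (\<lambda>v. (grad \<rho> p \<bullet> v) * (1 / a))) (at p)"
      by (rule has_derivative_transform_within_open[OF _ open_ball pb]) (simp add: m)
  qed (simp add: n_def)
  have "isCont (grad m) p" using continuous_on_grad[OF sm] by (simp add: continuous_on_eq_continuous_at)
  then obtain \<delta> where \<delta>: "\<delta> > 0" "\<And>x. dist x p < \<delta> \<Longrightarrow> dist (grad m x) (grad m p) < 1 / 10"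
    unfolding continuous_at_eps_delta by (metis zero_less_divide_1_iff zero_less_numeral)
  define r where "r = min (e / 3) \<delta>"
  have r: "r > 0" "ball p r \<subseteq> ball p (e / 3)" using e \<delta> by (auto simp: r_def)
  have g: "norm (grad m x - n) \<le> 1 / 10" if "x \<in> ball p r" for x
  proof -
    have "dist (grad m x) n < 1 / 10" using \<delta>(2)[of x] that by (simp add: gp r_def dist_commute[of x p])
    then show ?thesis by (simp add: dist_norm)
  qed
  have l: "\<bar>m y - m x - n \<bullet> (y - x)\<bar> \<le> norm (y - x) / 10" if "x \<in> ball p r" "y \<in> ball p r" for x y
  proof -
    have "norm ((m y - n \<bullet> y) - (m x - n \<bullet> x)) \<le> 1 / 10 * norm (y - x)"
    proof (rule differentiable_bound[where S="ball p r" and f'="\<lambda>x v. grad m x \<bullet> v - n \<bullet> v"])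
      show "((\<lambda>x. m x - n \<bullet> x) has_derivative (\<lambda>v. grad m z \<bullet> v - n \<bullet> v)) (at z within ball p r)" for z
        by (intro has_derivative_diff has_derivative_at_withinI[OF has_derivative_grad[OF sm]])
           (auto intro!: derivative_eq_intros)
      show "onorm (\<lambda>v. grad m z \<bullet> v - n \<bullet> v) \<le> 1 / 10" if "z \<in> ball p r" for z
      proof (rule onorm_le)
        fix v
        have "norm (grad m z \<bullet> v - n \<bullet> v) = \<bar>(grad m z - n) \<bullet> v\<bar>" by (simp add: inner_diff_left)
        also have "\<dots> \<le> norm (grad m z - n) * norm v" by (rule Cauchy_Schwarz_ineq2)
        also have "\<dots> \<le> 1 / 10 * norm v" using g[OF that] by (intro mult_right_mono) auto
        finally show "norm (grad m z \<bullet> v - n \<bullet> v) \<le> 1 / 10 * norm v" .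
      qed
    qed (use that in auto)
    then show ?thesis by (simp add: inner_diff_right algebra_simps)
  qed
  have O: "x \<in> \<Omega> \<longleftrightarrow> m x < 0" if "x \<in> ball p r" for x
  proof -
    have x: "x \<in> ball p (e / 3)" using that r by auto
    then have "x \<in> cball p e" using e by auto
    then have "x \<in> U" using e by blast
    then have "x \<in> \<Omega> \<longleftrightarrow> \<rho> x < 0" using U(5) by blast
    then show ?thesis using a m[OF x] by (simp add: divide_less_0_iff)
  qed
  have fr: "m x = 0" if x: "x \<in> ball p r" "x \<in> frontier \<Omega>" for x
  proof (rule ccontr)
    assume "m x \<noteq> 0"
    have "x \<notin> \<Omega>" using x \<Omega>(1) by (auto simp: frontier_def interior_open)
    then have "m x > 0" using O[OF x(1)] \<open>m x \<noteq> 0\<close> by auto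
    have "open (ball p r \<inter> {y. 0 < m y})"
      by (intro open_Int open_ball open_Collect_less continuous_intros smooth_on_continuous_on[OF sm])
    moreover have "x \<in> closure \<Omega>" using x by (simp add: frontier_def)
    ultimately have "ball p r \<inter> {y. 0 < m y} \<inter> \<Omega> \<noteq> {}"
      using open_Int_closure_eq_empty[of "ball p r \<inter> {y. 0 < m y}" \<Omega>] x(1) \<open>m x > 0\<close> by auto
    then show False using O by force
  qed
  show ?thesis using that[OF r(1) sm n l g O fr] .
qed

text \<open>A segment from an exterior point near \<open>p\<close> to the ball around
  \<open>p + 10 s n\<close> has normal component at least \<open>8 s\<close> and length at most
  \<open>12 s\<close>. The chart error is a tenth of the length, so \<open>m\<close> does not drop
  below its starting value and the segment stays outside. Radius \<open>r0 / 20\<close> keeps it,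
  within \<open>13 s\<close> of \<open>p\<close>, inside the chart.\<close>

lemma boundary_starshaped:
  assumes \<Omega>: "open \<Omega>" "smooth_boundary \<Omega>" and p: "p \<in> frontier \<Omega>"
  obtains r n where "r > 0" "norm n = 1"
    "\<And>s x z t. 0 < s \<Longrightarrow> s \<le> r \<Longrightarrow> x \<in> ball p s \<Longrightarrow> x \<notin> \<Omega> \<Longrightarrow> z \<in> ball (p + (10 * s) *\<^sub>R n) s \<Longrightarrow> 0 \<le> t \<Longrightarrow> t \<le> 1 \<Longrightarrow>
       x + t *\<^sub>R (z - x) \<notin> \<Omega>"
proof -
  obtain r0 m n where c: "r0 > 0" "smooth_on UNIV m" "norm n = 1"
    "\<And>x y. x \<in> ball p r0 \<Longrightarrow> y \<in> ball p r0 \<Longrightarrow> \<bar>m y - m x - n \<bullet> (y - x)\<bar> \<le> norm (y - x) / 10"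
    "\<And>x. x \<in> ball p r0 \<Longrightarrow> norm (grad m x - n) \<le> 1 / 10"
    "\<And>x. x \<in> ball p r0 \<Longrightarrow> x \<in> \<Omega> \<longleftrightarrow> m x < 0"
    "\<And>x. x \<in> ball p r0 \<Longrightarrow> x \<in> frontier \<Omega> \<Longrightarrow> m x = 0"
    using boundary_chart[OF assms] by metis
  show ?thesis
  proof (rule that[of "r0 / 20" n])
    fix s x z and t :: real
    assume s: "0 < s" "s \<le> r0 / 20" and x: "x \<in> ball p s" "x \<notin> \<Omega>" and z: "z \<in> ball (p + (10 * s) *\<^sub>R n) s"
      and t: "0 \<le> t" "t \<le> 1"
    define w where "w = z - x - (10 * s) *\<^sub>R n"
    have w: "norm w < 2 * s"
    proof -
      have "w = (p - x) - (p + (10 * s) *\<^sub>R n - z)" by (simp add: w_def)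
      then have "norm w \<le> norm (p - x) + norm (p + (10 * s) *\<^sub>R n - z)" by (metis norm_triangle_ineq4)
      then show ?thesis using x z by (simp add: dist_norm)
    qed
    have zx: "z - x = (10 * s) *\<^sub>R n + w" by (simp add: w_def)
    have nzx: "norm (z - x) \<le> 12 * s"
      unfolding zx using norm_triangle_ineq[of "(10 * s) *\<^sub>R n" w] w s c(3) by simp
    have xb: "x \<in> ball p r0" using x s by simp
    have yb: "x + t *\<^sub>R (z - x) \<in> ball p r0"
    proof -
      have "dist p (x + t *\<^sub>R (z - x)) \<le> dist p x + norm (t *\<^sub>R (z - x))"
        by (metis add_diff_cancel_left' dist_norm dist_triangle norm_minus_commute)
      also have "norm (t *\<^sub>R (z - x)) \<le> 1 * (12 * s)"
        unfolding norm_scaleR using t nzx by (intro mult_mono) auto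
      finally show ?thesis using x s by simp
    qed
    have "\<bar>m (x + t *\<^sub>R (z - x)) - m x - n \<bullet> (t *\<^sub>R (z - x))\<bar> \<le> norm (t *\<^sub>R (z - x)) / 10"
      using c(4)[OF xb yb] by simp
    also have "\<dots> \<le> t * (12 * s) / 10" using mult_left_mono[OF nzx t(1)] t by (simp add: mult_ac)
    finally have 1: "m (x + t *\<^sub>R (z - x)) \<ge> m x + n \<bullet> (t *\<^sub>R (z - x)) - t * (12 * s) / 10" by linarith
    have "n \<bullet> (z - x) \<ge> 8 * s"
    proof -
      have "n \<bullet> (z - x) = 10 * s + n \<bullet> w"
        using c(3) by (simp add: zx inner_add_right power2_norm_eq_inner[symmetric])
      moreover have "\<bar>n \<bullet> w\<bar> \<le> 2 * s" using Cauchy_Schwarz_ineq2[of n w] c(3) w by simp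
      ultimately show ?thesis by linarith
    qed
    then have "t * (n \<bullet> (z - x)) \<ge> t * (8 * s)" using t by (intro mult_left_mono)
    moreover have "m x \<ge> 0" using c(6)[OF xb] x by simp
    moreover have "t * s \<ge> 0" using t s by simp
    moreover have "t * (8 * s) = 8 * (t * s)" "t * (12 * s) = 12 * (t * s)" "n \<bullet> (t *\<^sub>R (z - x)) = t * (n \<bullet> (z - x))" by simp_all
    ultimately have "m (x + t *\<^sub>R (z - x)) \<ge> 0" using 1 by linarith
    then show "x + t *\<^sub>R (z - x) \<notin> \<Omega>" using c(6)[OF yb] by simp
  qed (use c in auto)
qed

text \<open>The endpoints of the segments from \<open>p\<close> itself fill such a ball. It provides
  an overlap of positive measure when Poincare inequalities are glued.\<close>

lemma boundary_exterior_ball: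
  assumes \<Omega>: "open \<Omega>" "smooth_boundary \<Omega>" and p: "p \<in> frontier \<Omega>" and W: "open W" "p \<in> W"
  obtains q s where "s > 0" "ball q s \<subseteq> W - \<Omega>"
proof -
  obtain r n where c: "r > 0" "norm n = 1"
    "\<And>s x z t. 0 < s \<Longrightarrow> s \<le> r \<Longrightarrow> x \<in> ball p s \<Longrightarrow> x \<notin> \<Omega> \<Longrightarrow> z \<in> ball (p + (10 * s) *\<^sub>R n) s \<Longrightarrow> 0 \<le> t \<Longrightarrow> t \<le> 1 \<Longrightarrow>
       x + t *\<^sub>R (z - x) \<notin> \<Omega>" using boundary_starshaped[OF \<Omega> p] by metis
  obtain e where e: "e > 0" "ball p e \<subseteq> W" using W openE by blast
  define s where "s = min r (e / 11)"
  have s: "s > 0" "s \<le> r" "11 * s \<le> e" using c e by (auto simp: s_def)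
  have po: "p \<notin> \<Omega>" using p \<Omega>(1) by (auto simp: frontier_def interior_open)
  have "ball (p + (10 * s) *\<^sub>R n) s \<subseteq> W - \<Omega>"
  proof
    fix z assume z: "z \<in> ball (p + (10 * s) *\<^sub>R n) s"
    have "z \<notin> \<Omega>" using c(3)[OF s(1,2) _ po z, of 1] s by simp
    moreover have "dist p z < 11 * s"
    proof -
      have "dist p z \<le> dist p (p + (10 * s) *\<^sub>R n) + dist (p + (10 * s) *\<^sub>R n) z" by (rule dist_triangle)
      then show ?thesis using z c(2) s by (simp add: dist_norm)
    qed
    ultimately show "z \<in> W - \<Omega>" using e s by auto
  qed
  then show ?thesis using that s by blast
qed

section \<open>Averaging over segments in star-shaped exterior pieces\<close>

lemma segment_energy:
  assumes f: "smooth_on UNIV f"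
  shows "ennreal ((f z - f x)\<^sup>2) \<le> ennreal ((norm (z - x))\<^sup>2) * (\<integral>\<^sup>+t. indicator {0..1} t * ennreal ((norm (grad f (x + t *\<^sub>R (z - x))))\<^sup>2) \<partial>lborel)"
proof -
  define g where "g t = grad f (x + t *\<^sub>R (z - x)) \<bullet> (z - x)" for t
  have cg: "continuous_on UNIV (\<lambda>t. grad f (x + t *\<^sub>R (z - x)))"
    by (rule continuous_on_compose2[OF continuous_on_grad[OF f]]) (auto intro!: continuous_intros)
  have cg': "continuous_on UNIV g" unfolding g_def by (intro continuous_intros cg)
  have [measurable]: "(\<lambda>t. grad f (x + t *\<^sub>R (z - x))) \<in> borel_measurable borel" "g \<in> borel_measurable borel"
    using cg cg' borel_measurable_continuous_onI by auto
  have d: "((\<lambda>t. f (x + t *\<^sub>R (z - x))) has_vector_derivative g t) (at t within {0..1})" for t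
  proof -
    have "((\<lambda>t. f (x + t *\<^sub>R (z - x))) has_derivative (\<lambda>h. grad f (x + t *\<^sub>R (z - x)) \<bullet> (h *\<^sub>R (z - x)))) (at t)"
      by (rule has_derivative_compose[OF _ has_derivative_grad[OF f UNIV_I]]) (auto intro!: derivative_eq_intros)
    then have "((\<lambda>t. f (x + t *\<^sub>R (z - x))) has_derivative (\<lambda>h. h *\<^sub>R g t)) (at t)" by (simp add: g_def)
    then show ?thesis unfolding has_vector_derivative_def by (rule has_derivative_at_withinI)
  qed
  have I: "(\<integral>t. indicator {0..1} t *\<^sub>R g t \<partial>lborel) = f z - f x"
    using integral_FTC_Icc[of 0 1 "\<lambda>t. f (x + t *\<^sub>R (z - x))" g, OF _ d continuous_on_subset[OF cg']]
    by simp
  have i0: "integrable lborel (\<lambda>t::real. indicat_real {0..1} t)"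
    by (rule integrable_real_indicator) auto
  have ii: "integrable lborel (\<lambda>t. indicator {0..1} t *\<^sub>R h t)" if "continuous_on UNIV h" for h :: "real \<Rightarrow> real"
    by (rule borel_integrable_compact[unfolded set_integrable_def]) (use that continuous_on_subset in auto)
  have i2: "integrable lborel (\<lambda>t. indicator {0..1} t *\<^sub>R (g t)\<^sup>2)" by (intro ii continuous_intros cg')
  have i3: "integrable lborel (\<lambda>t. indicator {0..1} t *\<^sub>R (norm (grad f (x + t *\<^sub>R (z - x))))\<^sup>2)" by (intro ii continuous_intros cg)
  have e1: "(norm (indicat_real {0..1} t *\<^sub>R g t))\<^sup>2 = indicator {0..1} t *\<^sub>R (g t)\<^sup>2" for t by (auto simp: indicator_def)
  have e0: "(norm (indicat_real {0..1} t))\<^sup>2 = indicator {0..1} t" for t :: real by (auto simp: indicator_def)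
  have "\<bar>\<integral>t. indicat_real {0..1} t \<bullet> (indicator {0..1} t *\<^sub>R g t) \<partial>lborel\<bar>
      \<le> sqrt (\<integral>t. (norm (indicat_real {0..1::real} t))\<^sup>2 \<partial>lborel) * sqrt (\<integral>t. (norm (indicat_real {0..1} t *\<^sub>R g t))\<^sup>2 \<partial>lborel)"
    by (rule L2_inner(4)[where f="indicat_real {0..1}" and g="\<lambda>t. indicat_real {0..1} t *\<^sub>R g t"]) (use i0 i2 e0 e1 in auto)
  moreover have "(\<integral>t. indicat_real {0..1} t \<bullet> (indicator {0..1} t *\<^sub>R g t) \<partial>lborel) = f z - f x"
    unfolding I[symmetric] by (rule Bochner_Integration.integral_cong) (auto simp: indicator_def)
  ultimately have "\<bar>f z - f x\<bar> \<le> sqrt (\<integral>t. indicator {0..1} t *\<^sub>R (g t)\<^sup>2 \<partial>lborel)"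
    unfolding e0 e1 by simp
  then have "(f z - f x)\<^sup>2 \<le> (\<integral>t. indicator {0..1} t *\<^sub>R (g t)\<^sup>2 \<partial>lborel)"
    using sqrt_ge_absD by blast
  also have "\<dots> \<le> (\<integral>t. (norm (z - x))\<^sup>2 * (indicator {0..1} t *\<^sub>R (norm (grad f (x + t *\<^sub>R (z - x))))\<^sup>2) \<partial>lborel)"
  proof (rule integral_mono[OF i2])
    fix t
    have "\<bar>g t\<bar> \<le> norm (grad f (x + t *\<^sub>R (z - x))) * norm (z - x)" unfolding g_def by (rule Cauchy_Schwarz_ineq2)
    then have "(g t)\<^sup>2 \<le> (norm (grad f (x + t *\<^sub>R (z - x))) * norm (z - x))\<^sup>2" by (rule abs_le_square_iff[THEN iffD1, OF order_trans]) simp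
    then show "indicator {0..1} t *\<^sub>R (g t)\<^sup>2 \<le> (norm (z - x))\<^sup>2 * (indicator {0..1} t *\<^sub>R (norm (grad f (x + t *\<^sub>R (z - x))))\<^sup>2)"
      by (auto simp: indicator_def power_mult_distrib mult.commute)
  qed (use i3 in auto)
  finally have "ennreal ((f z - f x)\<^sup>2) \<le> ennreal (\<integral>t. (norm (z - x))\<^sup>2 * (indicator {0..1} t *\<^sub>R (norm (grad f (x + t *\<^sub>R (z - x))))\<^sup>2) \<partial>lborel)"
    by (rule ennreal_leI)
  also have "\<dots> = (\<integral>\<^sup>+t. ennreal ((norm (z - x))\<^sup>2 * (indicator {0..1} t *\<^sub>R (norm (grad f (x + t *\<^sub>R (z - x))))\<^sup>2)) \<partial>lborel)"
    using i3 by (intro nn_integral_eq_integral[symmetric]) (auto simp: indicator_def)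
  also have "\<dots> = (\<integral>\<^sup>+t. ennreal ((norm (z - x))\<^sup>2) * (indicator {0..1} t * ennreal ((norm (grad f (x + t *\<^sub>R (z - x))))\<^sup>2)) \<partial>lborel)"
    by (intro nn_integral_cong) (auto simp: indicator_def ennreal_mult)
  also have "\<dots> = ennreal ((norm (z - x))\<^sup>2) * (\<integral>\<^sup>+t. indicator {0..1} t * ennreal ((norm (grad f (x + t *\<^sub>R (z - x))))\<^sup>2) \<partial>lborel)"
    by (rule nn_integral_cmult) measurable
  finally show ?thesis .
qed

lemma nn_integral_affine_le:
  fixes e :: "real^3 \<Rightarrow> ennreal"
  assumes [measurable]: "e \<in> borel_measurable borel" and c: "c \<ge> 1 / 2"
  shows "(\<integral>\<^sup>+x. e (b + c *\<^sub>R x) \<partial>lborel) \<le> 8 * (\<integral>\<^sup>+x. e x \<partial>lborel)"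
proof -
  have "1 \<le> 8 * c ^ 3"
    using power_mono[OF c, of 3] by (simp add: power3_eq_cube)
  then have "ennreal 1 \<le> ennreal (8 * c ^ 3)" by (rule ennreal_leI)
  also have "\<dots> = 8 * ennreal (c ^ 3)" using c by (simp add: ennreal_mult')
  finally have "1 * (\<integral>\<^sup>+x. e (b + c *\<^sub>R x) \<partial>lborel) \<le> 8 * ennreal (c ^ 3) * (\<integral>\<^sup>+x. e (b + c *\<^sub>R x) \<partial>lborel)"
    by (intro mult_right_mono) auto
  also have "\<dots> = 8 * (\<integral>\<^sup>+x. e x \<partial>lborel)"
    using nn_integral_lborel_affine[of e c b] c by (simp add: mult.assoc)
  finally show ?thesis by simp
qed

text \<open>For \<open>t \<le> 1/2\<close> the map \<open>x \<mapsto> x + t (z - x)\<close> has Jacobian at least \<open>1/8\<close>, for \<open>t \<ge> 1/2\<close> the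
  map \<open>z \<mapsto> x + t (z - x)\<close> does.\<close>

lemma starshaped_poincare:
  fixes D Z :: "(real^3) set"
  assumes [measurable]: "D \<in> sets borel" "Z \<in> sets borel" "\<Omega> \<in> sets borel"
    and star: "\<And>x z t. x \<in> D \<Longrightarrow> z \<in> Z \<Longrightarrow> 0 \<le> t \<Longrightarrow> t \<le> 1 \<Longrightarrow> x + t *\<^sub>R (z - x) \<notin> \<Omega>"
    and L: "\<And>x z. x \<in> D \<Longrightarrow> z \<in> Z \<Longrightarrow> norm (z - x) \<le> L"
    and f: "smooth_on UNIV f"
  shows "(\<integral>\<^sup>+z. \<integral>\<^sup>+x. indicator Z z * (indicator D x * ennreal ((f z - f x)\<^sup>2)) \<partial>lborel \<partial>lborel)
     \<le> ennreal (L\<^sup>2) * (8 * (emeasure lborel D + emeasure lborel Z) * (\<integral>\<^sup>+y. indicator (- \<Omega>) y * ennreal ((norm (grad f y))\<^sup>2) \<partial>lborel))"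
proof -
  have [measurable]: "grad f \<in> borel_measurable borel" by (rule measurable_grad[OF f])
  have [measurable]: "f \<in> borel_measurable borel"
    using smooth_on_continuous_on[OF f] by (rule borel_measurable_continuous_onI)
  define e where "e y = indicator (- \<Omega>) y * ennreal ((norm (grad f y))\<^sup>2)" for y
  have [measurable]: "e \<in> borel_measurable borel" unfolding e_def[abs_def] by measurable
  define E where "E = (\<integral>\<^sup>+y. e y \<partial>lborel)"
  define k where "k z x t = indicator Z z * (indicator D x * (indicator {0..1::real} t * e (x + t *\<^sub>R (z - x))))" for z x t
  have pt: "indicator Z z * (indicator D x * ennreal ((f z - f x)\<^sup>2)) \<le> ennreal (L\<^sup>2) * (\<integral>\<^sup>+t. k z x t \<partial>lborel)" for z x
  proof (cases "z \<in> Z \<and> x \<in> D")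
    case True
    have "ennreal ((f z - f x)\<^sup>2) \<le> ennreal ((norm (z - x))\<^sup>2) * (\<integral>\<^sup>+t. indicator {0..1} t * ennreal ((norm (grad f (x + t *\<^sub>R (z - x))))\<^sup>2) \<partial>lborel)"
      by (rule segment_energy[OF f])
    also have "(\<integral>\<^sup>+t. indicator {0..1} t * ennreal ((norm (grad f (x + t *\<^sub>R (z - x))))\<^sup>2) \<partial>lborel) = (\<integral>\<^sup>+t. k z x t \<partial>lborel)"
      using True star by (intro nn_integral_cong) (auto simp: k_def e_def indicator_def)
    also have "ennreal ((norm (z - x))\<^sup>2) * (\<integral>\<^sup>+t. k z x t \<partial>lborel) \<le> ennreal (L\<^sup>2) * (\<integral>\<^sup>+t. k z x t \<partial>lborel)"
      using True L by (intro mult_right_mono ennreal_leI power_mono) auto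
    finally show ?thesis using True by simp
  qed auto
  have km [measurable]: "(\<lambda>(z, x, t). k z x t) \<in> borel_measurable (lborel \<Otimes>\<^sub>M (lborel \<Otimes>\<^sub>M lborel))"
    unfolding k_def by measurable
  have J: "(\<integral>\<^sup>+z. \<integral>\<^sup>+x. k z x t \<partial>lborel \<partial>lborel) \<le> indicator {0..1} t * (8 * (emeasure lborel D + emeasure lborel Z) * E)" for t
  proof (cases "0 \<le> t \<and> t \<le> 1")
    case False
    then show ?thesis by (auto simp: k_def)
  next
    case t: True
    show ?thesis
    proof (cases "t \<le> 1 / 2")
      case True
      have "(\<integral>\<^sup>+z. \<integral>\<^sup>+x. k z x t \<partial>lborel \<partial>lborel) \<le> (\<integral>\<^sup>+z. (8 * E) * indicator Z z \<partial>lborel)"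
      proof (rule nn_integral_mono)
        fix z
        have "(\<integral>\<^sup>+x. k z x t \<partial>lborel) \<le> (\<integral>\<^sup>+x. indicator Z z * e (t *\<^sub>R z + (1 - t) *\<^sub>R x) \<partial>lborel)"
          using t by (intro nn_integral_mono) (auto simp: k_def indicator_def algebra_simps)
        also have "\<dots> = indicator Z z * (\<integral>\<^sup>+x. e (t *\<^sub>R z + (1 - t) *\<^sub>R x) \<partial>lborel)"
          by (rule nn_integral_cmult) measurable
        also have "\<dots> \<le> indicator Z z * (8 * E)" unfolding E_def
          using True by (intro mult_left_mono nn_integral_affine_le) auto
        finally show "(\<integral>\<^sup>+x. k z x t \<partial>lborel) \<le> (8 * E) * indicator Z z" by (simp add: mult.commute)
      qed
      also have "\<dots> = 8 * E * emeasure lborel Z" by (rule nn_integral_cmult_indicator) simp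
      also have "\<dots> \<le> 8 * (emeasure lborel D + emeasure lborel Z) * E"
        by (simp add: distrib_left distrib_right mult_ac)
      finally show ?thesis using t by simp
    next
      case False
      have "(\<integral>\<^sup>+z. \<integral>\<^sup>+x. k z x t \<partial>lborel \<partial>lborel) = (\<integral>\<^sup>+x. \<integral>\<^sup>+z. k z x t \<partial>lborel \<partial>lborel)"
        unfolding k_def by (rule lborel_pair.Fubini') measurable
      also have "\<dots> \<le> (\<integral>\<^sup>+x. (8 * E) * indicator D x \<partial>lborel)"
      proof (rule nn_integral_mono)
        fix x
        have "(\<integral>\<^sup>+z. k z x t \<partial>lborel) \<le> (\<integral>\<^sup>+z. indicator D x * e ((1 - t) *\<^sub>R x + t *\<^sub>R z) \<partial>lborel)"
          using t by (intro nn_integral_mono) (auto simp: k_def indicator_def algebra_simps)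
        also have "\<dots> = indicator D x * (\<integral>\<^sup>+z. e ((1 - t) *\<^sub>R x + t *\<^sub>R z) \<partial>lborel)"
          by (rule nn_integral_cmult) measurable
        also have "\<dots> \<le> indicator D x * (8 * E)" unfolding E_def
          using False by (intro mult_left_mono nn_integral_affine_le) auto
        finally show "(\<integral>\<^sup>+z. k z x t \<partial>lborel) \<le> (8 * E) * indicator D x" by (simp add: mult.commute)
      qed
      also have "\<dots> = 8 * E * emeasure lborel D" by (rule nn_integral_cmult_indicator) simp
      also have "\<dots> \<le> 8 * (emeasure lborel D + emeasure lborel Z) * E"
        by (simp add: distrib_left distrib_right mult_ac)
      finally show ?thesis using t by simp
    qed
  qed
  have sw: "(\<integral>\<^sup>+x. \<integral>\<^sup>+t. k z x t \<partial>lborel \<partial>lborel) = (\<integral>\<^sup>+t. \<integral>\<^sup>+x. k z x t \<partial>lborel \<partial>lborel)" for z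
    unfolding k_def by (rule lborel_pair.Fubini') measurable
  have "(\<integral>\<^sup>+z. \<integral>\<^sup>+x. \<integral>\<^sup>+t. k z x t \<partial>lborel \<partial>lborel \<partial>lborel) = (\<integral>\<^sup>+z. \<integral>\<^sup>+t. \<integral>\<^sup>+x. k z x t \<partial>lborel \<partial>lborel \<partial>lborel)"
    by (simp only: sw)
  also have "\<dots> = (\<integral>\<^sup>+t. \<integral>\<^sup>+z. \<integral>\<^sup>+x. k z x t \<partial>lborel \<partial>lborel \<partial>lborel)"
    unfolding k_def by (rule lborel_pair.Fubini') measurable
  also have "\<dots> \<le> (\<integral>\<^sup>+t. (8 * (emeasure lborel D + emeasure lborel Z) * E) * indicator {0..1::real} t \<partial>lborel)"
    by (rule nn_integral_mono) (use J in \<open>simp add: mult.commute\<close>)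
  also have "\<dots> = 8 * (emeasure lborel D + emeasure lborel Z) * E"
    by (subst nn_integral_cmult_indicator) auto
  finally have tot: "(\<integral>\<^sup>+z. \<integral>\<^sup>+x. \<integral>\<^sup>+t. k z x t \<partial>lborel \<partial>lborel \<partial>lborel) \<le> 8 * (emeasure lborel D + emeasure lborel Z) * E" .
  have "(\<integral>\<^sup>+z. \<integral>\<^sup>+x. indicator Z z * (indicator D x * ennreal ((f z - f x)\<^sup>2)) \<partial>lborel \<partial>lborel)
     \<le> (\<integral>\<^sup>+z. \<integral>\<^sup>+x. ennreal (L\<^sup>2) * (\<integral>\<^sup>+t. k z x t \<partial>lborel) \<partial>lborel \<partial>lborel)"
    by (intro nn_integral_mono pt)
  also have "\<dots> = ennreal (L\<^sup>2) * (\<integral>\<^sup>+z. \<integral>\<^sup>+x. \<integral>\<^sup>+t. k z x t \<partial>lborel \<partial>lborel \<partial>lborel)"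
    unfolding k_def by (simp add: nn_integral_cmult)
  also have "\<dots> \<le> ennreal (L\<^sup>2) * (8 * (emeasure lborel D + emeasure lborel Z) * E)"
    by (intro mult_left_mono tot) simp
  finally show ?thesis unfolding E_def e_def .
qed

subsection \<open>Poincare inequality in an exterior collar\<close>

definition ext_energy :: "(real^3) set \<Rightarrow> (real^3 \<Rightarrow> real) \<Rightarrow> real" where
  "ext_energy \<Omega> f = (\<integral>x. indicator (- \<Omega>) x * (norm (grad f x))\<^sup>2 \<partial>lborel)"

definition finite_energy :: "(real^3 \<Rightarrow> real) \<Rightarrow> bool" where
  "finite_energy f \<longleftrightarrow> smooth_on UNIV f \<and> integrable lborel (\<lambda>x. (norm (grad f x))\<^sup>2)"

definition sq_dev :: "(real^3) set \<Rightarrow> (real^3) set \<Rightarrow> (real^3 \<Rightarrow> real) \<Rightarrow> real \<Rightarrow> ennreal" where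
  "sq_dev \<Omega> A f c = (\<integral>\<^sup>+x. indicator (A - \<Omega>) x * ennreal ((f x - c)\<^sup>2) \<partial>lborel)"

text \<open>The right-hand side is the energy of the whole exterior rather than of
  \<open>A - \<Omega>\<close>: the segments used for the local inequality leave \<open>A\<close>,
  and gluing then only has to add constants.\<close>

definition poincare :: "(real^3) set \<Rightarrow> (real^3) set \<Rightarrow> bool" where
  "poincare \<Omega> A \<longleftrightarrow> (\<exists>C\<ge>0. \<forall>f. finite_energy f \<longrightarrow>
     (\<exists>c. sq_dev \<Omega> A f c \<le> ennreal (C * ext_energy \<Omega> f)))"

lemma ext_energy_nonneg: "ext_energy \<Omega> f \<ge> 0" by (simp add: ext_energy_def)

lemma nn_ext_energy:
  assumes "finite_energy f" "\<Omega> \<in> sets borel"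
  shows "(\<integral>\<^sup>+y. indicator (- \<Omega>) y * ennreal ((norm (grad f y))\<^sup>2) \<partial>lborel) = ennreal (ext_energy \<Omega> f)"
proof -
  have i: "integrable lborel (\<lambda>x. (norm (grad f x))\<^sup>2)" using assms by (simp add: finite_energy_def)
  have [measurable]: "\<Omega> \<in> sets borel" by fact
  have [measurable]: "grad f \<in> borel_measurable borel" using assms measurable_grad by (simp add: finite_energy_def)
  have "integrable lborel (\<lambda>x. indicator (- \<Omega>) x * (norm (grad f x))\<^sup>2)"
    by (rule Bochner_Integration.integrable_bound[OF i]) (auto simp: indicator_def)
  then have "(\<integral>\<^sup>+y. ennreal (indicator (- \<Omega>) y * (norm (grad f y))\<^sup>2) \<partial>lborel) = ennreal (ext_energy \<Omega> f)"
    unfolding ext_energy_def by (rule nn_integral_eq_integral) auto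
  moreover have "(\<integral>\<^sup>+y. ennreal (indicator (- \<Omega>) y * (norm (grad f y))\<^sup>2) \<partial>lborel) = (\<integral>\<^sup>+y. indicator (- \<Omega>) y * ennreal ((norm (grad f y))\<^sup>2) \<partial>lborel)"
    by (intro nn_integral_cong) (auto simp: indicator_def)
  ultimately show ?thesis by simp
qed

lemma emeasure_ball_eq: "emeasure lborel (ball (q::real^3) s) = ennreal (measure lborel (ball q s))"
  using emeasure_lborel_ball_finite[of q s] by (intro emeasure_eq_ennreal_measure) auto

lemma poincare_subset:
  assumes "poincare \<Omega> B" "A \<subseteq> B" shows "poincare \<Omega> A"
proof -
  obtain C where C: "C \<ge> 0" "\<And>f. finite_energy f \<Longrightarrow> \<exists>c. sq_dev \<Omega> B f c \<le> ennreal (C * ext_energy \<Omega> f)"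
    using assms(1) by (auto simp: poincare_def)
  have "\<exists>c. sq_dev \<Omega> A f c \<le> ennreal (C * ext_energy \<Omega> f)" if f: "finite_energy f" for f
  proof -
    obtain c where c: "sq_dev \<Omega> B f c \<le> ennreal (C * ext_energy \<Omega> f)"
      using C(2)[OF f] by blast
    have "sq_dev \<Omega> A f c \<le> sq_dev \<Omega> B f c"
      unfolding sq_dev_def using assms(2) by (intro nn_integral_mono) (auto simp: indicator_def)
    then show ?thesis using c by (meson order_trans)
  qed
  then show ?thesis using C(1) by (auto simp: poincare_def)
qed

text \<open>The two constants \<open>c\<close> and \<open>c'\<close> are both close to
  \<open>f\<close> on the common exterior ball, so their difference is controlled by the energy
  divided by its volume. The constant \<open>c\<close> then serves on \<open>B\<close> too.\<close>

lemma poincare_glue: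
  assumes \<Omega>: "open \<Omega>" and A: "poincare \<Omega> A" "open A" and B: "poincare \<Omega> B" "open B" "bounded B"
    and S: "s > 0" "ball q s \<subseteq> A \<inter> B - \<Omega>"
  shows "poincare \<Omega> (A \<union> B)"
proof -
  have [measurable]: "\<Omega> \<in> sets borel" "A \<in> sets borel" "B \<in> sets borel" using \<Omega> A B by auto
  obtain C where C: "C \<ge> 0" "\<And>f. finite_energy f \<Longrightarrow> \<exists>c. sq_dev \<Omega> A f c \<le> ennreal (C * ext_energy \<Omega> f)"
    using A by (auto simp: poincare_def)
  obtain D where D: "D \<ge> 0" "\<And>f. finite_energy f \<Longrightarrow> \<exists>c. sq_dev \<Omega> B f c \<le> ennreal (D * ext_energy \<Omega> f)"
    using B by (auto simp: poincare_def)
  define v where "v = measure lborel (ball q s)"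
  have v: "emeasure lborel (ball q s) = ennreal v" "v > 0"
    using S(1) by (simp_all add: v_def emeasure_ball_eq content_ball_pos)
  define b where "b = measure lborel (B - \<Omega>)"
  have bfin: "emeasure lborel (B - \<Omega>) < \<infinity>"
    using B(3) by (intro emeasure_bounded_finite bounded_subset[OF B(3)]) auto
  then have b: "emeasure lborel (B - \<Omega>) = ennreal b" "b \<ge> 0"
    by (auto simp: b_def emeasure_eq_ennreal_measure less_top)
  \<comment> \<open>\<open>C\<close> accounts for \<open>A\<close>, \<open>2 D\<close> for the
    deviation from \<open>c'\<close> on \<open>B\<close>, and the last term for the shift from
    \<open>c'\<close> to \<open>c\<close> integrated over \<open>B - \<Omega>\<close>.\<close>
  define M where "M = C + 2 * D + 2 * (2 * (C + D) / v) * b"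
  have M0: "M \<ge> 0" using C D v b by (simp add: M_def)
  have sq: "(u - w)\<^sup>2 \<le> 2 * (u - t)\<^sup>2 + 2 * (t - w)\<^sup>2" for u w t :: real
    using zero_le_power2[of "(u - t) - (t - w)"] by (simp add: power2_eq_square algebra_simps)
  have "\<exists>c. sq_dev \<Omega> (A \<union> B) f c \<le> ennreal (M * ext_energy \<Omega> f)" if f: "finite_energy f" for f
  proof -
    define E where "E = ext_energy \<Omega> f"
    have E: "E \<ge> 0" by (simp add: E_def ext_energy_nonneg)
    have "continuous_on UNIV f" using f smooth_on_continuous_on by (auto simp: finite_energy_def)
    then have [measurable]: "f \<in> borel_measurable borel" by (rule borel_measurable_continuous_onI)
    obtain c where c: "sq_dev \<Omega> A f c \<le> ennreal (C * E)"
      using C(2)[OF f] by (auto simp: E_def)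
    obtain c' where c': "sq_dev \<Omega> B f c' \<le> ennreal (D * E)"
      using D(2)[OF f] by (auto simp: E_def)
    have "ennreal ((c - c')\<^sup>2 * v) = (\<integral>\<^sup>+x. ennreal ((c - c')\<^sup>2) * indicator (ball q s) x \<partial>lborel)"
      using v by (subst nn_integral_cmult_indicator) (auto simp: ennreal_mult)
    also have "\<dots> \<le> (\<integral>\<^sup>+x. 2 * (indicator (A - \<Omega>) x * ennreal ((f x - c)\<^sup>2)) + 2 * (indicator (B - \<Omega>) x * ennreal ((f x - c')\<^sup>2)) \<partial>lborel)"
    proof (rule nn_integral_mono)
      fix x
      show "ennreal ((c - c')\<^sup>2) * indicator (ball q s) x \<le> 2 * (indicator (A - \<Omega>) x * ennreal ((f x - c)\<^sup>2)) + 2 * (indicator (B - \<Omega>) x * ennreal ((f x - c')\<^sup>2))"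
      proof (cases "x \<in> ball q s")
        case True
        then have x: "x \<in> A - \<Omega>" "x \<in> B - \<Omega>" using S(2) by auto
        have "(c - c')\<^sup>2 \<le> 2 * (f x - c)\<^sup>2 + 2 * (f x - c')\<^sup>2" using sq[of c c' "f x"] by (simp add: power2_commute)
        then have "ennreal ((c - c')\<^sup>2) \<le> ennreal (2 * (f x - c)\<^sup>2 + 2 * (f x - c')\<^sup>2)" by (rule ennreal_leI)
        also have "\<dots> = 2 * ennreal ((f x - c)\<^sup>2) + 2 * ennreal ((f x - c')\<^sup>2)" by (simp add: ennreal_plus ennreal_mult')
        finally show ?thesis using x True by simp
      qed simp
    qed
    also have "\<dots> = 2 * sq_dev \<Omega> A f c + 2 * sq_dev \<Omega> B f c'"
      by (simp add: sq_dev_def nn_integral_add nn_integral_cmult)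
    also have "\<dots> \<le> 2 * ennreal (C * E) + 2 * ennreal (D * E)" using c c' by (intro add_mono mult_left_mono) auto
    also have "\<dots> = ennreal (2 * (C * E) + 2 * (D * E))" using C D E by (simp add: ennreal_plus ennreal_mult')
    finally have "(c - c')\<^sup>2 * v \<le> 2 * (C * E) + 2 * (D * E)" using C D E by (subst (asm) ennreal_le_iff) auto
    then have cc: "(c - c')\<^sup>2 \<le> 2 * (C + D) / v * E" using v by (simp add: field_simps)
    have "sq_dev \<Omega> (A \<union> B) f c
      \<le> (\<integral>\<^sup>+x. indicator (A - \<Omega>) x * ennreal ((f x - c)\<^sup>2) + (2 * (indicator (B - \<Omega>) x * ennreal ((f x - c')\<^sup>2)) + ennreal (2 * (2 * (C + D) / v * E)) * indicator (B - \<Omega>) x) \<partial>lborel)"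
      unfolding sq_dev_def
    proof (rule nn_integral_mono)
      fix x
      show "indicator (A \<union> B - \<Omega>) x * ennreal ((f x - c)\<^sup>2) \<le> indicator (A - \<Omega>) x * ennreal ((f x - c)\<^sup>2) + (2 * (indicator (B - \<Omega>) x * ennreal ((f x - c')\<^sup>2)) + ennreal (2 * (2 * (C + D) / v * E)) * indicator (B - \<Omega>) x)"
      proof (cases "x \<in> B - \<Omega>")
        case True
        have "(f x - c)\<^sup>2 \<le> 2 * (f x - c')\<^sup>2 + 2 * (2 * (C + D) / v * E)"
          using sq[of "f x" c c'] cc by (simp add: power2_commute[of c'])
        then have "ennreal ((f x - c)\<^sup>2) \<le> ennreal (2 * (f x - c')\<^sup>2 + 2 * (2 * (C + D) / v * E))" by (rule ennreal_leI)
        also have "\<dots> = 2 * ennreal ((f x - c')\<^sup>2) + ennreal (2 * (2 * (C + D) / v * E))"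
          using C D E v by (subst ennreal_plus) (auto simp: ennreal_mult')
        also have "\<dots> \<le> indicator (A - \<Omega>) x * ennreal ((f x - c)\<^sup>2) + (2 * ennreal ((f x - c')\<^sup>2) + ennreal (2 * (2 * (C + D) / v * E)))"
          by simp
        finally show ?thesis using True by simp
      qed (auto simp: indicator_def)
    qed
    also have "\<dots> = sq_dev \<Omega> A f c + (2 * sq_dev \<Omega> B f c' + ennreal (2 * (2 * (C + D) / v * E)) * ennreal b)"
      by (simp add: sq_dev_def nn_integral_add nn_integral_cmult nn_integral_cmult_indicator b)
    also have "\<dots> \<le> ennreal (C * E) + (2 * ennreal (D * E) + ennreal (2 * (2 * (C + D) / v * E)) * ennreal b)"
      using c c' by (intro add_mono mult_left_mono order_refl) auto
    also have "\<dots> = ennreal (M * E)"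
    proof -
      have n: "0 \<le> C * E" "0 \<le> 2 * (D * E)" "0 \<le> 2 * (2 * (C + D) / v * E)" "0 \<le> 2 * (2 * (C + D) / v * E) * b"
        using C D E v b by auto
      have "M * E = C * E + (2 * (D * E) + 2 * (2 * (C + D) / v * E) * b)" by (simp add: M_def algebra_simps)
      moreover have "ennreal (C * E + (2 * (D * E) + 2 * (2 * (C + D) / v * E) * b)) = ennreal (C * E) + (ennreal (2 * (D * E)) + ennreal (2 * (2 * (C + D) / v * E) * b))"
        using n by (simp only: ennreal_plus add_nonneg_nonneg)
      moreover have "ennreal (2 * (D * E)) = 2 * ennreal (D * E)" by (simp add: ennreal_mult')
      moreover have "ennreal (2 * (2 * (C + D) / v * E) * b) = ennreal (2 * (2 * (C + D) / v * E)) * ennreal b"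
        using n b by (intro ennreal_mult) auto
      ultimately show ?thesis by (simp only:)
    qed
    finally show ?thesis by (auto simp: E_def)
  qed
  then show ?thesis using M0 by (auto simp: poincare_def)
qed

text \<open>The constant is a value \<open>f z\<close> at a suitable point \<open>z\<close> of the
  outer ball \<open>Z\<close>. By \<open>starshaped_poincare\<close> the squared deviation from
  \<open>f z\<close>, averaged over \<open>Z\<close>, is bounded by the energy, so it cannot be too
  large for every \<open>z\<close>.\<close>

lemma poincare_local:
  assumes \<Omega>: "open \<Omega>" "smooth_boundary \<Omega>" and p: "p \<in> frontier \<Omega>"
  obtains r where "r > 0" "poincare \<Omega> (ball p r)"
proof -
  have [measurable]: "\<Omega> \<in> sets borel" using \<Omega> by auto
  obtain r n where c: "r > 0" "norm n = 1"
    "\<And>s x z t. 0 < s \<Longrightarrow> s \<le> r \<Longrightarrow> x \<in> ball p s \<Longrightarrow> x \<notin> \<Omega> \<Longrightarrow> z \<in> ball (p + (10 * s) *\<^sub>R n) s \<Longrightarrow> 0 \<le> t \<Longrightarrow> t \<le> 1 \<Longrightarrow>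
       x + t *\<^sub>R (z - x) \<notin> \<Omega>" using boundary_starshaped[OF \<Omega> p] by metis
  define D where "D = ball p r - \<Omega>"
  define Z where "Z = ball (p + (10 * r) *\<^sub>R n) r"
  have [measurable]: "D \<in> sets borel" "Z \<in> sets borel" by (auto simp: D_def Z_def)
  define v where "v = measure lborel (ball p r)"
  have Zv: "emeasure lborel Z = ennreal v"
  proof -
    have "emeasure lborel Z = ennreal (measure lborel Z)" by (simp add: Z_def emeasure_ball_eq)
    also have "measure lborel Z = v" using c(1) by (simp add: Z_def v_def content_ball)
    finally show ?thesis .
  qed
  have v: "v > 0" using c(1) by (simp add: v_def content_ball_pos)
  have Dv: "emeasure lborel D \<le> ennreal v"
  proof -
    have "emeasure lborel D \<le> emeasure lborel (ball p r)" by (rule emeasure_mono) (auto simp: D_def)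
    also have "\<dots> = ennreal v" by (simp add: v_def emeasure_ball_eq)
    finally show ?thesis .
  qed
  define L where "L = 12 * r"
  have L: "norm (z - x) \<le> L" if "x \<in> D" "z \<in> Z" for x z
  proof -
    have "dist x z \<le> dist p x + dist p (p + (10 * r) *\<^sub>R n) + dist (p + (10 * r) *\<^sub>R n) z"
      using dist_triangle[of x z p] dist_triangle[of p z "p + (10 * r) *\<^sub>R n"] by (simp add: dist_commute)
    also have "dist p (p + (10 * r) *\<^sub>R n) = 10 * r" using c by (simp add: dist_norm)
    finally show ?thesis using that by (simp add: D_def Z_def L_def dist_norm norm_minus_commute)
  qed
  have star: "x + t *\<^sub>R (z - x) \<notin> \<Omega>" if "x \<in> D" "z \<in> Z" "0 \<le> t" "t \<le> 1" for x z t
    using c(3)[of r x z t] that c(1) by (auto simp: D_def Z_def)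
  \<comment> \<open>Twice the mean value \<open>16 L^2\<close> that
    \<open>starshaped_poincare\<close> yields when both sets have volume at most
    \<open>v\<close>.\<close>
  define C where "C = 32 * L\<^sup>2"
  have "\<exists>c. (\<integral>\<^sup>+x. indicator D x * ennreal ((f x - c)\<^sup>2) \<partial>lborel) \<le> ennreal (C * ext_energy \<Omega> f)" if f: "finite_energy f" for f
  proof (rule ccontr)
    assume no: "\<not> ?thesis"
    define E where "E = ext_energy \<Omega> f"
    have E: "E \<ge> 0" by (simp add: E_def ext_energy_nonneg)
    have sf: "smooth_on UNIV f" using f by (simp add: finite_energy_def)
    have [measurable]: "f \<in> borel_measurable borel"
      using smooth_on_continuous_on[OF sf] by (rule borel_measurable_continuous_onI)
    define H where "H z = (\<integral>\<^sup>+x. indicator D x * ennreal ((f z - f x)\<^sup>2) \<partial>lborel)" for z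
    have Hm [measurable]: "H \<in> borel_measurable borel" unfolding H_def by measurable
    have H: "H z > ennreal (C * E)" for z
      using no unfolding H_def E_def by (metis (no_types, lifting) not_le power2_commute nn_integral_cong)
    have "(\<integral>\<^sup>+z. indicator Z z * H z \<partial>lborel) = (\<integral>\<^sup>+z. \<integral>\<^sup>+x. indicator Z z * (indicator D x * ennreal ((f z - f x)\<^sup>2)) \<partial>lborel \<partial>lborel)"
      unfolding H_def by (intro nn_integral_cong) (simp add: nn_integral_cmult)
    also have "\<dots> \<le> ennreal (L\<^sup>2) * (8 * (emeasure lborel D + emeasure lborel Z) * (\<integral>\<^sup>+y. indicator (- \<Omega>) y * ennreal ((norm (grad f y))\<^sup>2) \<partial>lborel))"
      by (rule starshaped_poincare[OF _ _ _ star L sf]) auto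
    also have "\<dots> \<le> ennreal (L\<^sup>2) * (8 * (ennreal v + ennreal v) * ennreal E)"
      unfolding nn_ext_energy[OF f \<open>\<Omega> \<in> sets borel\<close>] E_def[symmetric] Zv
      using Dv by (intro mult_left_mono mult_right_mono add_mono) auto
    also have "\<dots> = ennreal (L\<^sup>2 * (8 * (v + v) * E))"
    proof -
      have "ennreal (L\<^sup>2 * (8 * (v + v) * E)) = ennreal (L\<^sup>2) * ennreal (8 * (v + v) * E)"
        using v E by (intro ennreal_mult) auto
      also have "ennreal (8 * (v + v) * E) = ennreal (8 * (v + v)) * ennreal E" using v E by (intro ennreal_mult) auto
      also have "ennreal (8 * (v + v)) = 8 * (ennreal v + ennreal v)" using v by (simp add: ennreal_mult' ennreal_plus[symmetric] del: ennreal_plus)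
      finally show ?thesis by simp
    qed
    also have "\<dots> = ennreal (C * E * v / 2)" by (simp add: C_def algebra_simps)
    finally have up: "(\<integral>\<^sup>+z. indicator Z z * H z \<partial>lborel) \<le> ennreal (C * E * v / 2)" .
    have "(\<integral>\<^sup>+z. ennreal (C * E) * indicator Z z \<partial>lborel) \<le> (\<integral>\<^sup>+z. indicator Z z * H z \<partial>lborel)"
      using H by (intro nn_integral_mono) (auto simp: indicator_def less_imp_le)
    then have "ennreal (C * E) * ennreal v \<le> ennreal (C * E * v / 2)"
      using up Zv by (simp add: nn_integral_cmult_indicator)
    moreover have "C * E \<ge> 0" using E by (simp add: C_def)
    ultimately have "C * E * v \<le> C * E * v / 2" using v by (simp add: ennreal_mult[symmetric])
    \<comment> \<open>The factor two forces \<open>C * E = 0\<close>. In that degenerate case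
      \<open>H\<close> is still positive everywhere but has integral 0 over \<open>Z\<close>, so
      \<open>Z\<close> would be null.\<close>
    then have CE: "C * E * v \<le> 0" by simp
    then have "(\<integral>\<^sup>+z. indicator Z z * H z \<partial>lborel) = 0" using up by (simp add: ennreal_neg)
    then have "AE z in lborel. indicator Z z * H z = 0" by (subst (asm) nn_integral_0_iff_AE) auto
    then have "AE z in lborel. z \<notin> Z"
    proof eventually_elim
      case (elim z)
      have "H z \<noteq> 0" using H[of z] by (metis not_less_zero)
      then show ?case using elim by (auto simp: indicator_def split: if_splits)
    qed
    then have "emeasure lborel Z = 0"
      by (subst (asm) AE_iff_measurable[of Z]) auto
    then show False using Zv v by simp
  qed
  then have "poincare \<Omega> (ball p r)"
    unfolding poincare_def sq_dev_def D_def[symmetric] by (intro exI[of _ C]) (auto simp: C_def)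
  then show ?thesis using that c(1) by blast
qed

text \<open>Being joined by a Poincare inequality on small balls around both points is an
  equivalence relation on the frontier with open classes, so connectedness leaves one class.
  Compactness then reduces the collar to finitely many balls.\<close>

lemma poincare_collar:
  assumes \<Omega>: "open \<Omega>" "bounded \<Omega>" "smooth_boundary \<Omega>" and conn: "connected (frontier \<Omega>)"
  obtains A where "open A" "bounded A" "frontier \<Omega> \<subseteq> A" "poincare \<Omega> A"
proof (cases "frontier \<Omega> = {}")
  case True
  have "poincare \<Omega> {}" unfolding poincare_def sq_dev_def by (intro exI[of _ 0]) auto
  then show ?thesis using that[of "{}"] True by auto
next
  case False
  then obtain p0 where p0: "p0 \<in> frontier \<Omega>" by blast
  \<comment> \<open>The radius may depend on the pair; it can always be shrunk by
    \<open>poincare_subset\<close>, which makes transitivity work by dropping the middle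
    balls.\<close>
  define rel where "rel p q \<longleftrightarrow> (\<exists>s>0. poincare \<Omega> (ball p s \<union> ball q s))" for p q
  have glue: "poincare \<Omega> (A \<union> B)" if g: "poincare \<Omega> A" "poincare \<Omega> B" "open A" "open B" "bounded B" "q \<in> A" "q \<in> B" "q \<in> frontier \<Omega>" for A B q
  proof -
    have "open (A \<inter> B)" "q \<in> A \<inter> B" using g by auto
    then obtain z s where "s > 0" "ball z s \<subseteq> A \<inter> B - \<Omega>"
      using boundary_exterior_ball[OF \<Omega>(1,3) g(8)] by metis
    then show ?thesis using poincare_glue[OF \<Omega>(1) g(1,3,2,4,5)] by blast
  qed
  have "rel p0 q" if q: "q \<in> frontier \<Omega>" for q
  proof (rule connected_equivalence_relation[OF conn p0 q])
    show "rel y x" if "rel x y" for x y using that by (simp add: rel_def Un_commute)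
    show "rel x z" if xy: "rel x y" "rel y z" and y: "y \<in> frontier \<Omega>" for x y z
    proof -
      obtain s s' where s: "s > 0" "poincare \<Omega> (ball x s \<union> ball y s)" "s' > 0" "poincare \<Omega> (ball y s' \<union> ball z s')"
        using xy by (auto simp: rel_def)
      have "poincare \<Omega> ((ball x s \<union> ball y s) \<union> (ball y s' \<union> ball z s'))"
        by (rule glue[OF s(2,4) _ _ _ _ _ y]) (use s in auto)
      then have "poincare \<Omega> (ball x (min s s') \<union> ball z (min s s'))"
        by (rule poincare_subset) auto
      then show ?thesis using s by (auto simp: rel_def intro!: exI[of _ "min s s'"])
    qed
    show "\<exists>T. openin (top_of_set (frontier \<Omega>)) T \<and> a \<in> T \<and> (\<forall>x\<in>T. rel a x)" if a: "a \<in> frontier \<Omega>" for a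
    proof -
      obtain r where r: "r > 0" "poincare \<Omega> (ball a r)" using poincare_local[OF \<Omega>(1,3) a] by blast
      have "rel a x" if "x \<in> ball a (r / 2)" for x
      proof -
        have "ball a (r / 2) \<union> ball x (r / 2) \<subseteq> ball a r"
        proof -
          have "dist a y < r" if "dist x y < r / 2" for y
            using dist_triangle[of a y x] \<open>x \<in> ball a (r / 2)\<close> that by simp
          then show ?thesis using r by auto
        qed
        then show ?thesis unfolding rel_def using poincare_subset[OF r(2)] r(1) by (intro exI[of _ "r / 2"]) auto
      qed
      then show ?thesis using a r
        by (intro exI[of _ "frontier \<Omega> \<inter> ball a (r / 2)"]) (auto intro: openin_open_Int)
    qed
  qed
  then obtain s where s: "\<And>q. q \<in> frontier \<Omega> \<Longrightarrow> s q > 0 \<and> poincare \<Omega> (ball p0 (s q) \<union> ball q (s q))"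
    unfolding rel_def by metis
  have "compact (frontier \<Omega>)" using \<Omega>(2) by (rule compact_frontier_bounded)
  then obtain I where I: "I \<subseteq> frontier \<Omega>" "finite I" "frontier \<Omega> \<subseteq> (\<Union>q\<in>I. ball q (s q))"
    by (rule compactE_image[of _ "frontier \<Omega>" "\<lambda>q. ball q (s q)"]) (use s in auto)
  \<comment> \<open>Every piece carries a ball around \<open>p0\<close>, so any two pieces overlap
    near this frontier point and can be glued in any order.\<close>
  define A where "A J = (\<Union>q\<in>J. ball p0 (s q) \<union> ball q (s q))" for J
  have "J \<subseteq> frontier \<Omega> \<Longrightarrow> J \<noteq> {} \<Longrightarrow> poincare \<Omega> (A J)" if "finite J" for J
    using that
  proof (induction J rule: finite_induct)
    case (insert q J)
    show ?case
    proof (cases "J = {}")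
      case True
      then show ?thesis using insert s by (simp add: A_def)
    next
      case False
      then obtain q' where q': "q' \<in> J" by blast
      have "poincare \<Omega> (A J \<union> (ball p0 (s q) \<union> ball q (s q)))"
      proof (rule glue[where q=p0])
        show "poincare \<Omega> (A J)" using insert False by auto
        show "poincare \<Omega> (ball p0 (s q) \<union> ball q (s q))" using s insert by auto
        show "open (A J)" by (auto simp: A_def)
        show "p0 \<in> A J" using q' s[of q'] insert by (auto simp: A_def intro!: bexI[of _ q'])
        show "p0 \<in> ball p0 (s q) \<union> ball q (s q)" using s[of q] insert by auto
      qed (use p0 in auto)
      moreover have "A (insert q J) = A J \<union> (ball p0 (s q) \<union> ball q (s q))" by (auto simp: A_def)
      ultimately show ?thesis by simp
    qed
  qed simp
  moreover have "I \<noteq> {}" using I p0 by auto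
  ultimately have "poincare \<Omega> (A I)" using I by blast
  moreover have "open (A I)" "bounded (A I)" "frontier \<Omega> \<subseteq> A I" using I by (auto simp: A_def)
  ultimately show ?thesis using that by blast
qed

subsection \<open>Reflection across the boundary\<close>

definition reflect :: "(real^3 \<Rightarrow> real) \<Rightarrow> real^3 \<Rightarrow> real^3 \<Rightarrow> real^3" where
  "reflect m n x = x - (2 * m x) *\<^sub>R n"

lemma reflect_has_derivative:
  assumes "smooth_on UNIV m"
  shows "(reflect m n has_derivative (\<lambda>v. v - (2 * (grad m x \<bullet> v)) *\<^sub>R n)) (at x)"
  unfolding reflect_def[abs_def]
  by (intro has_derivative_diff has_derivative_ident has_derivative_scaleR_left has_derivative_mult_right has_derivative_grad[OF assms] UNIV_I)

text \<open>The derivative of the composition in direction \<open>v\<close> is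
  \<open>f'(T) v - 2 (m' v) (f'(T) n)\<close> with \<open>T = reflect m n\<close>: scalar functions
  composed with \<open>T\<close>, and derivatives of \<open>m\<close>. The induction therefore stays
  among scalar functions.\<close>

lemma smooth_on_reflect:
  assumes m: "smooth_on UNIV m" and f: "smooth_on UNIV f"
  shows "smooth_on UNIV (\<lambda>x. f (reflect m n x))"
proof -
  have d: "((\<lambda>x. f (reflect m n x)) has_derivative (\<lambda>v. frechet_derivative f (at (reflect m n x)) v - 2 * (frechet_derivative m (at x) v * frechet_derivative f (at (reflect m n x)) n))) (at x)"
    if f: "smooth_on UNIV f" for f x
  proof -
    let ?D = "frechet_derivative f (at (reflect m n x))"
    have D: "(f has_derivative ?D) (at (reflect m n x))" by (rule smooth_on_has_derivative[OF f]) simp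
    have l: "linear ?D" using has_derivative_linear[OF D] .
    have "grad m x \<bullet> v = frechet_derivative m (at x) v" for v
      by (rule inner_grad) (use smooth_on_has_derivative[OF m, of x] in \<open>simp add: differentiableI\<close>)
    then show ?thesis
      using has_derivative_compose[OF reflect_has_derivative[OF m, of n x] D]
      by (simp add: linear_diff[OF l] linear_cmul[OF l] mult.assoc)
  qed
  have "Ck_on k UNIV (\<lambda>x. f (reflect m n x))" if "smooth_on UNIV f" for k f
    using that
  proof (induction k arbitrary: f)
    case 0
    then show ?case using d[OF 0]
      by (auto intro!: continuous_at_imp_continuous_on has_derivative_continuous)
  next
    case (Suc k)
    show ?case
    proof (rule Ck_on_SucI[OF open_UNIV d[OF Suc.prems]])
      fix v
      have 1: "Ck_on k UNIV (\<lambda>x. frechet_derivative f (at (reflect m n x)) w)" for w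
        by (rule Suc.IH[OF smooth_on_frechet[OF Suc.prems]])
      have 2: "Ck_on k UNIV (\<lambda>x. frechet_derivative m (at x) v)" by (rule smooth_onD[OF smooth_on_frechet[OF m]])
      have "Ck_on k UNIV (\<lambda>x. frechet_derivative f (at (reflect m n x)) v + (- 2) * (frechet_derivative m (at x) v * frechet_derivative f (at (reflect m n x)) n))"
        by (intro Ck_on_add Ck_on_mult Ck_on_const open_UNIV 1 2)
      then show "Ck_on k UNIV (\<lambda>x. frechet_derivative f (at (reflect m n x)) v - 2 * (frechet_derivative m (at x) v * frechet_derivative f (at (reflect m n x)) n))"
        by simp
    qed
  qed
  then show ?thesis using f by (simp add: smooth_on_def)
qed

text \<open>The determinant of a rank-one perturbation of the identity; for \<open>g = n\<close> a
  unit vector it is -1, as for a reflection.\<close>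

lemma det_reflect: "det (matrix (\<lambda>v::real^3. v - (2 * (g \<bullet> v)) *\<^sub>R n)) = 1 - 2 * (g \<bullet> n)"
  by (simp add: det_3 matrix_def inner_axis axis_1_component inner_vec_def sum_3) (simp add: algebra_simps)

lemma nn_integral_change_of_variables_le:
  fixes T :: "real^3 \<Rightarrow> real^3" and f :: "real^3 \<Rightarrow> real"
  assumes S: "open S" "bounded S" and W: "W \<in> sets borel" "T ` S \<subseteq> W"
    and T: "\<And>x. (T has_derivative T' x) (at x)" and inj: "inj_on T S"
    and dc: "continuous_on UNIV (\<lambda>x. det (matrix (T' x)))" and db: "\<And>x. x \<in> S \<Longrightarrow> \<bar>det (matrix (T' x))\<bar> \<ge> 1 / 2"
    and f: "continuous_on UNIV f" "\<And>x. f x \<ge> 0"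
  shows "(\<integral>\<^sup>+x. indicator S x * ennreal (f (T x)) \<partial>lborel) \<le> 2 * (\<integral>\<^sup>+y. indicator W y * ennreal (f y) \<partial>lborel)"
proof (cases "(\<integral>\<^sup>+y. indicator W y * ennreal (f y) \<partial>lborel) = \<infinity>")
  case True
  then show ?thesis by (simp add: ennreal_mult_top)
next
  case False
  have Tc: "continuous_on UNIV T" using T by (auto intro!: continuous_at_imp_continuous_on has_derivative_continuous)
  have fTc: "continuous_on UNIV (\<lambda>x. f (T x))" by (rule continuous_on_compose2[OF f(1) Tc]) auto
  have [measurable]: "f \<in> borel_measurable borel" using f(1) by (rule borel_measurable_continuous_onI)
  have [measurable]: "S \<in> sets borel" "W \<in> sets borel" using S W by auto
  define g where "g x = \<bar>det (matrix (T' x))\<bar> * f (T x)" for x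
  have gc: "continuous_on UNIV g" unfolding g_def by (intro continuous_intros dc fTc)
  have ic: "integrable lborel (\<lambda>x. indicator S x * h x)" if h: "continuous_on UNIV h" for h :: "real^3 \<Rightarrow> real"
  proof -
    have [measurable]: "h \<in> borel_measurable borel" using h by (rule borel_measurable_continuous_onI)
    have "integrable lborel (\<lambda>x. indicator (closure S) x *\<^sub>R h x)"
      by (rule borel_integrable_compact[unfolded set_integrable_def]) (use S h continuous_on_subset in auto)
    then show ?thesis
      by (rule Bochner_Integration.integrable_bound) (use closure_subset[of S] in \<open>auto simp: indicator_def\<close>)
  qed
  have hi: "((\<lambda>x. h x) has_integral (\<integral>x. indicator S x * h x \<partial>lborel)) S" if "continuous_on UNIV h" for h :: "real^3 \<Rightarrow> real"
  proof -
    have "((\<lambda>x. indicator S x * h x) has_integral (\<integral>x. indicator S x * h x \<partial>lborel)) UNIV"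
      by (rule has_integral_integral_lborel[OF ic[OF that]])
    moreover have "(\<lambda>x. indicator S x * h x) = (\<lambda>x. if x \<in> S then h x else 0)" by (auto simp: indicator_def)
    ultimately show ?thesis by (simp add: has_integral_restrict_UNIV)
  qed
  have g0: "g x \<ge> 0" for x using f by (simp add: g_def)
  \<comment> \<open>The scalar function is repackaged as a \<open>real^1\<close> field, the form in
    which the change of variables theorem is stated.\<close>
  define F where "F y = (\<chi> i::1. f y)" for y
  have gi: "g absolutely_integrable_on S" using hi[OF gc] g0 by (intro nonnegative_absolutely_integrable_1) auto
  have vi: "(\<lambda>x. \<bar>det (matrix (T' x))\<bar> *\<^sub>R F (T x)) absolutely_integrable_on S"
  proof -
    have "(\<lambda>x. \<bar>det (matrix (T' x))\<bar> *\<^sub>R F (T x)) = (\<lambda>x. (g x) *\<^sub>R (axis 1 1 :: real^1))"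
      by (auto simp: vec_eq_iff F_def g_def axis_def)
    moreover have "(\<lambda>x. (g x) *\<^sub>R (axis 1 1 :: real^1)) absolutely_integrable_on S"
      using absolutely_integrable_linear[OF gi bounded_linear_scaleR_left[of "axis 1 1 :: real^1"]] by (simp add: o_def)
    ultimately show ?thesis by simp
  qed
  define b where "b = integral S (\<lambda>x. \<bar>det (matrix (T' x))\<bar> *\<^sub>R F (T x))"
  have cov: "F absolutely_integrable_on T ` S \<and> integral (T ` S) F = b"
    by (rule has_absolute_integral_change_of_variables[OF _ has_derivative_at_withinI[OF T] inj, THEN iffD1])
       (use S vi b_def in \<open>auto intro: lebesgue_openin\<close>)
  have Fi: "F integrable_on T ` S" using cov by (simp add: set_lebesgue_integral_eq_integral(1))
  have fi: "f integrable_on T ` S" "integral (T ` S) f = b $ 1"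
  proof -
    have "((\<lambda>y. F y \<bullet> axis 1 1) has_integral (b \<bullet> axis 1 1)) (T ` S)"
      using has_integral_linear[OF integrable_integral[OF Fi] bounded_linear_inner_left[of "axis 1 1"]] cov by (simp add: o_def)
    then have "(f has_integral b $ 1) (T ` S)" by (simp add: F_def inner_axis)
    then show "f integrable_on T ` S" "integral (T ` S) f = b $ 1" by auto
  qed
  have bg: "b $ 1 = integral S g"
  proof -
    have "(\<lambda>x. \<bar>det (matrix (T' x))\<bar> *\<^sub>R F (T x)) integrable_on S" using vi by (simp add: set_lebesgue_integral_eq_integral(1))
    then have "((\<lambda>x. (\<bar>det (matrix (T' x))\<bar> *\<^sub>R F (T x)) \<bullet> axis 1 1) has_integral (b \<bullet> axis 1 1)) S"
      using has_integral_linear[OF integrable_integral bounded_linear_inner_left[of "axis 1 1 :: real^1"]]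
      unfolding b_def by (fastforce simp: o_def)
    then have "(g has_integral b $ 1) S" by (simp add: F_def inner_axis g_def[abs_def])
    then show ?thesis by (simp add: integral_unique)
  qed
  have Wi: "integrable lborel (\<lambda>y. indicator W y * f y)"
  proof (rule integrableI_nonneg)
    have "(\<integral>\<^sup>+y. ennreal (indicator W y * f y) \<partial>lborel) = (\<integral>\<^sup>+y. indicator W y * ennreal (f y) \<partial>lborel)"
      by (intro nn_integral_cong) (auto simp: indicator_def)
    then show "(\<integral>\<^sup>+y. ennreal (indicator W y * f y) \<partial>lborel) < \<infinity>" using False by (simp add: less_top)
  qed (use f in auto)
  have Wh: "(f has_integral (\<integral>y. indicator W y * f y \<partial>lborel)) W"
  proof -
    have "((\<lambda>x. indicator W x * f x) has_integral (\<integral>x. indicator W x * f x \<partial>lborel)) UNIV"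
      by (rule has_integral_integral_lborel[OF Wi])
    moreover have "(\<lambda>x. indicator W x * f x) = (\<lambda>x. if x \<in> W then f x else 0)" by (auto simp: indicator_def)
    ultimately show ?thesis by (simp add: has_integral_restrict_UNIV)
  qed
  have "(\<integral>x. indicator S x * f (T x) \<partial>lborel) = integral S (\<lambda>x. f (T x))"
    using hi[OF fTc] by (simp add: integral_unique)
  also have "\<dots> \<le> integral S (\<lambda>x. 2 * g x)"
  proof (rule integral_le)
    show "f (T x) \<le> 2 * g x" if "x \<in> S" for x
      using mult_right_mono[OF db[OF that] f(2)[of "T x"]] by (simp add: g_def)
    show "(\<lambda>x. f (T x)) integrable_on S" using hi[OF fTc] by auto
    show "(\<lambda>x. 2 * g x) integrable_on S" using hi[OF gc] by (auto intro: integrable_on_mult_right)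
  qed
  also have "\<dots> = 2 * integral (T ` S) f" by (simp add: fi bg)
  also have "\<dots> \<le> 2 * integral W f"
    using integral_subset_le[OF W(2) fi(1)] Wh f by auto
  also have "integral W f = (\<integral>y. indicator W y * f y \<partial>lborel)" using Wh by (rule integral_unique)
  finally have le: "(\<integral>x. indicator S x * f (T x) \<partial>lborel) \<le> 2 * (\<integral>y. indicator W y * f y \<partial>lborel)" .
  have "(\<integral>\<^sup>+x. indicator S x * ennreal (f (T x)) \<partial>lborel) = (\<integral>\<^sup>+x. ennreal (indicator S x * f (T x)) \<partial>lborel)"
    by (intro nn_integral_cong) (auto simp: indicator_def)
  also have "\<dots> = ennreal (\<integral>x. indicator S x * f (T x) \<partial>lborel)"
    by (rule nn_integral_eq_integral[OF ic[OF fTc]]) (use f in auto)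
  also have "\<dots> \<le> ennreal (2 * (\<integral>y. indicator W y * f y \<partial>lborel))" using le by (rule ennreal_leI)
  also have "\<dots> = 2 * ennreal (\<integral>y. indicator W y * f y \<partial>lborel)" by (simp add: ennreal_mult')
  also have "ennreal (\<integral>y. indicator W y * f y \<partial>lborel) = (\<integral>\<^sup>+y. ennreal (indicator W y * f y) \<partial>lborel)"
    by (rule nn_integral_eq_integral[symmetric, OF Wi]) (use f in auto)
  also have "\<dots> = (\<integral>\<^sup>+y. indicator W y * ennreal (f y) \<partial>lborel)"
    by (intro nn_integral_cong) (auto simp: indicator_def)
  finally show ?thesis .
qed

section \<open>Trading interior values for reflected exterior ones\<close>

definition collar_energy :: "(real^3) set \<Rightarrow> (real^3) set \<Rightarrow> (real^3 \<Rightarrow> real) \<Rightarrow> real \<Rightarrow> ennreal" where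
  "collar_energy \<Omega> A \<phi> c =
     (\<integral>\<^sup>+x. indicator (A - \<Omega>) x * ennreal ((\<phi> x - c)\<^sup>2 + (norm (grad \<phi> x))\<^sup>2) \<partial>lborel)"

text \<open>Weights whose share of the pairing is controlled from outside. The property is additive
  in \<open>\<theta>\<close>, so it can be proved near single frontier points. The constant
  \<open>c\<close> is left free for the Poincare inequality, and the real bound \<open>X\<close>
  keeps infinite energies out of the square roots.\<close>

definition transferable :: "(real^3) set \<Rightarrow> real \<Rightarrow> (real^3) set \<Rightarrow> (real^3 \<Rightarrow> real) \<Rightarrow> bool" where
  "transferable \<Omega> R A \<theta> \<longleftrightarrow> smooth_on UNIV \<theta> \<and> (\<exists>C\<ge>0. \<forall>F \<phi> c X. dfield \<Omega> R F \<longrightarrow> smooth_on UNIV \<phi> \<longrightarrow> X \<ge> 0 \<longrightarrow>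
     collar_energy \<Omega> A \<phi> c \<le> ennreal X \<longrightarrow>
     \<bar>ip F (grad (\<lambda>x. \<theta> x * (\<phi> x - c)))\<bar> \<le> C * sqrt (ip F F) * sqrt X)"

lemma grad_add:
  assumes "smooth_on UNIV f" "smooth_on UNIV g"
  shows "grad (\<lambda>x. f x + g x) x = grad f x + grad g x"
  by (rule grad_eqI[OF has_derivative_add[OF has_derivative_grad[OF assms(1)] has_derivative_grad[OF assms(2)]]])
     (auto simp: inner_add_left)

lemma ip_grad_add:
  assumes "bfield R F" "smooth_on UNIV f" "smooth_on UNIV g"
  shows "ip F (grad (\<lambda>x. f x + g x)) = ip F (grad f) + ip F (grad g)"
  using integrable_bfield_inner_cont[OF assms(1) continuous_on_grad[OF assms(2)]]
    integrable_bfield_inner_cont[OF assms(1) continuous_on_grad[OF assms(3)]]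
  by (simp add: grad_add[OF assms(2,3)] inner_add_right)

lemma transferable_add:
  assumes "transferable \<Omega> R A \<theta>1" "transferable \<Omega> R A \<theta>2"
  shows "transferable \<Omega> R A (\<lambda>x. \<theta>1 x + \<theta>2 x)"
proof -
  obtain C1 where C1: "C1 \<ge> 0" "\<And>F \<phi> c X. dfield \<Omega> R F \<Longrightarrow> smooth_on UNIV \<phi> \<Longrightarrow> X \<ge> 0 \<Longrightarrow>
     collar_energy \<Omega> A \<phi> c \<le> ennreal X \<Longrightarrow>
     \<bar>ip F (grad (\<lambda>x. \<theta>1 x * (\<phi> x - c)))\<bar> \<le> C1 * sqrt (ip F F) * sqrt X"
    using assms(1) unfolding transferable_def by blast
  obtain C2 where C2: "C2 \<ge> 0" "\<And>F \<phi> c X. dfield \<Omega> R F \<Longrightarrow> smooth_on UNIV \<phi> \<Longrightarrow> X \<ge> 0 \<Longrightarrow>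
     collar_energy \<Omega> A \<phi> c \<le> ennreal X \<Longrightarrow>
     \<bar>ip F (grad (\<lambda>x. \<theta>2 x * (\<phi> x - c)))\<bar> \<le> C2 * sqrt (ip F F) * sqrt X"
    using assms(2) unfolding transferable_def by blast
  have s: "smooth_on UNIV \<theta>1" "smooth_on UNIV \<theta>2" using assms by (auto simp: transferable_def)
  have "\<bar>ip F (grad (\<lambda>x. (\<theta>1 x + \<theta>2 x) * (\<phi> x - c)))\<bar> \<le> (C1 + C2) * sqrt (ip F F) * sqrt X"
    if h: "dfield \<Omega> R F" "smooth_on UNIV \<phi>" "X \<ge> 0" "collar_energy \<Omega> A \<phi> c \<le> ennreal X" for F \<phi> c X
  proof -
    have "ip F (grad (\<lambda>x. (\<theta>1 x + \<theta>2 x) * (\<phi> x - c))) = ip F (grad (\<lambda>x. \<theta>1 x * (\<phi> x - c) + \<theta>2 x * (\<phi> x - c)))"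
      by (simp add: distrib_right)
    also have "\<dots> = ip F (grad (\<lambda>x. \<theta>1 x * (\<phi> x - c))) + ip F (grad (\<lambda>x. \<theta>2 x * (\<phi> x - c)))"
      by (rule ip_grad_add) (use h s in \<open>auto simp: dfield_def intro!: smooth_on_mult smooth_on_diff\<close>)
    finally show ?thesis using C1(2)[OF h] C2(2)[OF h] by (simp add: distrib_right)
  qed
  then show ?thesis unfolding transferable_def using s C1(1) C2(1)
    by (intro conjI smooth_on_add open_UNIV exI[of _ "C1 + C2"]) auto
qed

text \<open>\<open>x - 2 m(x) n\<close> fixes \<open>{m = 0}\<close> and is a small perturbation of the orthogonal reflection along \<open>n\<close>,
  so it carries the inside of the boundary injectively to the outside; no flattening of the boundary is needed.\<close>

lemma reflection_chart:
  assumes \<Omega>: "open \<Omega>" "smooth_boundary \<Omega>" and p: "p \<in> frontier \<Omega>" and A: "open A" "p \<in> A"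
  obtains r m n where "r > 0" "smooth_on UNIV m" "norm n = 1" "inj_on (reflect m n) (\<Omega> \<inter> ball p r)"
    "reflect m n ` (\<Omega> \<inter> ball p r) \<subseteq> A - \<Omega>"
    "\<And>x. x \<in> ball p r \<Longrightarrow> norm (grad m x - n) \<le> 1 / 10"
    "\<And>x. x \<in> ball p r \<Longrightarrow> x \<in> frontier \<Omega> \<Longrightarrow> reflect m n x = x"
proof -
  obtain r0 m n where c: "r0 > 0" "smooth_on UNIV m" "norm n = 1"
    "\<And>x y. x \<in> ball p r0 \<Longrightarrow> y \<in> ball p r0 \<Longrightarrow> \<bar>m y - m x - n \<bullet> (y - x)\<bar> \<le> norm (y - x) / 10"
    "\<And>x. x \<in> ball p r0 \<Longrightarrow> norm (grad m x - n) \<le> 1 / 10"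
    "\<And>x. x \<in> ball p r0 \<Longrightarrow> x \<in> \<Omega> \<longleftrightarrow> m x < 0"
    "\<And>x. x \<in> ball p r0 \<Longrightarrow> x \<in> frontier \<Omega> \<Longrightarrow> m x = 0"
    using boundary_chart[OF \<Omega> p] by metis
  obtain s0 where s0: "s0 > 0" "ball p s0 \<subseteq> A" using A openE by blast
  define r where "r = min r0 s0 / 4"
  have r: "r > 0" "4 * r \<le> r0" "4 * r \<le> s0" using c s0 by (auto simp: r_def)
  have b0: "x \<in> ball p r0" if "x \<in> ball p r" for x using that r by auto
  have pb: "p \<in> ball p r0" using c by simp
  have nn: "n \<bullet> n = 1" using c(3) by (simp add: power2_norm_eq_inner[symmetric])
  \<comment> \<open>\<open>m\<close> vanishes at \<open>p\<close> and has slope at most 1.1; moving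
    by \<open>2 m\<close> then at most multiplies the distance to \<open>p\<close> by 3.2, which
    \<open>Tb\<close> rounds up to 4.\<close>
  have mb: "\<bar>m x\<bar> \<le> 1.1 * norm (x - p)" if "x \<in> ball p r" for x
  proof -
    have "\<bar>m x - m p - n \<bullet> (x - p)\<bar> \<le> norm (x - p) / 10" by (rule c(4)[OF pb b0[OF that]])
    moreover have "\<bar>n \<bullet> (x - p)\<bar> \<le> norm (x - p)" using Cauchy_Schwarz_ineq2[of n "x - p"] c(3) by simp
    ultimately show ?thesis using c(7)[OF pb p] by linarith
  qed
  have Tb: "dist p (reflect m n x) < 4 * r" if x: "x \<in> ball p r" for x
  proof -
    have "norm (reflect m n x - p) \<le> norm (x - p) + norm ((2 * m x) *\<^sub>R n)"
      unfolding reflect_def using norm_triangle_ineq4[of "x - p" "(2 * m x) *\<^sub>R n"] by (simp add: algebra_simps)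
    also have "\<dots> \<le> norm (x - p) + 2.2 * norm (x - p)" using mb[OF x] c(3) by simp
    also have "\<dots> < 4 * r" using x r by (simp add: dist_norm norm_minus_commute)
    finally show ?thesis by (simp add: dist_norm norm_minus_commute)
  qed
  show ?thesis
  proof (rule that[OF r(1) c(2,3)])
    show "norm (grad m x - n) \<le> 1 / 10" if "x \<in> ball p r" for x using c(5)[OF b0[OF that]] .
    show "reflect m n x = x" if "x \<in> ball p r" "x \<in> frontier \<Omega>" for x
      using c(7)[OF b0[OF that(1)] that(2)] by (simp add: reflect_def)
    show "reflect m n ` (\<Omega> \<inter> ball p r) \<subseteq> A - \<Omega>"
    proof
      fix y assume "y \<in> reflect m n ` (\<Omega> \<inter> ball p r)"
      then obtain x where x: "x \<in> \<Omega>" "x \<in> ball p r" "y = reflect m n x" by auto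
      have yb: "y \<in> ball p r0" "y \<in> A" using Tb[OF x(2)] x(3) r s0 by auto
      have d: "y - x = (- 2 * m x) *\<^sub>R n" by (simp add: x(3) reflect_def)
      have "\<bar>m y - m x - n \<bullet> (y - x)\<bar> \<le> norm (y - x) / 10" by (rule c(4)[OF b0[OF x(2)] yb(1)])
      \<comment> \<open>The step has length \<open>2 |m x|\<close> along \<open>n\<close>, so
        \<open>m\<close> changes by \<open>- 2 m x\<close> up to a tenth of that length. The sign of
        \<open>m\<close> flips.\<close>
      then have "\<bar>m y + m x\<bar> \<le> \<bar>m x\<bar> / 5" unfolding d using nn c(3) by (simp add: abs_mult add.commute)
      moreover have "m x < 0" using c(6)[OF b0[OF x(2)]] x(1) by simp
      ultimately have "m y > 0" by linarith
      then show "y \<in> A - \<Omega>" using c(6)[OF yb(1)] yb(2) by auto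
    qed
    show "inj_on (reflect m n) (\<Omega> \<inter> ball p r)"
    proof (rule inj_onI)
      fix x y assume x: "x \<in> \<Omega> \<inter> ball p r" and y: "y \<in> \<Omega> \<inter> ball p r" and e: "reflect m n x = reflect m n y"
      define w where "w = y - x"
      define k where "k = m y - m x"
      have w: "w = (2 * k) *\<^sub>R n" using e by (simp add: w_def k_def reflect_def algebra_simps)
      have "\<bar>k - n \<bullet> w\<bar> \<le> norm w / 10" unfolding k_def w_def by (rule c(4)) (use x y b0 in auto)
      \<comment> \<open>Two points with the same image differ by \<open>2 k n\<close>, along which
        \<open>m\<close> would have to grow by about \<open>2 k\<close> instead of
        \<open>k\<close>.\<close>
      then have "\<bar>k - 2 * k\<bar> \<le> \<bar>k\<bar> / 5" unfolding w using nn c(3) by simp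
      then have "k = 0" by (simp add: abs_if split: if_splits)
      then show "x = y" using w by (simp add: w_def)
    qed
  qed
qed

text \<open>\<open>\<theta> * \<psi>\<close> and \<open>\<theta> * (\<psi> o T)\<close> agree on the
  frontier, since \<open>T\<close> fixes it where \<open>\<theta>\<close> lives. So \<open>F\<close>
  pairs equally with both gradients, and inside \<open>\<Omega>\<close> the second function sees
  \<open>\<psi>\<close> only at exterior points of the collar.\<close>

lemma transferable_local:
  assumes \<Omega>: "open \<Omega>" "bounded \<Omega>" "smooth_boundary \<Omega>" and p: "p \<in> frontier \<Omega>" and A: "open A" "p \<in> A"
  obtains r where "r > 0" "\<And>\<theta>. smooth_on UNIV \<theta> \<Longrightarrow> (\<And>x. dist p x \<ge> r \<Longrightarrow> \<theta> x = 0) \<Longrightarrow> transferable \<Omega> R A \<theta>"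
proof -
  obtain r m n where c: "r > 0" "smooth_on UNIV m" "norm n = 1" "inj_on (reflect m n) (\<Omega> \<inter> ball p r)"
    "reflect m n ` (\<Omega> \<inter> ball p r) \<subseteq> A - \<Omega>"
    "\<And>x. x \<in> ball p r \<Longrightarrow> norm (grad m x - n) \<le> 1 / 10"
    "\<And>x. x \<in> ball p r \<Longrightarrow> x \<in> frontier \<Omega> \<Longrightarrow> reflect m n x = x"
    using reflection_chart[OF \<Omega>(1,3) p A] by metis
  define T where "T = reflect m n"
  define T' where "T' x = (\<lambda>v. v - (2 * (grad m x \<bullet> v)) *\<^sub>R n)" for x
  have T: "(T has_derivative T' x) (at x)" for x
    unfolding T_def T'_def by (rule reflect_has_derivative[OF c(2)])
  have det: "det (matrix (T' x)) = 1 - 2 * (grad m x \<bullet> n)" for x unfolding T'_def by (rule det_reflect)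
  have dc: "continuous_on UNIV (\<lambda>x. det (matrix (T' x)))"
    unfolding det by (intro continuous_intros continuous_on_grad c)
  have gn: "\<bar>grad m x \<bullet> n - 1\<bar> \<le> 1 / 10" "norm (grad m x) \<le> 2" if "x \<in> ball p r" for x
  proof -
    have "grad m x \<bullet> n - 1 = (grad m x - n) \<bullet> n" using c(3) by (simp add: inner_diff_left power2_norm_eq_inner[symmetric])
    also have "\<bar>\<dots>\<bar> \<le> norm (grad m x - n) * norm n" by (rule Cauchy_Schwarz_ineq2)
    finally show "\<bar>grad m x \<bullet> n - 1\<bar> \<le> 1 / 10" using c(3) c(6)[OF that] by simp
    show "norm (grad m x) \<le> 2" using norm_triangle_ineq[of "grad m x - n" n] c(3) c(6)[OF that] by simp
  qed
  have Tn: "norm (T' x v) \<le> 5 * norm v" if "x \<in> ball p r" for x v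
  proof -
    have "norm (T' x v) \<le> norm v + 2 * \<bar>grad m x \<bullet> v\<bar>"
      unfolding T'_def using norm_triangle_ineq4[of v "(2 * (grad m x \<bullet> v)) *\<^sub>R n"] c(3) by simp
    also have "\<bar>grad m x \<bullet> v\<bar> \<le> norm (grad m x) * norm v" by (rule Cauchy_Schwarz_ineq2)
    also have "\<dots> \<le> 2 * norm v" using gn(2)[OF that] by (intro mult_right_mono) auto
    finally show ?thesis by simp
  qed
  define S where "S = \<Omega> \<inter> ball p r"
  have S: "open S" "bounded S" "S \<subseteq> ball p r" using \<Omega> by (auto simp: S_def intro: bounded_subset)
  have [measurable]: "\<Omega> \<in> sets borel" "S \<in> sets borel" "A \<in> sets borel" using \<Omega> S A by auto
  show ?thesis
  proof (rule that[of "r / 2"])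
    show "r / 2 > 0" using c by simp
    fix \<theta> assume \<theta>: "smooth_on UNIV \<theta>" "\<And>x. dist p x \<ge> r / 2 \<Longrightarrow> \<theta> x = 0"
    have "continuous_on (cball p r) (\<lambda>x. \<bar>\<theta> x\<bar> + norm (grad \<theta> x))"
      by (intro continuous_intros continuous_on_subset[OF smooth_on_continuous_on[OF \<theta>(1)]] continuous_on_subset[OF continuous_on_grad[OF \<theta>(1)]]) auto
    from continuous_bounded_on_compact[OF this compact_cball]
    obtain M where M00: "M \<ge> 0" and M0: "\<And>x. x \<in> cball p r \<Longrightarrow> norm (\<bar>\<theta> x\<bar> + norm (grad \<theta> x)) \<le> M" by blast
    have M: "\<bar>\<theta> x\<bar> \<le> M" "norm (grad \<theta> x) \<le> M" if "x \<in> ball p r" for x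
    proof -
      have "\<bar>\<theta> x\<bar> + norm (grad \<theta> x) \<le> M" using M0[of x] that by simp
      then show "\<bar>\<theta> x\<bar> \<le> M" "norm (grad \<theta> x) \<le> M" using norm_ge_zero[of "grad \<theta> x"] by linarith+
    qed
    \<comment> \<open>\<open>C^2 = 100 M^2\<close> is the pointwise factor \<open>50 M^2\<close> of
      \<open>kb\<close> times the factor 2 from the Jacobian bound.\<close>
    define C where "C = 10 * M"
    have "\<bar>ip F (grad (\<lambda>x. \<theta> x * (\<phi> x - c')))\<bar> \<le> C * sqrt (ip F F) * sqrt X"
      if F: "dfield \<Omega> R F" and \<phi>: "smooth_on UNIV \<phi>" and X: "X \<ge> 0"
        "collar_energy \<Omega> A \<phi> c' \<le> ennreal X" for F \<phi> c' X
    proof -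
      have bF: "bfield R F" and F0: "\<And>x. x \<notin> \<Omega> \<Longrightarrow> F x = 0" using F by (auto simp: dfield_def)
      define \<psi> where "\<psi> x = \<phi> x - c'" for x
      have \<psi>: "smooth_on UNIV \<psi>" unfolding \<psi>_def by (intro smooth_on_diff \<phi> smooth_on_const open_UNIV)
      have g\<psi>: "grad \<psi> x = grad \<phi> x" for x
        by (rule grad_eqI) (use has_derivative_diff[OF has_derivative_grad[OF \<phi>, of x] has_derivative_const[of c']] in \<open>auto simp: \<psi>_def[abs_def]\<close>)
      have \<psi>T: "smooth_on UNIV (\<lambda>x. \<psi> (T x))" unfolding T_def by (rule smooth_on_reflect[OF c(2) \<psi>])
      define k where "k x = \<theta> x * \<psi> (T x)" for x
      have k: "smooth_on UNIV k" unfolding k_def by (intro smooth_on_mult \<theta> \<psi>T open_UNIV)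
      have h: "smooth_on UNIV (\<lambda>x. \<theta> x * \<psi> x - k x)" by (intro smooth_on_diff smooth_on_mult \<theta> \<psi> k open_UNIV)
      have h0: "ip F (grad (\<lambda>x. \<theta> x * \<psi> x - k x)) = 0"
      proof (rule dfield_orthogonal[OF \<Omega>(1,2) F h])
        fix x assume x: "x \<in> frontier \<Omega>"
        show "\<theta> x * \<psi> x - k x = 0"
        proof (cases "x \<in> ball p r")
          case True then show ?thesis using c(7)[OF True x] by (simp add: k_def T_def)
        next
          case False then show ?thesis using \<theta>(2)[of x] c(1) by (simp add: k_def)
        qed
      qed
      have "ip F (grad (\<lambda>x. \<theta> x * \<psi> x)) = ip F (grad (\<lambda>x. (\<theta> x * \<psi> x - k x) + k x))" by simp
      also have "\<dots> = ip F (grad k)" unfolding ip_grad_add[OF bF h k] h0 by simp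
      finally have e1: "ip F (grad (\<lambda>x. \<theta> x * \<psi> x)) = ip F (grad k)" .
      have [measurable]: "grad k \<in> borel_measurable borel" by (rule measurable_grad[OF k])
      have [measurable]: "F \<in> borel_measurable borel" using bF by (simp add: bfield_def)
      have kz: "grad k x = 0" if "x \<notin> ball p r" for x
        by (rule grad_eq_0_outside[of "cball p (r / 2)"]) (use that c(1) in \<open>auto simp: k_def \<theta>(2)\<close>)
      define f where "f x = (\<phi> x - c')\<^sup>2 + (norm (grad \<phi> x))\<^sup>2" for x
      have fc: "continuous_on UNIV f" unfolding f_def
        by (intro continuous_intros smooth_on_continuous_on[OF \<phi>] continuous_on_grad[OF \<phi>])
      have f0: "f x \<ge> 0" for x by (simp add: f_def)
      have kb: "(norm (grad k x))\<^sup>2 \<le> 50 * M\<^sup>2 * f (T x)" if x: "x \<in> ball p r" for x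
      proof -
        define a where "a = norm (grad \<phi> (T x))"
        define b where "b = \<bar>\<psi> (T x)\<bar>"
        have kd: "(k has_derivative (\<lambda>v. \<theta> x * (grad \<psi> (T x) \<bullet> T' x v) + (grad \<theta> x \<bullet> v) * \<psi> (T x))) (at x)"
          unfolding k_def[abs_def]
          by (intro has_derivative_mult has_derivative_grad[OF \<theta>(1)] has_derivative_compose[OF T has_derivative_grad[OF \<psi>]] UNIV_I)
        \<comment> \<open>Taking \<open>v = grad k x\<close> turns the formula for the derivative
          into a bound on the norm, without forming the adjoint of \<open>T' x\<close>.\<close>
        have "grad k x \<bullet> v = \<theta> x * (grad \<psi> (T x) \<bullet> T' x v) + (grad \<theta> x \<bullet> v) * \<psi> (T x)" for v
          by (rule fun_cong[OF has_derivative_unique[OF has_derivative_grad[OF k UNIV_I] kd]])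
        then have "(norm (grad k x))\<^sup>2 = \<theta> x * (grad \<psi> (T x) \<bullet> T' x (grad k x)) + (grad \<theta> x \<bullet> grad k x) * \<psi> (T x)"
          by (simp add: power2_norm_eq_inner)
        also have "\<dots> \<le> \<bar>\<theta> x\<bar> * \<bar>grad \<psi> (T x) \<bullet> T' x (grad k x)\<bar> + \<bar>grad \<theta> x \<bullet> grad k x\<bar> * \<bar>\<psi> (T x)\<bar>"
          by (metis abs_mult abs_ge_self add_mono)
        also have "\<dots> \<le> M * (a * (5 * norm (grad k x))) + (M * norm (grad k x)) * b"
        proof -
          have "\<bar>grad \<psi> (T x) \<bullet> T' x (grad k x)\<bar> \<le> a * (5 * norm (grad k x))"
            unfolding g\<psi> a_def
            by (rule order_trans[OF Cauchy_Schwarz_ineq2 mult_left_mono[OF Tn[OF x]]]) simp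
          moreover have "\<bar>grad \<theta> x \<bullet> grad k x\<bar> \<le> M * norm (grad k x)"
            by (rule order_trans[OF Cauchy_Schwarz_ineq2 mult_right_mono[OF M(2)[OF x]]]) simp
          ultimately show ?thesis unfolding b_def using M(1)[OF x] M00
            by (intro add_mono mult_mono) (auto simp: a_def)
        qed
        also have "\<dots> = norm (grad k x) * (M * (5 * a + b))" by (simp add: algebra_simps)
        finally have "norm (grad k x) * norm (grad k x) \<le> norm (grad k x) * (M * (5 * a + b))" by (simp add: power2_eq_square)
        then have "norm (grad k x) \<le> M * (5 * a + b)"
          using M00 by (cases "norm (grad k x) = 0") (auto simp: a_def b_def)
        then have "(norm (grad k x))\<^sup>2 \<le> (M * (5 * a + b))\<^sup>2" by (intro power_mono) auto
        also have "\<dots> = M\<^sup>2 * (5 * a + b)\<^sup>2" by (simp add: power_mult_distrib)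
        also have "\<dots> \<le> M\<^sup>2 * (50 * (b\<^sup>2 + a\<^sup>2))"
        proof (rule mult_left_mono)
          have "0 \<le> (5 * a - b)\<^sup>2 + 48 * b\<^sup>2" by simp
          then show "(5 * a + b)\<^sup>2 \<le> 50 * (b\<^sup>2 + a\<^sup>2)" by (simp add: power2_eq_square algebra_simps)
        qed simp
        also have "\<dots> = 50 * M\<^sup>2 * f (T x)" by (simp add: f_def a_def b_def \<psi>_def)
        finally show ?thesis .
      qed
      have cov: "(\<integral>\<^sup>+x. indicator S x * ennreal (f (T x)) \<partial>lborel) \<le> 2 * (\<integral>\<^sup>+y. indicator (A - \<Omega>) y * ennreal (f y) \<partial>lborel)"
      proof (rule nn_integral_change_of_variables_le[OF S(1,2) _ _ T _ dc _ fc f0])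
        show "T ` S \<subseteq> A - \<Omega>" "inj_on T S" using c(4,5) by (auto simp: T_def S_def)
        show "1 / 2 \<le> \<bar>det (matrix (T' x))\<bar>" if "x \<in> S" for x
          using gn(1)[of x] that S(3) unfolding det by (auto simp: abs_if split: if_splits)
      qed auto
      have "(\<integral>\<^sup>+x. ennreal ((norm (indicator S x *\<^sub>R grad k x))\<^sup>2) \<partial>lborel) \<le> (\<integral>\<^sup>+x. ennreal (50 * M\<^sup>2) * (indicator S x * ennreal (f (T x))) \<partial>lborel)"
      proof (rule nn_integral_mono)
        fix x
        show "ennreal ((norm (indicator S x *\<^sub>R grad k x))\<^sup>2) \<le> ennreal (50 * M\<^sup>2) * (indicator S x * ennreal (f (T x)))"
        proof (cases "x \<in> S")
          case True
          then have "(norm (grad k x))\<^sup>2 \<le> 50 * M\<^sup>2 * f (T x)" using kb S(3) by blast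
          then have "ennreal ((norm (grad k x))\<^sup>2) \<le> ennreal (50 * M\<^sup>2 * f (T x))" by (rule ennreal_leI)
          also have "\<dots> = ennreal (50 * M\<^sup>2) * ennreal (f (T x))" by (rule ennreal_mult) (auto simp: f0)
          finally show ?thesis using True by simp
        qed simp
      qed
      also have "\<dots> = ennreal (50 * M\<^sup>2) * (\<integral>\<^sup>+x. indicator S x * ennreal (f (T x)) \<partial>lborel)"
      proof (rule nn_integral_cmult)
        have "continuous_on UNIV T" using T by (auto intro!: continuous_at_imp_continuous_on has_derivative_continuous)
        then have [measurable]: "T \<in> borel_measurable borel" by (rule borel_measurable_continuous_onI)
        have [measurable]: "f \<in> borel_measurable borel" using fc by (rule borel_measurable_continuous_onI)
        show "(\<lambda>x. indicator S x * ennreal (f (T x))) \<in> borel_measurable lborel" by measurable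
      qed
      also have "\<dots> \<le> ennreal (50 * M\<^sup>2) * (2 * ennreal X)"
        by (intro mult_left_mono order_trans[OF cov] X(2)[unfolded collar_energy_def, folded f_def]) auto
      also have "\<dots> = ennreal (C\<^sup>2 * X)"
      proof -
        have "C\<^sup>2 * X = 50 * M\<^sup>2 * (2 * X)" by (simp add: C_def power2_eq_square)
        moreover have "2 * ennreal X = ennreal (2 * X)" by (simp add: ennreal_mult')
        moreover have "ennreal (50 * M\<^sup>2) * ennreal (2 * X) = ennreal (50 * M\<^sup>2 * (2 * X))"
          using X(1) by (intro ennreal_mult[symmetric]) auto
        ultimately show ?thesis by (simp only:)
      qed
      finally have nb: "(\<integral>\<^sup>+x. ennreal ((norm (indicator S x *\<^sub>R grad k x))\<^sup>2) \<partial>lborel) \<le> ennreal (C\<^sup>2 * X)" .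
      have ki: "integrable lborel (\<lambda>x. (norm (indicator S x *\<^sub>R grad k x))\<^sup>2)"
        using le_less_trans[OF nb ennreal_less_top] by (intro integrableI_nonneg) auto
      have kX: "(\<integral>x. (norm (indicator S x *\<^sub>R grad k x))\<^sup>2 \<partial>lborel) \<le> C\<^sup>2 * X"
        using nb X(1) by (subst (asm) nn_integral_eq_integral[OF ki]) (auto simp: ennreal_le_iff)
      have "ip F (grad k) = ip F (\<lambda>x. indicator S x *\<^sub>R grad k x)"
      proof (rule Bochner_Integration.integral_cong[OF refl])
        fix x
        show "F x \<bullet> grad k x = F x \<bullet> (indicator S x *\<^sub>R grad k x)"
          using F0[of x] kz[of x] by (cases "x \<in> \<Omega>"; cases "x \<in> ball p r") (simp_all add: S_def)
      qed
      also have "\<bar>\<dots>\<bar> \<le> sqrt (\<integral>x. (norm (F x))\<^sup>2 \<partial>lborel) * sqrt (\<integral>x. (norm (indicator S x *\<^sub>R grad k x))\<^sup>2 \<partial>lborel)"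
        by (rule L2_inner(4)) (use ki bF in \<open>auto simp: bfield_def\<close>)
      also have "\<dots> \<le> sqrt (\<integral>x. (norm (F x))\<^sup>2 \<partial>lborel) * sqrt (C\<^sup>2 * X)"
        using kX by (intro mult_left_mono) auto
      also have "\<dots> = C * sqrt (ip F F) * sqrt X"
        using M00 by (simp add: C_def real_sqrt_mult power2_norm_eq_inner)
      finally show ?thesis using e1 by (simp add: \<psi>_def)
    qed
    then show "transferable \<Omega> R A \<theta>"
      unfolding transferable_def using \<theta>(1) M00 by (intro conjI exI[of _ C]) (auto simp: C_def)
  qed
qed

text \<open>The product \<open>w I\<close> of the factors \<open>1 - \<eta> p\<close> vanishes on
  the frontier, so only the part of \<open>\<phi> - c\<close> weighted by \<open>1 - w I\<close> is
  seen by \<open>F\<close>. That weight is a sum of local ones, and \<open>c\<close> is chosen by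
  the Poincare inequality of the collar.\<close>

lemma exterior_energy_bound:
  assumes \<Omega>: "open \<Omega>" "bounded \<Omega>" "smooth_boundary \<Omega>" and conn: "connected (frontier \<Omega>)"
  obtains K where "K > 0" "\<And>F \<phi>. dfield \<Omega> R F \<Longrightarrow> smooth_on UNIV \<phi> \<Longrightarrow> integrable lborel (\<lambda>x. (norm (grad \<phi> x))\<^sup>2) \<Longrightarrow>
      \<bar>ip F (grad \<phi>)\<bar> \<le> K * sqrt (ip F F) * sqrt (\<integral>x. indicator (- \<Omega>) x * (norm (grad \<phi> x))\<^sup>2 \<partial>lborel)"
proof -
  obtain A where A: "open A" "bounded A" "frontier \<Omega> \<subseteq> A" "poincare \<Omega> A"
    using poincare_collar[OF assms] by metis
  have [measurable]: "\<Omega> \<in> sets borel" "A \<in> sets borel" using \<Omega> A by auto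
  have "\<exists>r>0. \<forall>\<theta>. smooth_on UNIV \<theta> \<longrightarrow> (\<forall>x. dist p x \<ge> r \<longrightarrow> \<theta> x = 0) \<longrightarrow> transferable \<Omega> R A \<theta>" if "p \<in> frontier \<Omega>" for p
    using transferable_local[OF \<Omega> that A(1), of R] A(3) that by (metis subsetD)
  then obtain r where r: "\<And>p. p \<in> frontier \<Omega> \<Longrightarrow> r p > 0"
    "\<And>p \<theta>. p \<in> frontier \<Omega> \<Longrightarrow> smooth_on UNIV \<theta> \<Longrightarrow> (\<forall>x. dist p x \<ge> r p \<longrightarrow> \<theta> x = 0) \<Longrightarrow> transferable \<Omega> R A \<theta>"
    by metis
  have "\<exists>\<eta>. smooth_on UNIV \<eta> \<and> (\<forall>x. dist p x \<le> r p / 2 \<longrightarrow> \<eta> x = 1) \<and> (\<forall>x. dist p x \<ge> r p \<longrightarrow> \<eta> x = 0)" if "p \<in> frontier \<Omega>" for p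
    using r(1)[OF that] smooth_cutoff[of "r p / 2" "r p" p] by (metis half_gt_zero field_sum_of_halves less_add_same_cancel1)
  then obtain \<eta> where \<eta>: "\<And>p. p \<in> frontier \<Omega> \<Longrightarrow> smooth_on UNIV (\<eta> p)"
    "\<And>p x. p \<in> frontier \<Omega> \<Longrightarrow> dist p x \<le> r p / 2 \<Longrightarrow> \<eta> p x = 1" "\<And>p x. p \<in> frontier \<Omega> \<Longrightarrow> dist p x \<ge> r p \<Longrightarrow> \<eta> p x = 0"
    by metis
  have "compact (frontier \<Omega>)" using \<Omega>(2) by (rule compact_frontier_bounded)
  then obtain I where I: "I \<subseteq> frontier \<Omega>" "finite I" "frontier \<Omega> \<subseteq> (\<Union>q\<in>I. ball q (r q / 2))"
    by (rule compactE_image[of _ "frontier \<Omega>" "\<lambda>q. ball q (r q / 2)"]) (use r in auto)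
  define w where "w J x = (\<Prod>p\<in>J. 1 - \<eta> p x)" for J x
  have ws: "smooth_on UNIV (w J)" if "J \<subseteq> frontier \<Omega>" for J
    unfolding w_def by (intro smooth_on_prod smooth_on_diff smooth_on_const \<eta> open_UNIV) (use that in auto)
  have "J \<subseteq> frontier \<Omega> \<Longrightarrow> transferable \<Omega> R A (\<lambda>x. 1 - w J x)" if "finite J" for J
    using that
  proof (induction J rule: finite_induct)
    case empty
    have "grad (\<lambda>x. 0) x = 0" for x :: "real^3" by (rule grad_eqI[OF has_derivative_const]) simp
    then show ?case by (auto simp: transferable_def w_def intro!: exI[of _ 0])
  next
    case (insert p J)
    \<comment> \<open>The increment of \<open>1 - w J\<close> when \<open>p\<close> joins
      \<open>J\<close>; it is supported near \<open>p\<close>, so the local lemma applies to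
      it.\<close>
    have "transferable \<Omega> R A (\<lambda>x. \<eta> p x * w J x)"
      by (rule r(2)[of p]) (use insert \<eta> ws in \<open>auto intro!: smooth_on_mult\<close>)
    then have "transferable \<Omega> R A (\<lambda>x. (1 - w J x) + \<eta> p x * w J x)"
      using insert by (intro transferable_add) auto
    moreover have "(\<lambda>x. (1 - w J x) + \<eta> p x * w J x) = (\<lambda>x. 1 - w (insert p J) x)"
      using insert by (auto simp: w_def algebra_simps)
    ultimately show ?case by simp
  qed
  from this[OF I(2,1)] obtain C where C: "C \<ge> 0" "\<And>F \<phi> c X. dfield \<Omega> R F \<Longrightarrow> smooth_on UNIV \<phi> \<Longrightarrow> X \<ge> 0 \<Longrightarrow>
     collar_energy \<Omega> A \<phi> c \<le> ennreal X \<Longrightarrow>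
     \<bar>ip F (grad (\<lambda>x. (1 - w I x) * (\<phi> x - c)))\<bar> \<le> C * sqrt (ip F F) * sqrt X"
    unfolding transferable_def by blast
  have wz: "w I x = 0" if x: "x \<in> frontier \<Omega>" for x
  proof -
    obtain q where "q \<in> I" "x \<in> ball q (r q / 2)" using I(3) x by blast
    then have "1 - \<eta> q x = 0" using \<eta>(2)[of q x] I(1) by auto
    then show ?thesis using I(2) \<open>q \<in> I\<close> by (auto simp: w_def)
  qed
  obtain D where D: "D \<ge> 0" "\<And>f. finite_energy f \<Longrightarrow> \<exists>c. sq_dev \<Omega> A f c \<le> ennreal (D * ext_energy \<Omega> f)"
    using A(4) by (auto simp: poincare_def)
  \<comment> \<open>\<open>D + 1\<close> combines the squared deviation with the gradient term of
    the collar energy; the added 1 only ensures positivity.\<close>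
  define K where "K = C * sqrt (D + 1) + 1"
  have K: "K > 0" using C D by (simp add: K_def add_nonneg_pos)
  show ?thesis
  proof (rule that[OF K])
    fix F \<phi> assume F: "dfield \<Omega> R F" and \<phi>: "smooth_on UNIV \<phi>" and fe: "integrable lborel (\<lambda>x. (norm (grad \<phi> x))\<^sup>2)"
    have bF: "bfield R F" using F by (simp add: dfield_def)
    have e: "finite_energy \<phi>" using \<phi> fe by (simp add: finite_energy_def)
    define E where "E = ext_energy \<Omega> \<phi>"
    have E: "E \<ge> 0" by (simp add: E_def ext_energy_nonneg)
    obtain c where c: "sq_dev \<Omega> A \<phi> c \<le> ennreal (D * E)"
      using D(2)[OF e] by (auto simp: E_def)
    have [measurable]: "\<phi> \<in> borel_measurable borel" "grad \<phi> \<in> borel_measurable borel"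
      using smooth_on_continuous_on[OF \<phi>] borel_measurable_continuous_onI measurable_grad[OF \<phi>] by auto
    have "collar_energy \<Omega> A \<phi> c
      \<le> (\<integral>\<^sup>+x. indicator (A - \<Omega>) x * ennreal ((\<phi> x - c)\<^sup>2) + indicator (- \<Omega>) x * ennreal ((norm (grad \<phi> x))\<^sup>2) \<partial>lborel)"
      unfolding collar_energy_def by (intro nn_integral_mono) (auto simp: indicator_def)
    also have "\<dots> = sq_dev \<Omega> A \<phi> c + ennreal E"
      by (simp add: nn_integral_add nn_ext_energy[OF e] E_def sq_dev_def)
    also have "\<dots> \<le> ennreal (D * E) + ennreal E" using c by (intro add_mono) auto
    also have "\<dots> = ennreal ((D + 1) * E)" using D E by (simp add: ennreal_plus[symmetric] distrib_right del: ennreal_plus)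
    finally have "\<bar>ip F (grad (\<lambda>x. (1 - w I x) * (\<phi> x - c)))\<bar> \<le> C * sqrt (ip F F) * sqrt ((D + 1) * E)"
      using D E by (intro C(2)[OF F \<phi>]) auto
    also have "\<dots> = (C * sqrt (D + 1)) * (sqrt (ip F F) * sqrt E)" by (simp add: real_sqrt_mult mult_ac)
    also have "\<dots> \<le> K * (sqrt (ip F F) * sqrt E)"
      using E by (intro mult_right_mono) (auto simp: K_def power2_norm_eq_inner[symmetric])
    finally have b: "\<bar>ip F (grad (\<lambda>x. (1 - w I x) * (\<phi> x - c)))\<bar> \<le> K * sqrt (ip F F) * sqrt E" by (simp add: mult.assoc)
    have s1: "smooth_on UNIV (\<lambda>x. (1 - w I x) * (\<phi> x - c))" "smooth_on UNIV (\<lambda>x. w I x * (\<phi> x - c))"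
      by (intro smooth_on_mult smooth_on_diff smooth_on_const ws[OF I(1)] \<phi> open_UNIV)+
    \<comment> \<open>The constant \<open>c\<close> disappears under the gradient, so it may be
      subtracted before splitting by the weights.\<close>
    have "grad \<phi> x = grad (\<lambda>x. (1 - w I x) * (\<phi> x - c) + w I x * (\<phi> x - c)) x" for x
    proof (rule grad_eqI)
      have "(\<phi> has_derivative (\<lambda>v. grad \<phi> x \<bullet> v)) (at x)" by (rule has_derivative_grad[OF \<phi>]) simp
      show "(\<phi> has_derivative (\<lambda>v. grad \<phi> x \<bullet> v)) (at x)" by fact
      have "((\<lambda>x. \<phi> x - c) has_derivative (\<lambda>v. grad \<phi> x \<bullet> v)) (at x)"
        using has_derivative_diff[OF \<open>(\<phi> has_derivative (\<lambda>v. grad \<phi> x \<bullet> v)) (at x)\<close> has_derivative_const[of c]] by simp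
      then have "grad (\<lambda>x. \<phi> x - c) x = grad \<phi> x" by (rule grad_eqI) simp
      then show "grad \<phi> x \<bullet> v = grad (\<lambda>x. (1 - w I x) * (\<phi> x - c) + w I x * (\<phi> x - c)) x \<bullet> v" for v
        by (simp add: algebra_simps)
    qed
    then have "grad \<phi> = grad (\<lambda>x. (1 - w I x) * (\<phi> x - c) + w I x * (\<phi> x - c))" by blast
    then have "ip F (grad \<phi>) = ip F (grad (\<lambda>x. (1 - w I x) * (\<phi> x - c))) + ip F (grad (\<lambda>x. w I x * (\<phi> x - c)))"
      using ip_grad_add[OF bF s1] by simp
    also have "ip F (grad (\<lambda>x. w I x * (\<phi> x - c))) = 0"
      by (rule dfield_orthogonal[OF \<Omega>(1,2) F s1(2)]) (simp add: wz)
    finally show "\<bar>ip F (grad \<phi>)\<bar> \<le> K * sqrt (ip F F) * sqrt (\<integral>x. indicator (- \<Omega>) x * (norm (grad \<phi> x))\<^sup>2 \<partial>lborel)"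
      using b by (simp add: E_def ext_energy_def)
  qed
qed

theorem theorem1:
  fixes \<Omega> :: "(real^3) set"
  assumes "open \<Omega>" and "bounded \<Omega>" and "smooth_boundary \<Omega>"
    and "connected (frontier \<Omega>)"
  shows "(\<exists>C\<ge>0. \<forall>F. closed2 \<Omega> F \<longrightarrow>
            closed2 \<Omega> (B_op \<Omega> F) \<and>
            sqrt (l2_inner \<Omega> (B_op \<Omega> F) (B_op \<Omega> F)) \<le> C * sqrt (l2_inner \<Omega> F F))
       \<and> (\<forall>F G. closed2 \<Omega> F \<longrightarrow> closed2 \<Omega> G \<longrightarrow>
            l2_inner \<Omega> (B_op \<Omega> F) G = l2_inner \<Omega> F (B_op \<Omega> G))
       \<and> (\<exists>m. 0 < m \<and> m < 1 \<and>
            (\<forall>F. closed2 \<Omega> F \<longrightarrow> l2_inner \<Omega> F F \<noteq> 0 \<longrightarrow>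
               -1 < -m \<and> -m < l2_inner \<Omega> (B_op \<Omega> F) F / l2_inner \<Omega> F F \<and>
               l2_inner \<Omega> (B_op \<Omega> F) F / l2_inner \<Omega> F F \<le> 0))"
proof -
  obtain R0 where "\<And>x. x \<in> \<Omega> \<Longrightarrow> norm x \<le> R0" using assms(2) by (auto simp: bounded_iff)
  then have R: "\<Omega> \<subseteq> cball 0 (max R0 0)" by force
  define R where "R = max R0 0"
  interpret domain \<Omega> R by unfold_locales (use assms R in \<open>auto simp: R_def\<close>)
  \<comment> \<open>Norms, pairings and \<open>B_op\<close> are all unchanged by passing to the
    representative, so the three claims reduce to Borel fields.\<close>
  have rep: "\<exists>F0 N. dfield \<Omega> R F0 \<and> negligible N \<and> (\<forall>x\<in>\<Omega>. x \<notin> N \<longrightarrow> F0 x = F x)" if "closed2 \<Omega> F" for F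
    using closed2_representative[OF op sub that] by metis
  have inner: "l2_inner \<Omega> F G = ip F0 G0"
    if "dfield \<Omega> R F0" "negligible N" "\<forall>x\<in>\<Omega>. x \<notin> N \<longrightarrow> F0 x = F x"
      "dfield \<Omega> R G0" "negligible M" "\<forall>x\<in>\<Omega>. x \<notin> M \<longrightarrow> G0 x = G x" for F G F0 G0 N M
    by (rule l2_inner_eq[of N _ _ _ M]) (use that dfieldD in auto)
  have innerB: "l2_inner \<Omega> (B_op \<Omega> F) G = ip (B_op \<Omega> F0) G0" "l2_inner \<Omega> G (B_op \<Omega> F) = ip G0 (B_op \<Omega> F0)"
    "l2_inner \<Omega> (B_op \<Omega> F) (B_op \<Omega> F) = ip (B_op \<Omega> F0) (B_op \<Omega> F0)" "B_op \<Omega> F = B_op \<Omega> F0"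
    if F: "dfield \<Omega> R F0" "negligible N" "\<forall>x\<in>\<Omega>. x \<notin> N \<longrightarrow> F0 x = F x"
      and G: "dfield \<Omega> R G0" "negligible M" "\<forall>x\<in>\<Omega>. x \<notin> M \<longrightarrow> G0 x = G x" for F G F0 G0 N M
  proof -
    show e: "B_op \<Omega> F = B_op \<Omega> F0" by (rule B_op_cong[symmetric, of N]) (use F in auto)
    show "l2_inner \<Omega> (B_op \<Omega> F) G = ip (B_op \<Omega> F0) G0" unfolding e
      by (rule inner[OF B_dfield[OF F(1)] negligible_empty _ G]) simp
    show "l2_inner \<Omega> G (B_op \<Omega> F) = ip G0 (B_op \<Omega> F0)" unfolding e
      by (rule inner[OF G B_dfield[OF F(1)] negligible_empty]) simp
    show "l2_inner \<Omega> (B_op \<Omega> F) (B_op \<Omega> F) = ip (B_op \<Omega> F0) (B_op \<Omega> F0)" unfolding e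
      by (rule inner[OF B_dfield[OF F(1)] negligible_empty _ B_dfield[OF F(1)] negligible_empty]) simp_all
  qed
  have 1: "closed2 \<Omega> (B_op \<Omega> F) \<and> sqrt (l2_inner \<Omega> (B_op \<Omega> F) (B_op \<Omega> F)) \<le> 1 * sqrt (l2_inner \<Omega> F F)" if cF: "closed2 \<Omega> F" for F
  proof -
    obtain F0 N where F: "dfield \<Omega> R F0" "negligible N" "\<forall>x\<in>\<Omega>. x \<notin> N \<longrightarrow> F0 x = F x" using rep[OF cF] by blast
    show ?thesis
      unfolding innerB(3)[OF F F] inner[OF F F]
      unfolding innerB(4)[OF F F]
      using dfield_imp_closed2[OF op B_dfield[OF F(1)]] B_L2(2)[OF F(1)] by (simp add: power2_norm_eq_inner)
  qed
  have 2: "l2_inner \<Omega> (B_op \<Omega> F) G = l2_inner \<Omega> F (B_op \<Omega> G)" if cF: "closed2 \<Omega> F" and cG: "closed2 \<Omega> G" for F G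
  proof -
    obtain F0 N where F: "dfield \<Omega> R F0" "negligible N" "\<forall>x\<in>\<Omega>. x \<notin> N \<longrightarrow> F0 x = F x" using rep[OF cF] by blast
    obtain G0 M where G: "dfield \<Omega> R G0" "negligible M" "\<forall>x\<in>\<Omega>. x \<notin> M \<longrightarrow> G0 x = G x" using rep[OF cG] by blast
    show ?thesis unfolding innerB(1)[OF F G] innerB(2)[OF G F] by (rule B_symmetric[OF F(1) G(1)])
  qed
  obtain K where K: "K > 0" "\<And>F \<phi>. dfield \<Omega> R F \<Longrightarrow> smooth_on UNIV \<phi> \<Longrightarrow> integrable lborel (\<lambda>x. (norm (grad \<phi> x))\<^sup>2) \<Longrightarrow>
      \<bar>ip F (grad \<phi>)\<bar> \<le> K * sqrt (ip F F) * sqrt (\<integral>x. indicator (- \<Omega>) x * (norm (grad \<phi> x))\<^sup>2 \<partial>lborel)"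
    by (rule exterior_energy_bound[OF assms, where R=R]) (rule that)
  define k where "k = sqrt (K\<^sup>2 / (1 + K\<^sup>2))"
  have k: "0 \<le> k" "k < 1"
  proof -
    show "0 \<le> k" by (simp add: k_def)
    have "K\<^sup>2 / (1 + K\<^sup>2) < 1" by (simp add: divide_less_eq add_pos_nonneg)
    then show "k < 1" by (simp add: k_def)
  qed
  \<comment> \<open>The midpoint between \<open>k\<close> and 1 makes the lower bound strict and
    \<open>m\<close> positive while staying below 1.\<close>
  define m where "m = (k + 1) / 2"
  have m: "0 < m" "m < 1" "k < m" using k by (auto simp: m_def)
  have 3: "-1 < -m \<and> -m < l2_inner \<Omega> (B_op \<Omega> F) F / l2_inner \<Omega> F F \<and> l2_inner \<Omega> (B_op \<Omega> F) F / l2_inner \<Omega> F F \<le> 0"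
    if cF: "closed2 \<Omega> F" and nz: "l2_inner \<Omega> F F \<noteq> 0" for F
  proof -
    obtain F0 N where F: "dfield \<Omega> R F0" "negligible N" "\<forall>x\<in>\<Omega>. x \<notin> N \<longrightarrow> F0 x = F x" using rep[OF cF] by blast
    have e: "l2_inner \<Omega> F F = ip F0 F0" "l2_inner \<Omega> (B_op \<Omega> F) F = ip (B_op \<Omega> F0) F0"
      using inner[OF F F] innerB(1)[OF F F] by auto
    have "ip F0 F0 \<ge> 0" by (rule integral_nonneg_AE) simp
    then have p: "ip F0 F0 > 0" using nz e by linarith
    have "- ip (B_op \<Omega> F0) F0 \<le> k * ip F0 F0"
      unfolding k_def by (rule B_lower_bound[OF K F(1)])
    also have "\<dots> < m * ip F0 F0" using m p by (intro mult_strict_right_mono)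
    finally show ?thesis unfolding e using p m B_nonpos[OF F(1)]
      by (simp add: less_divide_eq divide_le_0_iff)
  qed
  show ?thesis using 1 2 3 m zero_le_one by blast
qed

end
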